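(* Let $K,L$ be positive integers with $L\ge 10$ and $\frac{3L}{2}\le K\le 3L-2$. Let $m_0$ be a trigonometric polynomial with real coefficients, $m_0(0)=1$ and $$|m_0(\xi_1)|^2=(\cos(\pi\xi_1))^{2K}\sum_{n=0}^{L-1}\binom{K-1+n}{n}(\sin(\pi\xi_1))^{2n},\qquad \xi_1\in\mathbb{R},$$ let $m_1$ be a trigonometric polynomial with $|m_1(\xi_1)|^2=|m_0(\xi_1+\frac12)|^2$ for $\xi_1\in\mathbb{R}$, let $\phi$ be the scaling function given by $\hat\phi(\xi_1)=\prod_{j=0}^\infty m_0(2^{-j}\xi_1)$, $\xi_1\in\mathbb{R}$, and define $\psi\in L^2(\mathbb{R}^2)$ by $$\hat\psi(\xi)=m_1(4\xi_1)\,\hat\phi(\xi_1)\,\hat\phi(2\xi_2),\qquad \xi=(\xi_1,\xi_2)\in\mathbb{R}^2.$$ For $c=(c_1,c_2)\in(\mathbb{R}^+)^2$ let $$\mathcal{SH}(\Lambda,\psi)=\{\psi_{j,k,m}=2^{3j/4}\psi(S_{-k}A_{2^j}\,\cdot\,-M_cm): j\ge0,\ |k|\le\lceil2^{j/2}\rceil,\ m\in\mathbb{Z}^2\}$$ be the shearlet system associated with the regular sampling set $\Lambda=\{(2^{-j},k2^{-j/2},S_{k2^{-j/2}}A_{2^{-j}}M_cm): j\ge0,\ |k|\le\lceil 2^{j/2}\rceil,\ m\in\mathbb{Z}^2\}$. Then there exists a sampling constant $\hat c_1>0$ such that $\mathcal{SH}(\Lambda,\psi)$ forms a frame for $L^2(\mathcal{C})$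 for every $c=(c_1,c_2)\in(\mathbb{R}^+)^2$ with $c_2\le c_1\le\hat c_1$. Furthermore, for every such $c$, there exist real numbers $\tilde L_{inf},\tilde L_{sup}$ with $R(c)<\tilde L_{inf}\le L_{inf}$ and $L_{sup}\le\tilde L_{sup}$, and for any such numbers the frame bounds $A$ and $B$ satisfy $$\frac{1}{|\det(M_c)|}\bigl[\tilde L_{inf}-R(c)\bigr]\le A\le B\le\frac{1}{|\det(M_c)|}\bigl[\tilde L_{sup}+R(c)\bigr].$$
   Context: Fourier transform: $\hat f(\xi)=\int f(x)e^{-2\pi i\langle x,\xi\rangle}\,dx$. Trigonometric polynomials are finite linear combinations of $e^{2\pi i n\xi_1}$, $n\in\mathbb{Z}$. Matrices: $A_a=\begin{pmatrix} a&0\\0&\sqrt a\end{pmatrix}$ ($a>0$), $S_s=\begin{pmatrix}1&s\\0&1\end{pmatrix}$ ($s\in\mathbb{R}$), $M_c=\begin{pmatrix}c_1&0\\0&c_2\end{pmatrix}$. Cone: $\mathcal{C}=\{(\xi_1,\xi_2)\in\mathbb{R}^2: |\xi_1|\ge 1,\ |\xi_2/\xi_1|\le 1\}$, and $L^2(\mathcal{C})=\{f\in L^2(\mathbb{R}^2):\operatorname{supp}\hat f\subseteq \mathcal{C}\}$. Associated quantities: for $\xi\in\mathcal{C}$, $\omega\in\mathbb{R}^2$, $$\Phi(\xi,\omega)=\sum_{j\ge0}\ \sum_{|k|\le\lceil 2^{j/2}\rceil}|\hat\psi(S_{k}^TA_{2^{-j}}\xi)|\,|\hat\psi(S_{k}^TA_{2^{-j}}\xi+\omega)|,\qquad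 \Gamma(\omega)=\operatorname*{ess\,sup}_{\xi\in\mathcal{C}}\Phi(\xi,\omega),$$ $$L_{inf}=\operatorname*{ess\,inf}_{\xi\in\mathcal{C}}\Phi(\xi,0),\qquad L_{sup}=\operatorname*{ess\,sup}_{\xi\in\mathcal{C}}\Phi(\xi,0),\qquad R(c)=\sum_{m\in\mathbb{Z}^2\setminus\{0\}}\bigl[\Gamma(M_c^{-1}m)\,\Gamma(-M_c^{-1}m)\bigr]^{1/2}.$$ Frame for $L^2(\mathcal{C})$ with (optimal) frame bounds $0<A\le B<\infty$: $A\|f\|_2^2\le\sum_{j,k,m}|\langle f,\psi_{j,k,m}\rangle|^2\le B\|f\|_2^2$ for all $f\in L^2(\mathcal{C})$ (the elements need not lie in $L^2(\mathcal{C})$; equivalently they are orthogonally projected onto it). *)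

theory Defs
  imports "HOL-Probability.Probability"
begin

text \<open>Elements of the L2 space are represented by Borel functions; every class of
  Lebesgue measurable functions modulo null sets has such a representative.\<close>

definition square_integrable :: "('a::euclidean_space \<Rightarrow> complex) \<Rightarrow> bool" where
  "square_integrable f \<longleftrightarrow>
     f \<in> borel_measurable lborel \<and> integrable lborel (\<lambda>x. (cmod (f x))\<^sup>2)"

definition L2_inner :: "('a::euclidean_space \<Rightarrow> complex) \<Rightarrow> ('a \<Rightarrow> complex) \<Rightarrow> complex" where
  "L2_inner f g = (LINT x|lborel. f x * cnj (g x))"

definition L2_norm :: "('a::euclidean_space \<Rightarrow> complex) \<Rightarrow> real" where
  "L2_norm f = sqrt (LINT x|lborel. (cmod (f x))\<^sup>2)"

definition L2_converges ::
  "(nat \<Rightarrow> 'a::euclidean_space \<Rightarrow> complex) \<Rightarrow> ('a \<Rightarrow> complex) \<Rightarrow> bool" where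
  "L2_converges F f \<longleftrightarrow>
     (\<lambda>n. \<integral>\<^sup>+ x. ennreal ((cmod (F n x - f x))\<^sup>2) \<partial>lborel) \<longlonglongrightarrow> 0"

definition fourier_integral :: "('a::euclidean_space \<Rightarrow> complex) \<Rightarrow> 'a \<Rightarrow> complex" where
  "fourier_integral f \<xi> = (LINT x|lborel. f x * exp (- 2 * of_real pi * \<i> * of_real (x \<bullet> \<xi>)))"

text \<open>The integral only makes sense for integrable functions; on the whole L2 space the
  Fourier transform is its continuous extension. It is determined up to null sets
  only, whence a relation: \<open>g\<close> is a representative of the transform of \<open>f\<close>.\<close>

definition is_fourier_transform ::
  "('a::euclidean_space \<Rightarrow> complex) \<Rightarrow> ('a \<Rightarrow> complex) \<Rightarrow> bool" where
  "is_fourier_transform f g \<longleftrightarrow>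
     square_integrable f \<and> square_integrable g \<and>
     (\<exists>F. (\<forall>n. integrable lborel (F n) \<and> square_integrable (F n)) \<and>
          L2_converges F f \<and> L2_converges (\<lambda>n. fourier_integral (F n)) g)"

text \<open>Support of a class of functions modulo null sets: the complement of the largest
  open set on which the function vanishes almost everywhere.\<close>

definition ess_support :: "('a::euclidean_space \<Rightarrow> complex) \<Rightarrow> 'a set" where
  "ess_support g = - \<Union>{U. open U \<and> (AE \<xi> in lborel. \<xi> \<in> U \<longrightarrow> g \<xi> = 0)}"

text \<open>Here \<open>H\<close> is a space of square-integrable functions; the members of the family
  \<open>g\<close> are square-integrable but need not belong to \<open>H\<close>.\<close>

definition frame_sum ::
  "'i set \<Rightarrow> ('i \<Rightarrow> 'a::euclidean_space \<Rightarrow> complex) \<Rightarrow> ('a \<Rightarrow> complex) \<Rightarrow> ennreal" where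
  "frame_sum I g f = (\<Sum>\<^sub>\<infinity>i\<in>I. ennreal ((cmod (L2_inner f (g i)))\<^sup>2))"

definition lower_frame_bounds ::
  "('a::euclidean_space \<Rightarrow> complex) set \<Rightarrow> 'i set \<Rightarrow> ('i \<Rightarrow> 'a \<Rightarrow> complex) \<Rightarrow> real set" where
  "lower_frame_bounds H I g =
     {A. 0 < A \<and> (\<forall>f\<in>H. ennreal (A * (L2_norm f)\<^sup>2) \<le> frame_sum I g f)}"

definition upper_frame_bounds ::
  "('a::euclidean_space \<Rightarrow> complex) set \<Rightarrow> 'i set \<Rightarrow> ('i \<Rightarrow> 'a \<Rightarrow> complex) \<Rightarrow> real set" where
  "upper_frame_bounds H I g =
     {B. 0 < B \<and> (\<forall>f\<in>H. frame_sum I g f \<le> ennreal (B * (L2_norm f)\<^sup>2))}"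

definition is_frame_for ::
  "('a::euclidean_space \<Rightarrow> complex) set \<Rightarrow> 'i set \<Rightarrow> ('i \<Rightarrow> 'a \<Rightarrow> complex) \<Rightarrow> bool" where
  "is_frame_for H I g \<longleftrightarrow>
     (\<forall>i\<in>I. square_integrable (g i)) \<and>
     (\<exists>A B. A \<le> B \<and> A \<in> lower_frame_bounds H I g \<and> B \<in> upper_frame_bounds H I g)"

text \<open>The optimal bounds; meaningful if the family is a frame for \<open>H\<close> and \<open>H\<close> contains
  a function that is not null.\<close>

definition lower_frame_bound ::
  "('a::euclidean_space \<Rightarrow> complex) set \<Rightarrow> 'i set \<Rightarrow> ('i \<Rightarrow> 'a \<Rightarrow> complex) \<Rightarrow> real" where
  "lower_frame_bound H I g = Sup (lower_frame_bounds H I g)"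

definition upper_frame_bound ::
  "('a::euclidean_space \<Rightarrow> complex) set \<Rightarrow> 'i set \<Rightarrow> ('i \<Rightarrow> 'a \<Rightarrow> complex) \<Rightarrow> real" where
  "upper_frame_bound H I g = Inf (upper_frame_bounds H I g)"

definition trig_poly :: "complex set \<Rightarrow> (real \<Rightarrow> complex) \<Rightarrow> bool" where
  "trig_poly R p \<longleftrightarrow>
     (\<exists>N a. finite N \<and> (\<forall>n\<in>N. a n \<in> R) \<and>
       (\<forall>x. p x = (\<Sum>n\<in>N. a n * exp (2 * of_real pi * \<i> * of_int (n::int) * of_real x))))"

text \<open>The Fourier transform of the scaling function with low-pass filter \<open>m0\<close>. The
  infinite product may contain finitely many zero factors; its value is then 0.\<close>

definition phi_hat :: "(real \<Rightarrow> complex) \<Rightarrow> real \<Rightarrow> complex" where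
  "phi_hat m0 x = (\<Prod>j. m0 (x / 2 ^ j))"

definition psi_hat :: "(real \<Rightarrow> complex) \<Rightarrow> (real \<Rightarrow> complex) \<Rightarrow> real^2 \<Rightarrow> complex" where
  "psi_hat m0 m1 \<xi> = m1 (4 * \<xi>$1) * phi_hat m0 (\<xi>$1) * phi_hat m0 (2 * \<xi>$2)"

definition dil_mat :: "real \<Rightarrow> real^2^2" where
  "dil_mat a = vector [vector [a, 0], vector [0, sqrt a]]"

definition shear_mat :: "real \<Rightarrow> real^2^2" where
  "shear_mat s = vector [vector [1, s], vector [0, 1]]"

definition samp_mat :: "real^2 \<Rightarrow> real^2^2" where
  "samp_mat c = vector [vector [c$1, 0], vector [0, c$2]]"

definition vec_of_int :: "int^2 \<Rightarrow> real^2" where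
  "vec_of_int m = (\<chi> i. of_int (m$i))"

definition shear_cone :: "(real^2) set" where
  "shear_cone = {\<xi>. \<bar>\<xi>$1\<bar> \<ge> 1 \<and> \<bar>\<xi>$2 / \<xi>$1\<bar> \<le> 1}"

definition L2_cone :: "(real^2 \<Rightarrow> complex) set" where
  "L2_cone = {f. \<exists>g. is_fourier_transform f g \<and> ess_support g \<subseteq> shear_cone}"

definition shears :: "nat \<Rightarrow> int set" where
  "shears j = {k. \<bar>k\<bar> \<le> \<lceil>2 powr (real j / 2)\<rceil>}"

definition shearlet_index :: "(nat \<times> int \<times> (int^2)) set" where
  "shearlet_index = {(j, k, m). k \<in> shears j}"

text \<open>With \<open>a = 2 powr (- j)\<close>, \<open>s = k * 2 powr (- j / 2)\<close> and \<open>t = S\<^sub>s A\<^sub>a M\<^sub>c m\<close> one has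
  \<open>A\<^sub>a\<inverse> S\<^sub>s\<inverse> (x - t) = S\<^sub>-\<^sub>k A\<^sub>1\<^sub>/\<^sub>a x - M\<^sub>c m\<close>, so this is the system
  attached to the sampling set of the points \<open>(a, s, t)\<close>.\<close>

definition shearlet ::
  "(real^2 \<Rightarrow> complex) \<Rightarrow> real^2 \<Rightarrow> nat \<times> int \<times> (int^2) \<Rightarrow> real^2 \<Rightarrow> complex" where
  "shearlet \<psi> c = (\<lambda>(j, k, m) x. of_real (2 powr (3 * real j / 4)) *
     \<psi> ((shear_mat (- of_int k) ** dil_mat (2 ^ j)) *v x - samp_mat c *v vec_of_int m))"

text \<open>The quantities controlling the frame bounds take values in the extended nonnegative reals, so that no finiteness is
  presupposed. The argument \<open>p\<close> stands for the Fourier transform of the generator;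
  changing it on a null set changes \<open>Phi p \<xi> \<omega>\<close>, for fixed \<open>\<omega>\<close>, only on a null set of \<open>\<xi>\<close>.\<close>

definition Phi :: "(real^2 \<Rightarrow> complex) \<Rightarrow> real^2 \<Rightarrow> real^2 \<Rightarrow> ennreal" where
  "Phi p \<xi> \<omega> = (\<Sum>j. \<Sum>k\<in>shears j.
     (let \<eta> = (transpose (shear_mat (of_int k)) ** dil_mat (1 / 2 ^ j)) *v \<xi>
      in ennreal (cmod (p \<eta>) * cmod (p (\<eta> + \<omega>)))))"

definition essinf :: "'a measure \<Rightarrow> ('a \<Rightarrow> ennreal) \<Rightarrow> ennreal" where
  "essinf M f = Sup {z. AE x in M. z \<le> f x}"

definition Gamma_sup :: "(real^2 \<Rightarrow> complex) \<Rightarrow> real^2 \<Rightarrow> ennreal" where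
  "Gamma_sup p \<omega> = esssup (restrict_space lborel shear_cone) (\<lambda>\<xi>. Phi p \<xi> \<omega>)"

definition L_inf :: "(real^2 \<Rightarrow> complex) \<Rightarrow> ennreal" where
  "L_inf p = essinf (restrict_space lborel shear_cone) (\<lambda>\<xi>. Phi p \<xi> 0)"

definition L_sup :: "(real^2 \<Rightarrow> complex) \<Rightarrow> ennreal" where
  "L_sup p = esssup (restrict_space lborel shear_cone) (\<lambda>\<xi>. Phi p \<xi> 0)"

definition ennreal_sqrt :: "ennreal \<Rightarrow> ennreal" where
  "ennreal_sqrt x = (if x = \<infinity> then \<infinity> else ennreal (sqrt (enn2real x)))"

definition R_sum :: "(real^2 \<Rightarrow> complex) \<Rightarrow> real^2 \<Rightarrow> ennreal" where
  "R_sum p c = (\<Sum>\<^sub>\<infinity>m\<in>UNIV - {0}.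
     (let \<omega> = matrix_inv (samp_mat c) *v vec_of_int m
      in ennreal_sqrt (Gamma_sup p \<omega> * Gamma_sup p (- \<omega>))))"

end

theory Submission
  imports Defs
begin

text \<open>By Plancherel, the coefficients of \<open>f\<close> at scale \<open>j\<close> and shear \<open>k\<close> are Fourier coefficients on a
  lattice torus of \<open>G = g * cnj (p \<circ> T)\<close>, where \<open>g\<close> and \<open>p\<close> are the transforms of \<open>f\<close> and \<open>\<psi>\<close>. Parseval
  turns their square sum into the square norm of the periodization of \<open>G\<close>. Its diagonal part, summed
  over all \<open>j\<close> and \<open>k\<close>, is the integral of \<open>\<bar>g\<bar>\<^sup>2 * Phi p \<xi> 0\<close>, and Cauchy-Schwarz bounds the
  off-diagonal part by \<open>R(c)\<close> times the square norm of \<open>f\<close>. The cosine factors of the filter outweigh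
  the binomial factors, so that \<open>\<bar>p \<xi>\<bar>\<close> is at most a constant times
  \<open>\<xi>\<^sub>1\<^sup>2 (1 + \<xi>\<^sub>1\<^sup>2)\<^sup>-\<^sup>3 (1 + \<xi>\<^sub>2\<^sup>2)\<^sup>-\<^sup>2\<close>; this makes \<open>\<Gamma>(\<omega>)\<close> decay like \<open>\<bar>\<omega>\<bar>\<^sup>-\<^sup>3\<close> and hence \<open>R(c)\<close> of
  order \<open>c\<^sub>1\<^sup>3\<close>. The lower bound of \<open>Phi p \<xi> 0\<close> on the cone comes from a single pair \<open>(j, k)\<close>, chosen
  such that \<open>T *v \<xi>\<close> lies in a fixed box on which \<open>p\<close> has no zero.\<close>

text \<open>The exponents are balanced as follows. At scale \<open>j\<close> the second coordinates
  of \<open>T *v \<xi>\<close> form an arithmetic progression with gap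
  \<open>x = \<xi> $ 1 / 2 ^ j\<close>, so summing over the shears costs a factor of order 1 +
  1/|x|. Of the two powers of x kept from the zero of the high-pass filter, one pays for 1/|x| and
  the other makes the sum over the fine scales converge. For large |x| the order 4 of decay splits
  into 3 for \<omega> and 1 for the coarse scales. The 3 exceeds 2, the rank of the lattice, so R(c)
  is finite. The lower bound of \<open>Phi\<close> on the cone is independent of c; it remains to
  make R(c) small. Parseval needs a square integrable periodization, which is not known for
  \<open>G\<close> at the outset. Hence the periodization is first compared pointwise with its
  diagonal and off-diagonal parts; finiteness of their totals, a consequence of the decay of
  \<open>p\<close>, then justifies Parseval. Two-sided estimates are written as sums, since
  subtraction in \<open>ennreal\<close> is truncated.\<close>

definition chr :: "real \<Rightarrow> complex" where
  "chr t = cis (2 * pi * t)"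

lemma chr_add: "chr (s + t) = chr s * chr t"
  by (simp add: chr_def cis_mult ring_distribs)

lemma chr_0 [simp]: "chr 0 = 1"
  by (simp add: chr_def)

lemma norm_chr [simp]: "cmod (chr t) = 1"
  by (simp add: chr_def)

lemma cnj_chr: "cnj (chr t) = chr (- t)"
  by (simp add: chr_def cis_cnj)

lemma chr_of_int [simp]: "chr (of_int n) = 1"
  by (simp add: chr_def complex_eq_iff)

lemma continuous_chr [continuous_intros]:
  "continuous_on S f \<Longrightarrow> continuous_on S (\<lambda>x. chr (f x))"
  unfolding chr_def by (intro continuous_intros)

lemma chr_measurable [measurable]: "chr \<in> borel_measurable borel"
  by (intro borel_measurable_continuous_onI continuous_intros)

lemma chr_eq_exp: "exp (2 * of_real pi * \<i> * of_real t) = chr t"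
  by (simp add: chr_def cis_conv_exp mult_ac)

lemma chr_eq_1_iff: "chr t = 1 \<longleftrightarrow> t \<in> \<int>"
proof
  assume "chr t = 1"
  then have "cos (2 * pi * t) = 1" by (simp add: chr_def complex_eq_iff)
  then obtain n :: int where "2 * pi * t = n * 2 * pi"
    using cos_one_2pi_int by auto
  then have "t = n" by simp
  then show "t \<in> \<int>" by simp
qed (auto elim: Ints_cases)

section \<open>Countable sums as integrals over counting measure\<close>

lemma nn_integral_count_space_eq_SUP:
  fixes f :: "'a \<Rightarrow> ennreal"
  assumes "countable A"
  shows "(\<integral>\<^sup>+x. f x \<partial>count_space A) = (SUP F\<in>{F. finite F \<and> F \<subseteq> A}. \<Sum>x\<in>F. f x)"
proof (rule antisym)
  show "(SUP F\<in>{F. finite F \<and> F \<subseteq> A}. \<Sum>x\<in>F. f x) \<le> (\<integral>\<^sup>+x. f x \<partial>count_space A)"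
  proof (intro SUP_least, clarsimp)
    fix F assume F: "finite F" "F \<subseteq> A"
    have "(\<Sum>x\<in>F. f x) = (\<integral>\<^sup>+x. f x \<partial>count_space F)"
      using F by (simp add: nn_integral_count_space_finite)
    also have "\<dots> = (\<integral>\<^sup>+x. f x * indicator F x \<partial>count_space A)"
      using F by (subst (1 2) nn_integral_count_space_indicator)
        (auto intro!: nn_integral_cong simp: indicator_def)
    also have "\<dots> \<le> (\<integral>\<^sup>+x. f x \<partial>count_space A)"
      by (intro nn_integral_mono) (auto simp: indicator_def)
    finally show "(\<Sum>x\<in>F. f x) \<le> (\<integral>\<^sup>+x. f x \<partial>count_space A)" .
  qed
  show "(\<integral>\<^sup>+x. f x \<partial>count_space A) \<le> (SUP F\<in>{F. finite F \<and> F \<subseteq> A}. \<Sum>x\<in>F. f x)"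
  proof (cases "finite A")
    case True
    then show ?thesis
      by (auto simp: nn_integral_count_space_finite intro!: SUP_upper2[of A])
  next
    case False
    let ?g = "from_nat_into A"
    have bij: "bij_betw ?g UNIV A" using bij_betw_from_nat_into[OF assms False] .
    have "(\<integral>\<^sup>+x. f x \<partial>count_space A) = (\<integral>\<^sup>+n. f (?g n) \<partial>count_space UNIV)"
      using nn_integral_bij_count_space[OF bij, of f] by simp
    also have "\<dots> = (SUP n. \<Sum>i<n. f (?g i))"
      by (simp add: nn_integral_count_space_nat suminf_eq_SUP)
    also have "\<dots> \<le> (SUP F\<in>{F. finite F \<and> F \<subseteq> A}. \<Sum>x\<in>F. f x)"
    proof (rule SUP_least)
      fix n
      have "(\<Sum>i<n. f (?g i)) = (\<Sum>x\<in>?g ` {..<n}. f x)"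
        using bij by (subst sum.reindex) (auto simp: bij_betw_def intro: inj_on_subset)
      also have "\<dots> \<le> (SUP F\<in>{F. finite F \<and> F \<subseteq> A}. \<Sum>x\<in>F. f x)"
        using bij by (intro SUP_upper) (auto simp: bij_betw_def)
      finally show "(\<Sum>i<n. f (?g i)) \<le> (SUP F\<in>{F. finite F \<and> F \<subseteq> A}. \<Sum>x\<in>F. f x)" .
    qed
    finally show ?thesis .
  qed
qed

text \<open>In \<open>ennreal\<close> an infinite sum is the supremum of its finite parts, and so is
  the integral over counting measure. Read as an integral, a sum over the lattice or over the scales
  can be exchanged with another integral by Tonelli.\<close>

lemma infsum_eq_nn_integral:
  fixes f :: "'a \<Rightarrow> ennreal"
  assumes "countable A"
  shows "infsum f A = (\<integral>\<^sup>+x. f x \<partial>count_space A)"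
  using assms by (simp add: nn_integral_count_space_eq_SUP nonneg_infsum_complete)

section \<open>Squared norms and distances with values in \<open>ennreal\<close>\<close>

abbreviation sq_integral :: "'a measure \<Rightarrow> ('a \<Rightarrow> complex) \<Rightarrow> ennreal" where
  "sq_integral M f \<equiv> (\<integral>\<^sup>+x. ennreal ((cmod (f x))\<^sup>2) \<partial>M)"

text \<open>The square of the L2 distance, possibly infinite, so that no integrability has to be
  carried along. Density arguments get by with the triangle inequality with factor 2, whose proof is
  pointwise.\<close>

definition sqdist :: "'a measure \<Rightarrow> ('a \<Rightarrow> complex) \<Rightarrow> ('a \<Rightarrow> complex) \<Rightarrow> ennreal" where
  "sqdist M f g = sq_integral M (\<lambda>x. f x - g x)"

lemma norm_add_square_le:
  fixes a b :: complex
  shows "(cmod (a + b))\<^sup>2 \<le> 2 * (cmod a)\<^sup>2 + 2 * (cmod b)\<^sup>2"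
proof -
  have "(cmod (a + b))\<^sup>2 \<le> (cmod a + cmod b)\<^sup>2"
    by (intro power_mono norm_triangle_ineq) auto
  also have "\<dots> \<le> 2 * (cmod a)\<^sup>2 + 2 * (cmod b)\<^sup>2"
    using sum_squares_bound[of "cmod a" "cmod b"] by (simp add: power2_sum)
  finally show ?thesis .
qed

lemma nn_integral_norm_add_square_le:
  assumes [measurable]: "f \<in> borel_measurable M" "g \<in> borel_measurable M"
  shows "sq_integral M (\<lambda>x. f x + g x) \<le>
    2 * sq_integral M f + 2 * sq_integral M g"
proof -
  have "sq_integral M (\<lambda>x. f x + g x) \<le>
    (\<integral>\<^sup>+x. 2 * ennreal ((cmod (f x))\<^sup>2) + 2 * ennreal ((cmod (g x))\<^sup>2) \<partial>M)"
    by (intro nn_integral_mono)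
       (simp add: norm_add_square_le flip: ennreal_numeral ennreal_mult ennreal_plus)
  also have "\<dots> = 2 * sq_integral M f + 2 * sq_integral M g"
    by (simp add: nn_integral_add nn_integral_cmult)
  finally show ?thesis .
qed

lemma sqdist_triangle:
  assumes [measurable]: "f \<in> borel_measurable M" "g \<in> borel_measurable M" "h \<in> borel_measurable M"
  shows "sqdist M f h \<le> 2 * sqdist M f g + 2 * sqdist M g h"
  using nn_integral_norm_add_square_le[of "\<lambda>x. f x - g x" M "\<lambda>x. g x - h x"]
  by (simp add: sqdist_def)

lemma sqdist_add_le:
  assumes [measurable]: "f \<in> borel_measurable M" "g \<in> borel_measurable M"
    "h \<in> borel_measurable M" "k \<in> borel_measurable M"
  shows "sqdist M (\<lambda>x. f x + h x) (\<lambda>x. g x + k x) \<le> 2 * sqdist M f g + 2 * sqdist M h k"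
  using nn_integral_norm_add_square_le[of "\<lambda>x. f x - g x" M "\<lambda>x. h x - k x"]
  by (simp add: sqdist_def algebra_simps)

lemma sqdist_cmult:
  assumes [measurable]: "f \<in> borel_measurable M" "g \<in> borel_measurable M"
  shows "sqdist M (\<lambda>x. c * f x) (\<lambda>x. c * g x) = ennreal ((cmod c)\<^sup>2) * sqdist M f g"
  unfolding sqdist_def
  by (subst nn_integral_cmult[symmetric])
     (auto simp: power_mult_distrib norm_mult simp flip: right_diff_distrib ennreal_mult intro!: nn_integral_cong)

lemma sqdist_le_bound:
  assumes "\<And>x. x \<in> space M \<Longrightarrow> cmod (f x - g x) \<le> B" "emeasure M (space M) = 1"
  shows "sqdist M f g \<le> ennreal (B\<^sup>2)"
proof -
  have "sqdist M f g \<le> (\<integral>\<^sup>+x. ennreal (B\<^sup>2) \<partial>M)"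
    unfolding sqdist_def
    by (intro nn_integral_mono ennreal_leI power_mono) (use assms in auto)
  then show ?thesis using assms by simp
qed

lemma sqdist_LIMSEQ_dominated:
  assumes [measurable]: "\<And>n::nat. F n \<in> borel_measurable M" "f \<in> borel_measurable M"
    "w \<in> borel_measurable M"
    and dom: "\<And>n x. cmod (F n x - f x) \<le> w x"
    and fin: "(\<integral>\<^sup>+x. ennreal ((w x)\<^sup>2) \<partial>M) < \<infinity>"
    and lim: "AE x in M. (\<lambda>n. F n x) \<longlonglongrightarrow> f x"
  shows "(\<lambda>n. sqdist M (F n) f) \<longlonglongrightarrow> 0"
proof -
  have "(\<lambda>n. \<integral>\<^sup>+x. ennreal ((cmod (F n x - f x))\<^sup>2) \<partial>M) \<longlonglongrightarrow> (\<integral>\<^sup>+x. 0 \<partial>M)"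
  proof (rule nn_integral_dominated_convergence[where w = "\<lambda>x. ennreal ((w x)\<^sup>2)"])
    show "AE x in M. ennreal ((cmod (F n x - f x))\<^sup>2) \<le> ennreal ((w x)\<^sup>2)" for n
      by (intro AE_I2 ennreal_leI power_mono dom) auto
    show "AE x in M. (\<lambda>n. ennreal ((cmod (F n x - f x))\<^sup>2)) \<longlonglongrightarrow> 0"
      using lim
    proof eventually_elim
      case (elim x)
      then have "(\<lambda>n. (cmod (F n x - f x))\<^sup>2) \<longlonglongrightarrow> (cmod (f x - f x))\<^sup>2"
        by (intro tendsto_intros)
      then show ?case using tendsto_ennrealI by fastforce
    qed
  qed (use fin in auto)
  then show ?thesis by (simp add: sqdist_def)
qed

section \<open>Fourier series on the unit interval\<close>

text \<open>A probability measure on the whole line instead of a subspace, so that measurability is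
  plain Borel measurability. The half-open interval is a fundamental domain of the integers.\<close>

definition U01 :: "real measure" where
  "U01 = density lborel (indicator {0..<1})"

lemma space_U01 [simp]: "space U01 = UNIV" and sets_U01 [simp, measurable_cong]: "sets U01 = sets borel"
  by (simp_all add: U01_def)

interpretation U01: prob_space U01
  by standard (simp add: U01_def emeasure_density)

lemma AE_U01: "AE x in U01. x \<in> {0..<1}"
  unfolding U01_def by (subst AE_density) (auto simp: indicator_def)

lemma integral_U01:
  fixes f :: "real \<Rightarrow> complex"
  assumes [measurable]: "f \<in> borel_measurable borel"
  shows "(LINT x|U01. f x) = (LINT x|lborel. indicator {0..<1} x *\<^sub>R f x)"
proof -
  have "(LINT x|U01. f x) = (LINT x|density lborel (\<lambda>x. ennreal (indicator {0..<1} x)). f x)"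
    by (simp add: U01_def ennreal_indicator)
  also have "\<dots> = (LINT x|lborel. indicator {0..<1} x *\<^sub>R f x)"
    by (rule integral_density) auto
  finally show ?thesis .
qed

lemma integral_chr_U01:
  "(LINT x|U01. chr (of_int n * x)) = (if n = 0 then 1 else 0)"
proof (cases "n = 0")
  case False
  let ?F = "\<lambda>x. chr (of_int n * x) / (2 * pi * n * \<i>)"
  have "(LINT x|U01. chr (of_int n * x)) = (LINT x|lborel. indicator {0..<1} x *\<^sub>R chr (of_int n * x))"
    by (intro integral_U01) measurable
  \<comment> \<open>The endpoint 1 is a null set; the fundamental theorem of calculus is applied on
    the closed interval.\<close>
  also have "\<dots> = (LINT x|lborel. indicator {0..1} x *\<^sub>R chr (of_int n * x))"
    by (intro integral_cong_AE) (use AE_lborel_singleton[of 1] in \<open>auto simp: indicator_def\<close>)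
  also have "\<dots> = ?F 1 - ?F 0"
  proof (rule integral_FTC_Icc)
    show "(?F has_vector_derivative chr (of_int n * x)) (at x within {0..1})" for x
      unfolding chr_def cis_conv_exp using False
      by (auto intro!: derivative_eq_intros has_vector_derivative_real_field simp: field_simps)
  qed (auto intro!: continuous_intros)
  also have "\<dots> = 0" using chr_of_int[of n] by simp
  finally show ?thesis using False by simp
next
  case True then show ?thesis using U01.prob_space by simp
qed

section \<open>Density of the trigonometric polynomials in L2 of the unit interval\<close>

lemma trig_poly_iff_chr:
  "trig_poly UNIV p \<longleftrightarrow> (\<exists>N a. finite N \<and> p = (\<lambda>x. \<Sum>n\<in>N. a n * chr (of_int n * x)))"
proof -
  have "exp (2 * of_real pi * \<i> * of_int n * of_real x) = chr (of_int n * x)" for n x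
    using chr_eq_exp[of "of_int n * x"] by (simp add: mult_ac)
  then show ?thesis by (auto simp: trig_poly_def fun_eq_iff)
qed

lemma trig_poly_chr: "trig_poly UNIV (\<lambda>x. c * chr (of_int n * x))"
  unfolding trig_poly_iff_chr by (intro exI[of _ "{n}"] exI[of _ "\<lambda>_. c"]) auto

lemma trig_poly_add:
  assumes "trig_poly UNIV p" "trig_poly UNIV q"
  shows "trig_poly UNIV (\<lambda>x. p x + q x)"
proof -
  obtain N a where 1: "finite N" "p = (\<lambda>x. \<Sum>n\<in>N. a n * chr (of_int n * x))"
    using assms(1) by (auto simp: trig_poly_iff_chr)
  obtain N' a' where 2: "finite N'" "q = (\<lambda>x. \<Sum>n\<in>N'. a' n * chr (of_int n * x))"
    using assms(2) by (auto simp: trig_poly_iff_chr)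
  let ?a = "\<lambda>n. (if n \<in> N then a n else 0) + (if n \<in> N' then a' n else 0)"
  have "p x + q x = (\<Sum>n\<in>N\<union>N'. ?a n * chr (of_int n * x))" for x
  proof -
    have "p x = (\<Sum>n\<in>N\<union>N'. (if n \<in> N then a n else 0) * chr (of_int n * x))"
      unfolding 1 using 1 2 by (intro sum.mono_neutral_cong_left) auto
    moreover have "q x = (\<Sum>n\<in>N\<union>N'. (if n \<in> N' then a' n else 0) * chr (of_int n * x))"
      unfolding 2 using 1 2 by (intro sum.mono_neutral_cong_left) auto
    ultimately show ?thesis by (simp add: sum.distrib distrib_right)
  qed
  then show ?thesis
    unfolding trig_poly_iff_chr using 1 2 by (intro exI[of _ "N \<union> N'"] exI[of _ ?a]) auto
qed

lemma trig_poly_const: "trig_poly UNIV (\<lambda>x. c)"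
  using trig_poly_chr[of c 0] by simp

lemma trig_poly_sum:
  "finite A \<Longrightarrow> (\<And>i. i \<in> A \<Longrightarrow> trig_poly UNIV (p i)) \<Longrightarrow> trig_poly UNIV (\<lambda>x. \<Sum>i\<in>A. p i x)"
  by (induction A rule: finite_induct) (auto intro: trig_poly_add trig_poly_const)

lemma trig_poly_mult:
  assumes "trig_poly UNIV p" "trig_poly UNIV q"
  shows "trig_poly UNIV (\<lambda>x. p x * q x)"
proof -
  obtain N a where 1: "finite N" "p = (\<lambda>x. \<Sum>n\<in>N. a n * chr (of_int n * x))"
    using assms(1) by (auto simp: trig_poly_iff_chr)
  obtain N' a' where 2: "finite N'" "q = (\<lambda>x. \<Sum>n\<in>N'. a' n * chr (of_int n * x))"
    using assms(2) by (auto simp: trig_poly_iff_chr)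
  have "p x * q x = (\<Sum>n\<in>N. \<Sum>k\<in>N'. (a n * a' k) * chr (of_int (n + k) * x))" for x
    unfolding 1 2 sum_product by (simp add: chr_add ring_distribs mult_ac)
  moreover have "trig_poly UNIV (\<lambda>x. \<Sum>n\<in>N. \<Sum>k\<in>N'. (a n * a' k) * chr (of_int (n + k) * x))"
    using 1 2 by (intro trig_poly_sum trig_poly_chr)
  ultimately show ?thesis by (simp only:)
qed

lemma trig_poly_borel: "trig_poly UNIV p \<Longrightarrow> p \<in> borel_measurable borel"
  unfolding trig_poly_iff_chr by auto

text \<open>On the circle a real linear functional is a combination of cosine and sine, hence of the
  characters with frequencies 1 and -1. Sums and products then follow from the closure properties of
  trigonometric polynomials.\<close>

lemma real_polynomial_function_cis_trig_poly:
  assumes "real_polynomial_function f"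
  shows "trig_poly UNIV (\<lambda>x. of_real (f (chr x)))"
  using assms
proof induction
  case (linear f)
  interpret bounded_linear f by fact
  have "of_real (f (chr x)) = (of_real (f 1) / 2 + of_real (f \<i>) / (2 * \<i>)) * chr (of_int 1 * x)
      + (of_real (f 1) / 2 - of_real (f \<i>) / (2 * \<i>)) * chr (of_int (- 1) * x)" for x
  proof -
    have "chr x = cos (2*pi*x) *\<^sub>R 1 + sin (2*pi*x) *\<^sub>R \<i>"
      by (simp add: chr_def complex_eq_iff)
    then have "f (chr x) = cos (2*pi*x) * f 1 + sin (2*pi*x) * f \<i>"
      by (simp only: add scaleR) simp
    then show ?thesis by (simp add: chr_def complex_eq_iff field_simps)
  qed
  then show ?case by (simp only: trig_poly_add trig_poly_chr)
qed (auto intro: trig_poly_add trig_poly_mult trig_poly_const)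

lemma polynomial_function_cis_trig_poly:
  fixes q :: "complex \<Rightarrow> complex"
  assumes "polynomial_function q"
  shows "trig_poly UNIV (\<lambda>x. q (chr x))"
proof -
  have "real_polynomial_function (Re \<circ> q)" "real_polynomial_function (Im \<circ> q)"
    using assms bounded_linear_Re bounded_linear_Im unfolding polynomial_function_def by blast+
  from this[THEN real_polynomial_function_cis_trig_poly]
  have "trig_poly UNIV (\<lambda>x. of_real (Re (q (chr x))) + \<i> * of_real (Im (q (chr x))))"
    by (intro trig_poly_add trig_poly_mult trig_poly_const) (auto simp: o_def)
  then show ?thesis by (simp flip: complex_eq)
qed

lemma two_mult_add_two_mult_less:
  assumes "a < ennreal (e / 4)" "b < ennreal (e / 4)"
  shows "2 * a + 2 * b < ennreal e"
proof -
  obtain x where x: "a = ennreal x" "x \<ge> 0" using assms by (cases a) auto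
  obtain y where y: "b = ennreal y" "y \<ge> 0" using assms by (cases b) auto
  have "x < e / 4" "y < e / 4" using assms x y by (auto simp: ennreal_less_iff)
  then have "ennreal (2 * x + 2 * y) < ennreal e" using x y by (intro ennreal_lessI) auto
  then show ?thesis using x y by (simp add: ennreal_mult)
qed

text \<open>Membership in the L2 closure of the trigonometric polynomials. That the closure is all
  of L2 is reached from continuous functions through half-lines, Borel sets and simple
  functions.\<close>

definition trig_approx :: "(real \<Rightarrow> complex) \<Rightarrow> bool" where
  "trig_approx h \<longleftrightarrow> (\<forall>e>0. \<exists>p. trig_poly UNIV p \<and> sqdist U01 h p < ennreal e)"

lemma trig_approx_closed:
  assumes [measurable]: "h \<in> borel_measurable borel"
    and "\<And>e. e > 0 \<Longrightarrow> \<exists>g\<in>borel_measurable borel. trig_approx g \<and> sqdist U01 h g < ennreal e"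
  shows "trig_approx h"
  unfolding trig_approx_def
proof safe
  fix e :: real assume e: "e > 0"
  obtain g where g[measurable]: "g \<in> borel_measurable borel" and "trig_approx g" "sqdist U01 h g < ennreal (e/4)"
    using assms(2)[of "e/4"] e by auto
  then obtain p where p: "trig_poly UNIV p" "sqdist U01 g p < ennreal (e/4)"
    using e unfolding trig_approx_def by (meson divide_pos_pos zero_less_numeral)
  note [measurable] = trig_poly_borel[OF p(1)]
  have "sqdist U01 h p \<le> 2 * sqdist U01 h g + 2 * sqdist U01 g p"
    by (rule sqdist_triangle) auto
  also have "\<dots> < ennreal e"
    by (rule two_mult_add_two_mult_less) fact+
  finally show "\<exists>p. trig_poly UNIV p \<and> sqdist U01 h p < ennreal e" using p by blast
qed

lemma trig_approx_LIMSEQ: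
  assumes [measurable]: "h \<in> borel_measurable borel" "\<And>n::nat. g n \<in> borel_measurable borel"
    and "\<And>n. trig_approx (g n)" "(\<lambda>n. sqdist U01 (g n) h) \<longlonglongrightarrow> 0"
  shows "trig_approx h"
proof (rule trig_approx_closed)
  fix e :: real assume "e > 0"
  then have "eventually (\<lambda>n. sqdist U01 (g n) h < ennreal e) sequentially"
    using assms(4) by (intro order_tendstoD) auto
  then obtain n where "sqdist U01 (g n) h < ennreal e" by (auto simp: eventually_sequentially)
  then show "\<exists>g\<in>borel_measurable borel. trig_approx g \<and> sqdist U01 h g < ennreal e"
    using assms by (intro bexI[of _ "g n"]) (auto simp: sqdist_def norm_minus_commute)
qed auto

lemma trig_approx_add:
  assumes [measurable]: "f \<in> borel_measurable borel" "g \<in> borel_measurable borel"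
    and "trig_approx f" "trig_approx g"
  shows "trig_approx (\<lambda>x. f x + g x)"
  unfolding trig_approx_def
proof safe
  fix e :: real assume e: "e > 0"
  obtain p where p: "trig_poly UNIV p" "sqdist U01 f p < ennreal (e/4)"
    using assms(3) e unfolding trig_approx_def by (meson divide_pos_pos zero_less_numeral)
  obtain q where q: "trig_poly UNIV q" "sqdist U01 g q < ennreal (e/4)"
    using assms(4) e unfolding trig_approx_def by (meson divide_pos_pos zero_less_numeral)
  note [measurable] = trig_poly_borel[OF p(1)] trig_poly_borel[OF q(1)]
  have "sqdist U01 (\<lambda>x. f x + g x) (\<lambda>x. p x + q x) \<le> 2 * sqdist U01 f p + 2 * sqdist U01 g q"
    by (rule sqdist_add_le) auto
  also have "\<dots> < ennreal e"
    using p q by (intro two_mult_add_two_mult_less)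
  finally show "\<exists>p. trig_poly UNIV p \<and> sqdist U01 (\<lambda>x. f x + g x) p < ennreal e"
    using trig_poly_add[OF p(1) q(1)] by blast
qed

lemma trig_approx_cmult:
  assumes [measurable]: "f \<in> borel_measurable borel" and "trig_approx f"
  shows "trig_approx (\<lambda>x. c * f x)"
  unfolding trig_approx_def
proof safe
  fix e :: real assume e: "e > 0"
  define d where "d = e / ((cmod c)\<^sup>2 + 1)"
  have d: "d > 0" "(cmod c)\<^sup>2 * d < e"
    using e by (auto simp: d_def divide_simps add_pos_nonneg add_nonneg_pos mult_pos_pos algebra_simps)
  obtain p where p: "trig_poly UNIV p" "sqdist U01 f p < ennreal d"
    using assms(2) d unfolding trig_approx_def by blast
  note [measurable] = trig_poly_borel[OF p(1)]
  have "sqdist U01 (\<lambda>x. c * f x) (\<lambda>x. c * p x) = ennreal ((cmod c)\<^sup>2) * sqdist U01 f p"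
    by (rule sqdist_cmult) auto
  also have "\<dots> \<le> ennreal ((cmod c)\<^sup>2) * ennreal d" by (intro mult_left_mono less_imp_le[OF p(2)]) auto
  also have "\<dots> < ennreal e" using d e by (simp add: ennreal_less_iff flip: ennreal_mult)
  finally show "\<exists>p. trig_poly UNIV p \<and> sqdist U01 (\<lambda>x. c * f x) p < ennreal e"
    using trig_poly_mult[OF trig_poly_const p(1), of c] by blast
qed

lemma trig_approx_circle:
  assumes "continuous_on (sphere 0 1) f"
  shows "trig_approx (\<lambda>x. f (chr x))"
  unfolding trig_approx_def
proof safe
  fix e :: real assume e: "e > 0"
  \<comment> \<open>\<open>U01\<close> has total mass 1, so the uniform error sqrt(e/2) gives a
    squared distance of at most e/2.\<close>
  obtain q where q: "polynomial_function q" "\<And>z. z \<in> sphere 0 1 \<Longrightarrow> cmod (f z - q z) < sqrt (e/2)"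
    using Stone_Weierstrass_polynomial_function[OF _ assms, of "sqrt (e/2)"] e by auto
  have "sqdist U01 (\<lambda>x. f (chr x)) (\<lambda>x. q (chr x)) \<le> ennreal ((sqrt (e/2))\<^sup>2)"
    using q(2) U01.emeasure_space_1 by (intro sqdist_le_bound less_imp_le) auto
  also have "\<dots> < ennreal e" using e by (simp add: ennreal_less_iff)
  finally show "\<exists>p. trig_poly UNIV p \<and> sqdist U01 (\<lambda>x. f (chr x)) p < ennreal e"
    using polynomial_function_cis_trig_poly[OF q(1)] by blast
qed

lemma Arg2pi_chr: "x \<in> {0..<1} \<Longrightarrow> Arg2pi (chr x) = 2 * pi * x"
  by (rule Arg2pi_unique[of 1]) (auto simp: chr_def cis_conv_exp)

text \<open>The factor \<open>min 1 (n * cmod (z - 1))\<close> removes the jump of \<open>g \<circ> Arg2pi\<close> at \<open>1\<close>.\<close>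

lemma trig_approx_continuous:
  assumes g: "continuous_on UNIV g" and bd: "\<And>x. cmod (g x) \<le> B"
  shows "trig_approx g"
proof -
  define f where "f n z = of_real (min 1 (real n * cmod (z - 1))) * g (Arg2pi z / (2 * pi))" for n z
  have B: "B \<ge> 0" using bd[of 0] norm_ge_zero order_trans by blast
  have cont: "continuous_on (sphere 0 1) (f n)" for n
    unfolding continuous_on_eq_continuous_within
  proof
    fix z :: complex assume z: "z \<in> sphere 0 1"
    show "continuous (at z within sphere 0 1) (f n)"
    proof (cases "z = 1")
      case False
      have "z \<notin> \<real>\<^sub>\<ge>\<^sub>0"
        using z False by (auto simp: nonneg_Reals_def)
      then have 1: "isCont (\<lambda>z. Arg2pi z / (2 * pi)) z"
        using continuous_at_Arg2pi by (intro continuous_intros) auto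
      have "isCont g (Arg2pi z / (2 * pi))"
        using g by (simp add: continuous_on_eq_continuous_at)
      then have "isCont (\<lambda>z. g (Arg2pi z / (2 * pi))) z"
        using isCont_o2[OF 1] by blast
      then have "isCont (f n) z"
        unfolding f_def by (intro continuous_intros) auto
      then show ?thesis by (rule continuous_at_imp_continuous_at_within)
    next
      case True
      \<comment> \<open>At 1 the argument jumps, but \<open>g\<close> is bounded by
        \<open>B\<close>, so the cutoff alone forces the limit 0.\<close>
      have "((\<lambda>z. real n * cmod (z - 1) * B) \<longlongrightarrow> real n * cmod (1 - 1) * B) (at 1 within sphere 0 1)"
        by (intro tendsto_intros)
      then have lim: "((\<lambda>z. real n * cmod (z - 1) * B) \<longlongrightarrow> 0) (at 1 within sphere 0 1)" by simp
      have "(f n \<longlongrightarrow> 0) (at 1 within sphere 0 1)"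
      proof (rule Lim_null_comparison[OF always_eventually lim], rule allI)
        fix z
        show "cmod (f n z) \<le> real n * cmod (z - 1) * B"
          unfolding f_def norm_mult by (intro mult_mono bd) auto
      qed
      then show ?thesis using True by (simp add: continuous_within f_def)
    qed
  qed
  define g1 where "g1 n x = (of_real (min 1 (real n * cmod (chr x - 1))) * g x)" for n x
  have [measurable]: "g \<in> borel_measurable borel" using g by (rule borel_measurable_continuous_onI)
  have [measurable]: "g1 n \<in> borel_measurable borel" for n unfolding g1_def by measurable
  have "trig_approx (g1 n)" for n
  proof -
    have "trig_approx (\<lambda>x. f n (chr x))" by (rule trig_approx_circle[OF cont])
    moreover have "sqdist U01 (g1 n) p = sqdist U01 (\<lambda>x. f n (chr x)) p" for p
      unfolding sqdist_def
    proof (rule nn_integral_cong_AE, use AE_U01 in eventually_elim)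
      fix x :: real assume "x \<in> {0..<1}"
      then show "ennreal ((cmod (g1 n x - p x))\<^sup>2) = ennreal ((cmod (f n (chr x) - p x))\<^sup>2)"
        using Arg2pi_chr[of x] by (simp add: g1_def f_def)
    qed
    ultimately show ?thesis by (simp add: trig_approx_def)
  qed
  moreover have "(\<lambda>n. sqdist U01 (g1 n) g) \<longlonglongrightarrow> 0"
  proof (rule sqdist_LIMSEQ_dominated[where w = "\<lambda>_. 2 * B"])
    fix n x
    have "cmod (g1 n x) \<le> 1 * B" unfolding g1_def norm_mult
      by (intro mult_mono bd) auto
    then show "cmod (g1 n x - g x) \<le> 2 * B"
      using bd[of x] norm_triangle_ineq4[of "g1 n x" "g x"] by linarith
  next
    have "AE x in U01. x \<noteq> 0"
      unfolding U01_def by (subst AE_density) (use AE_lborel_singleton[of 0] in auto)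
    with AE_U01 show "AE x in U01. (\<lambda>n. g1 n x) \<longlonglongrightarrow> g x"
    proof eventually_elim
      case (elim x)
      \<comment> \<open>Off the null point 0 no point of the interval is an integer, so
        \<open>chr x\<close> stays away from 1 and the cutoff is eventually equal to 1.\<close>
      have "x \<notin> \<int>" using elim by (auto elim!: Ints_cases)
      then have "cmod (chr x - 1) > 0" by (simp add: chr_eq_1_iff)
      then obtain n0 :: nat where n0: "1 < real n0 * cmod (chr x - 1)"
        using reals_Archimedean3 by blast
      have "g1 n x = g x" if "n \<ge> n0" for n
      proof -
        have "real n0 * cmod (chr x - 1) \<le> real n * cmod (chr x - 1)"
          using that by (intro mult_right_mono) auto
        then have "min 1 (real n * cmod (chr x - 1)) = 1" using n0 by linarith
        then show ?thesis by (simp add: g1_def)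
      qed
      then have "\<forall>\<^sub>F n in sequentially. g1 n x = g x"
        unfolding eventually_sequentially by (intro exI[of _ n0]) simp
      then show ?case by (rule tendsto_eventually)
    qed
  qed (auto simp: U01.emeasure_space_1[simplified])
  ultimately show ?thesis by (rule trig_approx_LIMSEQ[rotated 2]) auto
qed

lemma trig_approx_halfline: "trig_approx (indicator {..a})"
proof -
  \<comment> \<open>A ramp descending from 1 at \<open>a\<close> to 0 at a + 1/n. It converges at
    every point, including \<open>a\<close> itself, to the indicator of the closed
    half-line.\<close>
  define g where "g n x = complex_of_real (max 0 (min 1 (1 - real n * (x - a))))" for n x
  have [measurable]: "g n \<in> borel_measurable borel" for n unfolding g_def by measurable
  have "\<bar>max 0 (min 1 r)\<bar> \<le> 1" for r :: real by (simp add: max_def min_def)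
  then have bd: "cmod (g n x) \<le> 1" for n x unfolding g_def norm_of_real .
  have "trig_approx (g n)" for n
  proof (rule trig_approx_continuous)
    show "continuous_on UNIV (g n)" unfolding g_def by (intro continuous_intros)
  qed (rule bd)
  moreover have "(\<lambda>n. sqdist U01 (g n) (indicator {..a})) \<longlonglongrightarrow> 0"
  proof (rule sqdist_LIMSEQ_dominated[where w = "\<lambda>_. 2"])
    show "cmod (g n x - indicator {..a} x) \<le> 2" for n x
    proof -
      have "cmod (indicator {..a} x) \<le> 1" by (simp add: indicator_def)
      then show ?thesis
        using bd[of n x] norm_triangle_ineq4[of "g n x" "indicator {..a} x"] by linarith
    qed
    show "AE x in U01. (\<lambda>n. g n x) \<longlonglongrightarrow> indicator {..a} x"
    proof (rule AE_I2)
      fix x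
      show "(\<lambda>n. g n x) \<longlonglongrightarrow> indicator {..a} x"
      proof (cases "x \<le> a")
        case True
        then have "g n x = 1" for n
        proof -
          have "real n * (x - a) \<le> 0" using True by (intro mult_nonneg_nonpos) auto
          then have "max 0 (min 1 (1 - real n * (x - a))) = 1" by linarith
          then show ?thesis unfolding g_def by (simp only: of_real_1)
        qed
        then have "(\<lambda>n. g n x) \<longlonglongrightarrow> 1" by (simp only: tendsto_const)
        then show ?thesis using True by simp
      next
        case False
        then obtain n0 :: nat where "1 < real n0 * (x - a)"
          using reals_Archimedean3[of "x - a"] by force
        then have "g n x = 0" if "n \<ge> n0" for n
        proof -
          have "real n0 * (x - a) \<le> real n * (x - a)"
            using that False by (intro mult_right_mono) auto
          then have "max 0 (min 1 (1 - real n * (x - a))) = 0"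
            using \<open>1 < real n0 * (x - a)\<close> by linarith
          then show ?thesis unfolding g_def by (simp only: of_real_0)
        qed
        then have "\<forall>\<^sub>F n in sequentially. g n x = 0"
          unfolding eventually_sequentially by (intro exI[of _ n0]) simp
        then have "(\<lambda>n. g n x) \<longlonglongrightarrow> 0" by (rule tendsto_eventually)
        then show ?thesis using False by simp
      qed
    qed
  qed (auto simp: U01.emeasure_space_1[simplified])
  ultimately show ?thesis by (rule trig_approx_LIMSEQ[rotated 2]) auto
qed

text \<open>The closed half-lines are stable under intersection and generate the Borel sets, and the
  approximable sets form a Dynkin system: complements by linearity, disjoint unions by dominated
  convergence.\<close>

lemma trig_approx_indicator:
  assumes "A \<in> sets borel"
  shows "trig_approx (indicator A)"
proof -
  have *: "sets (borel::real measure) = sigma_sets UNIV (range atMost)"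
    by (subst borel_eq_atMost) simp
  have "Int_stable (range (atMost :: real \<Rightarrow> _))"
    by (auto simp: Int_stable_def)
  moreover have "range (atMost :: real \<Rightarrow> _) \<subseteq> Pow UNIV" by simp
  ultimately show ?thesis using assms[unfolded *]
  proof (induction rule: sigma_sets_induct_disjoint)
    case (basic A)
    then show ?case using trig_approx_halfline by auto
  next
    case empty
    have "trig_approx (\<lambda>x. 0 * indicator {..0::real} x)"
      by (intro trig_approx_cmult trig_approx_halfline) auto
    then show ?case by (simp add: indicator_def[abs_def])
  next
    case (compl A)
    have [measurable]: "A \<in> sets borel" using compl * by simp
    have "trig_approx (\<lambda>x. 1 + (- 1) * indicator A x)"
      by (intro trig_approx_add trig_approx_cmult compl trig_approx_continuous[of "\<lambda>_. 1"]) auto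
    also have "(\<lambda>x. 1 + (- 1) * indicator A x :: complex) = indicator (UNIV - A)"
      by (auto simp: fun_eq_iff indicator_def)
    finally show ?case .
  next
    case (union A)
    have [measurable]: "A i \<in> sets borel" for i using union * by auto
    define g where "g n x = (\<Sum>i<n. indicator (A i) x :: complex)" for n x
    have [measurable]: "g n \<in> borel_measurable borel" for n unfolding g_def by measurable
    have g: "g n = indicator (\<Union>i<n. A i)" for n
    proof
      fix x
      have "disjoint_family_on A {..<n}"
        using union(1) by (rule disjoint_family_on_mono[rotated]) simp
      then show "g n x = indicator (\<Union>i<n. A i) x"
        unfolding g_def by (subst indicator_UN_disjoint) auto
    qed
    have "trig_approx (g n)" for n
    proof (induction n)
      case 0
      have "trig_approx (\<lambda>_. 0)" by (intro trig_approx_continuous[of _ 0]) auto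
      then show ?case by (simp add: g_def[abs_def])
    next
      case (Suc n)
      have "trig_approx (\<lambda>x. g n x + indicator (A n) x)"
        by (intro trig_approx_add Suc union) auto
      then show ?case by (simp add: g_def[abs_def])
    qed
    moreover have "(\<lambda>n. sqdist U01 (g n) (indicator (\<Union>i. A i))) \<longlonglongrightarrow> 0"
    proof (rule sqdist_LIMSEQ_dominated[where w = "\<lambda>_. 2"])
      show "cmod (g n x - indicator (\<Union>i. A i) x) \<le> 2" for n x
        unfolding g by (auto simp: indicator_def)
      show "AE x in U01. (\<lambda>n. g n x) \<longlonglongrightarrow> indicator (\<Union>i. A i) x"
        unfolding g using LIMSEQ_indicator_UN[of A] by auto
    qed (auto simp: U01.emeasure_space_1[simplified])
    ultimately show ?case by (rule trig_approx_LIMSEQ[rotated 2]) auto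
  qed
qed

text \<open>Simple functions with modulus at most 2|h| converge pointwise to \<open>h\<close>; the
  error is dominated by 3|h|, which is square integrable.\<close>

lemma trig_approx_L2:
  assumes [measurable]: "h \<in> borel_measurable borel"
    and fin: "sq_integral U01 h < \<infinity>"
  shows "trig_approx h"
proof -
  obtain F where F: "\<And>i::nat. simple_function borel (F i)" "\<And>x. (\<lambda>i. F i x) \<longlonglongrightarrow> h x"
     "\<And>i x. cmod (F i x) \<le> 2 * cmod (h x)"
    using borel_measurable_implies_sequence_metric[OF assms(1), of 0] by auto
  have [measurable]: "F i \<in> borel_measurable borel" for i
    using F(1) by (rule borel_measurable_simple_function)
  have "trig_approx (F i)" for i
  proof -
    let ?Y = "range (F i)"
    have fin: "finite ?Y" using F(1)[of i] by (simp add: simple_function_def)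
    have eq: "F i = (\<lambda>x. \<Sum>y\<in>?Y. y * indicator (F i -` {y}) x)"
    proof
      fix x
      have "(\<Sum>y\<in>?Y. y * indicator (F i -` {y}) x) = (\<Sum>y\<in>?Y. if y = F i x then F i x else 0)"
        by (intro sum.cong) (auto simp: indicator_def)
      then show "F i x = (\<Sum>y\<in>?Y. y * indicator (F i -` {y}) x)" using fin by simp
    qed
    have "trig_approx (\<lambda>x. \<Sum>y\<in>Z. y * indicator (F i -` {y}) x)" if "finite Z" for Z
      using that
    proof induction
      case empty
      then show ?case using trig_approx_continuous[of "\<lambda>_. 0" 0] by auto
    next
      case (insert y Z)
      have [measurable]: "F i -` {y} \<in> sets borel" for y
        using measurable_sets[of "F i" borel borel "{y}"] by simp
      have "trig_approx (\<lambda>x. y * indicator (F i -` {y}) x + (\<Sum>y\<in>Z. y * indicator (F i -` {y}) x))"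
      proof (rule trig_approx_add)
        show "trig_approx (\<lambda>x. y * indicator (F i -` {y}) x)"
          by (rule trig_approx_cmult[OF _ trig_approx_indicator]) measurable
        show "trig_approx (\<lambda>x. \<Sum>y\<in>Z. y * indicator (F i -` {y}) x)"
          by (rule insert.IH)
      qed measurable
      then show ?case by (simp only: sum.insert[OF insert(1,2)])
    qed
    from this[OF fin] show ?thesis using eq by metis
  qed
  moreover have "(\<lambda>n. sqdist U01 (F n) h) \<longlonglongrightarrow> 0"
  proof (rule sqdist_LIMSEQ_dominated[where w = "\<lambda>x. 3 * cmod (h x)"])
    show "cmod (F n x - h x) \<le> 3 * cmod (h x)" for n x
      using F(3)[of n x] norm_triangle_ineq4[of "F n x" "h x"] by linarith
    show "(\<integral>\<^sup>+x. ennreal ((3 * cmod (h x))\<^sup>2) \<partial>U01) < \<infinity>"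
      using fin by (simp add: power_mult_distrib ennreal_mult nn_integral_cmult ennreal_mult_less_top)
  qed (use F in auto)
  ultimately show ?thesis by (rule trig_approx_LIMSEQ[rotated 2]) auto
qed

section \<open>Bessel's inequality and Parseval's identity on the interval\<close>

lemma integrable_U01_of_square:
  assumes [measurable]: "h \<in> borel_measurable borel"
    and fin: "sq_integral U01 h < \<infinity>"
  shows "integrable U01 h" "integrable U01 (\<lambda>x. (cmod (h x))\<^sup>2)"
proof -
  show 1: "integrable U01 (\<lambda>x. (cmod (h x))\<^sup>2)"
    using fin by (intro integrableI_bounded) auto
  show "integrable U01 h"
  proof (rule Bochner_Integration.integrable_bound)
    show "integrable U01 (\<lambda>x. 1 + (cmod (h x))\<^sup>2)" using 1 by simp
    show "AE x in U01. norm (h x) \<le> norm (1 + (cmod (h x))\<^sup>2)"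
    proof (rule AE_I2)
      fix x
      \<comment> \<open>The inequality 2t <= 1 + t^2, on a space of finite mass, makes square
        integrable functions integrable.\<close>
      have "0 \<le> (cmod (h x) - 1)\<^sup>2" by simp
      then have "2 * cmod (h x) \<le> 1 + (cmod (h x))\<^sup>2" by (simp add: power2_diff)
      then show "norm (h x) \<le> norm (1 + (cmod (h x))\<^sup>2)"
        using norm_ge_zero[of "h x"] unfolding real_norm_def by linarith
    qed
  qed auto
qed

text \<open>Expand the square of \<open>h - p\<close> and complete the square in the coefficients.
  The one identity gives Bessel's inequality, when the \<open>a n\<close> are the Fourier
  coefficients, and the reverse estimate, when \<open>p\<close> is a good approximation. Since
  \<open>c n\<close> is formed with the character of frequency \<open>n\<close>, the Fourier
  coefficient belonging to \<open>a n\<close> is \<open>c (- n)\<close>.\<close>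

lemma sqdist_trig_poly:
  assumes [measurable]: "h \<in> borel_measurable borel"
    and fin: "sq_integral U01 h < \<infinity>" and N: "finite N"
  defines "c \<equiv> \<lambda>n::int. LINT x|U01. h x * chr (of_int n * x)"
  shows "(LINT x|U01. (cmod (h x))\<^sup>2) + (\<Sum>n\<in>N. (cmod (a n - c (- n)))\<^sup>2)
    = (LINT x|U01. (cmod (h x - (\<Sum>n\<in>N. a n * chr (of_int n * x))))\<^sup>2) + (\<Sum>n\<in>N. (cmod (c (- n)))\<^sup>2)"
proof -
  define p where "p x = (\<Sum>n\<in>N. a n * chr (of_int n * x))" for x
  have [measurable]: "p \<in> borel_measurable borel" unfolding p_def by measurable
  note int = integrable_U01_of_square[OF assms(1,2)]
  have inth: "integrable U01 (\<lambda>x. h x * chr (r * x))" for r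
    by (rule Bochner_Integration.integrable_bound[OF int(1)]) (auto simp: norm_mult)
  have intc: "integrable U01 (\<lambda>x. chr (r * x))" for r
    by (rule U01.integrable_const_bound[of _ 1]) auto
  have cnjp: "cnj (p x) = (\<Sum>n\<in>N. cnj (a n) * chr (of_int (- n) * x))" for x
    by (simp add: p_def cnj_chr)
  have pp: "p x * cnj (p x) = (\<Sum>n\<in>N. \<Sum>k\<in>N. a n * cnj (a k) * chr (of_int (n - k) * x))" for x
    unfolding cnjp unfolding p_def sum_product
    by (intro sum.cong refl) (simp add: ring_distribs mult_ac flip: chr_add)
  have hp: "h x * cnj (p x) = (\<Sum>n\<in>N. cnj (a n) * (h x * chr (of_int (- n) * x)))" for x
    unfolding cnjp by (simp add: sum_distrib_left mult_ac)
  have intpp: "integrable U01 (\<lambda>x. p x * cnj (p x))" and inthp: "integrable U01 (\<lambda>x. h x * cnj (p x))"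
    unfolding pp hp
    by (intro Bochner_Integration.integrable_sum integrable_mult_right intc inth)+
  have 1: "(LINT x|U01. p x * cnj (p x)) = (\<Sum>n\<in>N. a n * cnj (a n))"
  proof -
    have "(LINT x|U01. p x * cnj (p x)) = (\<Sum>n\<in>N. \<Sum>k\<in>N. a n * cnj (a k) * (LINT x|U01. chr (of_int (n - k) * x)))"
      unfolding pp
      by (subst Bochner_Integration.integral_sum,
          intro Bochner_Integration.integrable_sum integrable_mult_right intc)+ (simp add: intc)
    also have "\<dots> = (\<Sum>n\<in>N. \<Sum>k\<in>N. if n = k then a n * cnj (a n) else 0)"
      unfolding integral_chr_U01 by (intro sum.cong refl) auto
    finally show ?thesis using N by simp
  qed
  have 2: "(LINT x|U01. h x * cnj (p x)) = (\<Sum>n\<in>N. cnj (a n) * c (- n))"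
    unfolding hp c_def
    by (subst Bochner_Integration.integral_sum) (intro integrable_mult_right inth, simp)
  have exp: "(cmod (u - v))\<^sup>2 = (cmod u)\<^sup>2 - 2 * Re (u * cnj v) + Re (v * cnj v)" for u v
    by (simp only: cmod_power2 minus_complex.simps times_complex.simps complex_cnj power2_diff)
       (simp add: algebra_simps power2_eq_square)
  have "(LINT x|U01. (cmod (h x - p x))\<^sup>2) =
    (LINT x|U01. (cmod (h x))\<^sup>2 - 2 * Re (h x * cnj (p x)) + Re (p x * cnj (p x)))"
    by (simp only: exp)
  also have "\<dots> = (LINT x|U01. (cmod (h x))\<^sup>2) - 2 * Re (LINT x|U01. h x * cnj (p x))
      + Re (LINT x|U01. p x * cnj (p x))"
    using int(2) integrable_Re[OF intpp] integrable_Re[OF inthp] integral_Re[OF intpp] integral_Re[OF inthp]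
    by (simp del: times_complex.simps complex_cnj)
  also have "\<dots> = (LINT x|U01. (cmod (h x))\<^sup>2) + (\<Sum>n\<in>N. Re (a n * cnj (a n)) - 2 * Re (cnj (a n) * c (- n)))"
    unfolding 1 2 by (simp add: sum_subtractf sum_distrib_left)
  finally have "(LINT x|U01. (cmod (h x - p x))\<^sup>2) + (\<Sum>n\<in>N. (cmod (c (- n)))\<^sup>2) = (LINT x|U01. (cmod (h x))\<^sup>2) +
     (\<Sum>n\<in>N. Re (a n * cnj (a n)) - 2 * Re (cnj (a n) * c (- n)) + (cmod (c (- n)))\<^sup>2)"
    by (simp add: sum.distrib)
  also have "(\<Sum>n\<in>N. Re (a n * cnj (a n)) - 2 * Re (cnj (a n) * c (- n)) + (cmod (c (- n)))\<^sup>2) =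
      (\<Sum>n\<in>N. (cmod (a n - c (- n)))\<^sup>2)"
    by (intro sum.cong refl) (simp only: exp, simp only: cmod_power2, simp add: algebra_simps power2_eq_square)
  finally show ?thesis by (simp add: p_def)
qed

lemma parseval_U01:
  assumes [measurable]: "h \<in> borel_measurable borel"
    and fin: "sq_integral U01 h < \<infinity>"
  shows "(sq_integral (count_space UNIV) (\<lambda>n. LINT x|U01. h x * chr (of_int n * x)))
    = sq_integral U01 h"
proof -
  define c where "c n = (LINT x|U01. h x * chr (of_int n * x))" for n :: int
  define S where "S = (LINT x|U01. (cmod (h x))\<^sup>2)"
  note int = integrable_U01_of_square[OF assms]
  have S: "sq_integral U01 h = ennreal S" "S \<ge> 0"
    unfolding S_def using nn_integral_eq_integral[OF int(2)] by auto
  have bessel: "(\<Sum>n\<in>N. (cmod (c n))\<^sup>2) \<le> S" if "finite N" for N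
  proof -
    \<comment> \<open>With the optimal coefficients \<open>c (- n)\<close> the second sum on the
      left vanishes.\<close>
    have "S + (\<Sum>n\<in>uminus ` N. (cmod (c (- n) - c (- n)))\<^sup>2)
    = (LINT x|U01. (cmod (h x - (\<Sum>n\<in>uminus ` N. c (- n) * chr (of_int n * x))))\<^sup>2) + (\<Sum>n\<in>uminus ` N. (cmod (c (- n)))\<^sup>2)"
      unfolding S_def c_def using that by (intro sqdist_trig_poly[OF assms]) auto
    moreover have "(LINT x|U01. (cmod (h x - (\<Sum>n\<in>uminus ` N. c (- n) * chr (of_int n * x))))\<^sup>2) \<ge> 0"
      by simp
    moreover have "(\<Sum>n\<in>uminus ` N. (cmod (c (- n)))\<^sup>2) = (\<Sum>n\<in>N. (cmod (c n))\<^sup>2)"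
      by (subst sum.reindex) (auto intro: inj_onI)
    ultimately show ?thesis by simp
  qed
  have sum_le: "ennreal (\<Sum>n\<in>N. (cmod (c n))\<^sup>2) \<le> sq_integral (count_space UNIV) c"
    if "finite N" for N
  proof -
    have "ennreal (\<Sum>n\<in>N. (cmod (c n))\<^sup>2) = (\<integral>\<^sup>+n. ennreal ((cmod (c n))\<^sup>2) \<partial>count_space N)"
      using that by (simp add: nn_integral_count_space_finite sum_ennreal)
    also have "\<dots> \<le> sq_integral (count_space UNIV) c"
      by (subst nn_integral_count_space_indicator) (auto intro!: nn_integral_mono simp: indicator_def)
    finally show ?thesis .
  qed
  \<comment> \<open>For \<open>p\<close> within \<open>e\<close> of \<open>h\<close>, dropping the
    nonnegative sum with the \<open>a n\<close> bounds \<open>S\<close> by \<open>e\<close> plus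
    finitely many squared coefficients.\<close>
  have "ennreal S \<le> sq_integral (count_space UNIV) c"
  proof (rule ennreal_le_epsilon)
    fix e :: real assume e: "e > 0"
    obtain p where p: "trig_poly UNIV p" "sqdist U01 h p < ennreal e"
      using trig_approx_L2[OF assms] e unfolding trig_approx_def by blast
    obtain N a where N: "finite N" "p = (\<lambda>x. \<Sum>n\<in>N. a n * chr (of_int n * x))"
      using p by (auto simp: trig_poly_iff_chr)
    note [measurable] = trig_poly_borel[OF p(1)]
    have "integrable U01 (\<lambda>x. (cmod (h x - p x))\<^sup>2)"
      using p(2) unfolding sqdist_def
      by (intro integrableI_bounded) (auto intro: less_trans)
    then have "sqdist U01 h p = ennreal (LINT x|U01. (cmod (h x - p x))\<^sup>2)"
      unfolding sqdist_def by (intro nn_integral_eq_integral) auto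
    with p(2) have *: "(LINT x|U01. (cmod (h x - p x))\<^sup>2) < e"
      using e by (simp add: ennreal_less_iff)
    have "S + (\<Sum>n\<in>N. (cmod (a n - c (- n)))\<^sup>2) = (LINT x|U01. (cmod (h x - p x))\<^sup>2) + (\<Sum>n\<in>N. (cmod (c (- n)))\<^sup>2)"
      unfolding S_def c_def N(2) using N(1) by (intro sqdist_trig_poly[OF assms])
    moreover have "(\<Sum>n\<in>N. (cmod (c (- n)))\<^sup>2) = (\<Sum>n\<in>uminus ` N. (cmod (c n))\<^sup>2)"
      by (subst sum.reindex) (auto intro: inj_onI)
    moreover have "(\<Sum>n\<in>N. (cmod (a n - c (- n)))\<^sup>2) \<ge> 0" by (intro sum_nonneg) auto
    ultimately have "S \<le> e + (\<Sum>n\<in>uminus ` N. (cmod (c n))\<^sup>2)" using * by linarith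
    then have "ennreal S \<le> ennreal ((\<Sum>n\<in>uminus ` N. (cmod (c n))\<^sup>2) + e)"
      by (intro ennreal_leI) auto
    also have "\<dots> = ennreal (\<Sum>n\<in>uminus ` N. (cmod (c n))\<^sup>2) + ennreal e"
      using e by (intro ennreal_plus sum_nonneg) auto
    also have "\<dots> \<le> sq_integral (count_space UNIV) c + ennreal e"
      using N by (intro add_right_mono sum_le) auto
    finally show "ennreal S \<le> sq_integral (count_space UNIV) c + ennreal e" .
  qed
  moreover have "sq_integral (count_space UNIV) c \<le> ennreal S"
  proof -
    have "sq_integral (count_space UNIV) c = (SUP F\<in>{F. finite F}. \<Sum>n\<in>F. ennreal ((cmod (c n))\<^sup>2))"
      using nn_integral_count_space_eq_SUP[of "UNIV::int set"] by simp
    also have "\<dots> \<le> ennreal S" using bessel by (intro SUP_least) (auto simp: sum_ennreal intro!: ennreal_leI)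
    finally show ?thesis .
  qed
  ultimately show ?thesis unfolding S c_def by (rule antisym[rotated])
qed

section \<open>Fourier series and lattices in the plane\<close>

text \<open>Carries the product measure, on which iterated integrals are available, over to the
  plane.\<close>

definition pt :: "real \<times> real \<Rightarrow> real^2" where
  "pt z = vector [fst z, snd z]"

lemma pt_nth [simp]: "pt z $ 1 = fst z" "pt z $ 2 = snd z"
  by (simp_all add: pt_def)

lemma pt_eq: "pt z = fst z *\<^sub>R axis 1 1 + snd z *\<^sub>R axis 2 1"
  by (simp add: vec_eq_iff forall_2 axis_def)

lemma pt_measurable [measurable]: "pt \<in> borel_measurable borel"
  unfolding pt_eq[abs_def] by (intro borel_measurable_continuous_onI continuous_intros)

lemma pt_measurable' [measurable]: "pt \<in> borel_measurable (borel \<Otimes>\<^sub>M borel)"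
  using pt_measurable by (simp add: borel_prod)

lemma vec_nth_measurable [measurable]: "(\<lambda>\<xi>::real^'n. \<xi> $ i) \<in> borel_measurable borel"
  by (intro borel_measurable_continuous_onI continuous_intros)

lemma Basis_real2: "(Basis :: (real^2) set) = {axis 1 1, axis 2 1}"
  by (auto simp: Basis_vec_def UNIV_2)

lemma prod_Basis_real2: "(\<Prod>b\<in>Basis. (x::real^2) \<bullet> b) = x $ 1 * x $ 2"
  unfolding Basis_real2 by (subst prod.insert) (auto simp: axis_eq_axis inner_axis)

lemma lborel_real2: "(lborel :: (real^2) measure) = distr (lborel \<Otimes>\<^sub>M lborel) borel pt"
proof (rule lborel_eqI)
  fix l u :: "real^2" assume lu: "\<And>b. b \<in> Basis \<Longrightarrow> l \<bullet> b \<le> u \<bullet> b"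
  then have "l \<bullet> axis 1 1 \<le> u \<bullet> axis 1 1" "l \<bullet> axis 2 1 \<le> u \<bullet> axis 2 1"
    unfolding Basis_real2 by blast+
  then have lu': "l $ 1 \<le> u $ 1" "l $ 2 \<le> u $ 2"
    by (simp_all add: inner_axis)
  have "pt -` box l u = box (l $ 1) (u $ 1) \<times> box (l $ 2) (u $ 2)"
    by (auto simp: mem_box Basis_real2 inner_axis)
  then have "emeasure (distr (lborel \<Otimes>\<^sub>M lborel) borel pt) (box l u) =
      emeasure (lborel \<Otimes>\<^sub>M lborel) (box (l $ 1) (u $ 1) \<times> box (l $ 2) (u $ 2))"
    by (subst emeasure_distr) (auto simp: space_pair_measure)
  also have "\<dots> = ennreal (u $ 1 - l $ 1) * ennreal (u $ 2 - l $ 2)"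
    using lu' by (subst lborel.emeasure_pair_measure_Times) auto
  also have "\<dots> = (\<Prod>b\<in>Basis. (u - l) \<bullet> b)"
    using lu' by (simp add: prod_Basis_real2 ennreal_mult)
  finally show "emeasure (distr (lborel \<Otimes>\<^sub>M lborel) borel pt) (box l u) = (\<Prod>b\<in>Basis. (u - l) \<bullet> b)" .
qed simp

definition unit_square :: "(real^2) set" where
  "unit_square = {\<xi>. \<xi> $ 1 \<in> {0..<1} \<and> \<xi> $ 2 \<in> {0..<1}}"

lemma unit_square_borel [measurable]: "unit_square \<in> sets borel"
proof -
  have "Measurable.pred borel (\<lambda>\<xi>::real^2. \<xi> $ 1 \<in> {0..<1} \<and> \<xi> $ 2 \<in> {0..<1})"
    by measurable
  then show ?thesis unfolding unit_square_def by simp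
qed

definition U2 :: "(real^2) measure" where
  "U2 = distr (U01 \<Otimes>\<^sub>M U01) borel pt"

lemma space_U2 [simp]: "space U2 = UNIV" and sets_U2 [simp, measurable_cong]: "sets U2 = sets borel"
  by (simp_all add: U2_def)

interpretation U01_pair: pair_sigma_finite U01 U01 ..

interpretation U2: prob_space U2
proof -
  interpret pair_prob_space U01 U01 ..
  show "prob_space U2" unfolding U2_def by (rule prob_space_distr) auto
qed

text \<open>\<open>U2\<close> is used in two forms: as the image of a product it gives iterated
  integrals and hence Parseval in two variables, as a density of Lebesgue measure it gives the
  tiling of the plane.\<close>

lemma U2_density: "U2 = density lborel (indicator unit_square)"
proof -
  have "U01 \<Otimes>\<^sub>M U01 = density (lborel \<Otimes>\<^sub>M lborel) (\<lambda>(x, y). indicator {0..<1} x * indicator {0..<1} y)"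
    unfolding U01_def
    using U01.sigma_finite_measure_axioms lborel.sigma_finite_measure_axioms
    by (intro pair_measure_density) (auto simp: U01_def)
  also have "\<dots> = density (lborel \<Otimes>\<^sub>M lborel) (\<lambda>z. indicator unit_square (pt z))"
    by (intro arg_cong2[of _ _ _ _ density] refl) (auto simp: fun_eq_iff unit_square_def indicator_def)
  finally show ?thesis
    unfolding U2_def lborel_real2 by (subst density_distr) auto
qed

lemma nn_integral_U2:
  "f \<in> borel_measurable borel \<Longrightarrow> (\<integral>\<^sup>+\<xi>. f \<xi> \<partial>U2) = (\<integral>\<^sup>+\<xi>. indicator unit_square \<xi> * f \<xi> \<partial>lborel)"
  by (simp add: U2_density nn_integral_density)

lemma nn_integral_U2_iterated:
  assumes [measurable]: "f \<in> borel_measurable borel"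
  shows "(\<integral>\<^sup>+\<xi>. f \<xi> \<partial>U2) = (\<integral>\<^sup>+x. \<integral>\<^sup>+y. f (pt (x, y)) \<partial>U01 \<partial>U01)"
proof -
  have "(\<integral>\<^sup>+\<xi>. f \<xi> \<partial>U2) = (\<integral>\<^sup>+z. f (pt z) \<partial>(U01 \<Otimes>\<^sub>M U01))"
    unfolding U2_def by (subst nn_integral_distr) auto
  also have "\<dots> = (\<integral>\<^sup>+x. \<integral>\<^sup>+y. f (pt (x, y)) \<partial>U01 \<partial>U01)"
    using U01.nn_integral_fst[of "\<lambda>z. f (pt z)" U01] by simp
  finally show ?thesis .
qed

lemma integral_U2_iterated:
  fixes f :: "real^2 \<Rightarrow> complex"
  assumes "integrable U2 f"
  shows "(LINT \<xi>|U2. f \<xi>) = (LINT x|U01. LINT y|U01. f (pt (x, y)))"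
proof -
  have [measurable]: "f \<in> borel_measurable borel" using borel_measurable_integrable[OF assms] by simp
  have "(LINT \<xi>|U2. f \<xi>) = (LINT z|(U01 \<Otimes>\<^sub>M U01). f (pt z))"
    unfolding U2_def by (subst integral_distr) auto
  moreover have "integrable (U01 \<Otimes>\<^sub>M U01) (\<lambda>z. f (pt z))"
    using assms unfolding U2_def by (subst (asm) integrable_distr_eq) auto
  ultimately show ?thesis using U01_pair.integral_fst'[of "\<lambda>z. f (pt z)"] by simp
qed

lemma vec_of_int_nth [simp]: "vec_of_int m $ i = of_int (m $ i)"
  by (simp add: vec_of_int_def)

lemma vec_of_int_add: "vec_of_int (k + l) = vec_of_int k + vec_of_int l"
  and vec_of_int_minus: "vec_of_int (- k) = - vec_of_int k"
  and vec_of_int_0 [simp]: "vec_of_int 0 = 0"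
  by (simp_all add: vec_eq_iff)

lemma inner_real2: "(x::real^2) \<bullet> y = x $ 1 * y $ 1 + x $ 2 * y $ 2"
  by (simp add: inner_vec_def sum_2)

lemma chr_vec_of_int [simp]: "chr (vec_of_int m \<bullet> vec_of_int k) = 1"
proof -
  have "vec_of_int m \<bullet> vec_of_int k = of_int (m $ 1 * k $ 1 + m $ 2 * k $ 2)"
    by (simp add: inner_real2)
  then show ?thesis by (simp only: chr_of_int)
qed

section \<open>Exchanging lattice sums with integrals, and Parseval on the unit square\<close>

lemma nn_integral_count_int2:
  fixes f :: "int^2 \<Rightarrow> ennreal"
  shows "(\<integral>\<^sup>+m. f m \<partial>count_space UNIV) =
    (\<integral>\<^sup>+a. \<integral>\<^sup>+b. f (vector [a, b]) \<partial>count_space UNIV \<partial>count_space UNIV)"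
proof -
  have "bij (\<lambda>(a, b). vector [a, b] :: int^2)"
    by (rule bij_betw_byWitness[where f' = "\<lambda>m. (m $ 1, m $ 2)"]) (auto simp: vec_eq_iff forall_2)
  from nn_integral_bij_count_space[OF this, of f, symmetric] show ?thesis
    by (simp add: nn_integral_fst_count_space[symmetric])
qed

text \<open>Over a countable index set, measurability of every section already gives joint
  measurability, so Tonelli applies.\<close>

lemma nn_integral_count_swap:
  assumes "countable A" "sigma_finite_measure M"
    and "\<And>a. a \<in> A \<Longrightarrow> f a \<in> borel_measurable M"
  shows "(\<integral>\<^sup>+x. \<integral>\<^sup>+a. f a x \<partial>count_space A \<partial>M) = (\<integral>\<^sup>+a. \<integral>\<^sup>+x. f a x \<partial>M \<partial>count_space A)"
proof -
  interpret pair_sigma_finite "count_space A" M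
    using assms by (auto simp: pair_sigma_finite_def intro: sigma_finite_measure_count_space_countable)
  show ?thesis
    using assms by (intro Fubini' measurable_pair_measure_countable1) auto
qed

lemma borel_measurable_nn_integral_count:
  fixes f :: "'a \<Rightarrow> 'b \<Rightarrow> ennreal"
  assumes "countable A" "\<And>a. a \<in> A \<Longrightarrow> f a \<in> borel_measurable M"
  shows "(\<lambda>x. \<integral>\<^sup>+a. f a x \<partial>count_space A) \<in> borel_measurable M"
proof -
  interpret sigma_finite_measure "count_space A"
    using assms by (intro sigma_finite_measure_count_space_countable)
  have "(\<lambda>z. f (fst z) (snd z)) \<in> borel_measurable (count_space A \<Otimes>\<^sub>M M)"
    using assms by (intro measurable_pair_measure_countable1) auto
  then have "(\<lambda>(x, a). f a x) \<in> borel_measurable (M \<Otimes>\<^sub>M count_space A)"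
    by (subst measurable_pair_swap_iff) (simp add: case_prod_unfold)
  then show ?thesis by (rule borel_measurable_nn_integral)
qed

text \<open>Parseval in the second variable for almost every \<open>x\<close>, then in the first
  variable for each partial coefficient \<open>c b\<close>.\<close>

lemma parseval_U2:
  fixes h :: "real^2 \<Rightarrow> complex"
  assumes [measurable]: "h \<in> borel_measurable borel"
    and fin: "sq_integral U2 h < \<infinity>"
  shows "(sq_integral (count_space UNIV) (\<lambda>m. LINT \<xi>|U2. h \<xi> * chr (vec_of_int m \<bullet> \<xi>)))
    = sq_integral U2 h"
proof -
  define c where "c b x = (LINT y|U01. h (pt (x, y)) * chr (of_int b * y))" for b :: int and x
  have [measurable]: "c b \<in> borel_measurable borel" for b
    unfolding c_def by measurable
  have int: "integrable U2 (\<lambda>\<xi>. h \<xi> * chr (m \<bullet> \<xi>))" for m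
  proof (rule Bochner_Integration.integrable_bound)
    have "integrable U2 (\<lambda>\<xi>. (cmod (h \<xi>))\<^sup>2)"
      using fin by (intro integrableI_bounded) auto
    then show "integrable U2 (\<lambda>\<xi>. 1 + (cmod (h \<xi>))\<^sup>2)" by simp
    show "AE x in U2. cmod (h x * chr (m \<bullet> x)) \<le> norm (1 + (cmod (h x))\<^sup>2)"
    proof (rule AE_I2)
      fix x
      have "0 \<le> (cmod (h x) - 1)\<^sup>2" by simp
      then have "2 * cmod (h x) \<le> 1 + (cmod (h x))\<^sup>2" by (simp add: power2_diff)
      then show "cmod (h x * chr (m \<bullet> x)) \<le> norm (1 + (cmod (h x))\<^sup>2)"
        using norm_ge_zero[of "h x"] unfolding real_norm_def norm_mult norm_chr by linarith
    qed
  qed measurable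
  have coef: "(LINT \<xi>|U2. h \<xi> * chr (vec_of_int (vector [a, b]) \<bullet> \<xi>)) = (LINT x|U01. c b x * chr (of_int a * x))" for a b
  proof -
    have "(LINT \<xi>|U2. h \<xi> * chr (vec_of_int (vector [a, b]) \<bullet> \<xi>)) =
      (LINT x|U01. LINT y|U01. h (pt (x, y)) * chr (vec_of_int (vector [a, b]) \<bullet> pt (x, y)))"
      by (rule integral_U2_iterated[OF int])
    also have "\<dots> = (LINT x|U01. LINT y|U01. h (pt (x, y)) * chr (of_int b * y) * chr (of_int a * x))"
      by (simp add: inner_real2 chr_add mult_ac)
    finally show ?thesis by (simp add: c_def)
  qed
  have fin2: "(\<integral>\<^sup>+x. \<integral>\<^sup>+y. ennreal ((cmod (h (pt (x, y))))\<^sup>2) \<partial>U01 \<partial>U01) < \<infinity>"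
    using fin by (subst (asm) nn_integral_U2_iterated) auto
  then have AE_fin: "AE x in U01. (sq_integral U01 (\<lambda>y. h (pt (x, y)))) < \<infinity>"
    using nn_integral_PInf_AE[of "\<lambda>x. \<integral>\<^sup>+y. ennreal ((cmod (h (pt (x, y))))\<^sup>2) \<partial>U01" U01]
    by (simp add: top.not_eq_extremum)
  have sum_c: "AE x in U01. (sq_integral (count_space UNIV) (\<lambda>b. c b x)) =
      sq_integral U01 (\<lambda>y. h (pt (x, y)))"
    using AE_fin unfolding c_def
    by eventually_elim (rule parseval_U01; measurable)
  have swap: "(\<integral>\<^sup>+b. \<integral>\<^sup>+x. ennreal ((cmod (c b x))\<^sup>2) \<partial>U01 \<partial>count_space UNIV) =
     (\<integral>\<^sup>+x. \<integral>\<^sup>+y. ennreal ((cmod (h (pt (x, y))))\<^sup>2) \<partial>U01 \<partial>U01)"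
    using nn_integral_cong_AE[OF sum_c]
    by (subst nn_integral_count_swap[symmetric]) (auto intro: U01.sigma_finite_measure_axioms)
  \<comment> \<open>The second application of Parseval needs each \<open>c b\<close> to be square
    integrable; it is one term of the finite total computed in \<open>swap\<close>.\<close>
  have fin_c: "sq_integral U01 (c b) < \<infinity>" for b
  proof -
    have "sq_integral U01 (c b) \<le>
      (\<integral>\<^sup>+b. \<integral>\<^sup>+x. ennreal ((cmod (c b x))\<^sup>2) \<partial>U01 \<partial>count_space UNIV)"
      by (rule nn_integral_ge_point) simp
    then show ?thesis unfolding swap using fin2 by (rule le_less_trans)
  qed
  have "(sq_integral (count_space UNIV) (\<lambda>m. LINT \<xi>|U2. h \<xi> * chr (vec_of_int m \<bullet> \<xi>))) =
    (\<integral>\<^sup>+a. \<integral>\<^sup>+b. ennreal ((cmod (LINT x|U01. c b x * chr (of_int a * x)))\<^sup>2) \<partial>count_space UNIV \<partial>count_space UNIV)"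
    unfolding nn_integral_count_int2 coef ..
  also have "\<dots> = (\<integral>\<^sup>+b. \<integral>\<^sup>+a. ennreal ((cmod (LINT x|U01. c b x * chr (of_int a * x)))\<^sup>2) \<partial>count_space UNIV \<partial>count_space UNIV)"
    by (rule nn_integral_count_swap) (auto intro: sigma_finite_measure_count_space_countable)
  also have "\<dots> = (\<integral>\<^sup>+b. \<integral>\<^sup>+x. ennreal ((cmod (c b x))\<^sup>2) \<partial>U01 \<partial>count_space UNIV)"
    by (intro nn_integral_cong parseval_U01 fin_c) auto
  also have "\<dots> = sq_integral U2 h"
    unfolding swap by (rule nn_integral_U2_iterated[symmetric]) measurable
  finally show ?thesis .
qed

section \<open>The tiling of the plane by integer translates of the unit square\<close>

lemma nn_integral_indicator_lattice:
  "(\<integral>\<^sup>+l. indicator unit_square (\<xi> - vec_of_int l) \<partial>count_space UNIV) = 1"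
proof -
  \<comment> \<open>Because the square is half-open, the coordinatewise floor is the only
    translation that catches \<open>\<xi>\<close>.\<close>
  define l0 :: "int^2" where "l0 = (\<chi> i. \<lfloor>\<xi> $ i\<rfloor>)"
  have iff: "0 \<le> x - of_int k \<and> x - of_int k < 1 \<longleftrightarrow> k = \<lfloor>x\<rfloor>" for x :: real and k
    using floor_unique[of k x] by (auto simp: floor_less_iff) linarith+
  have "\<xi> - vec_of_int l \<in> unit_square \<longleftrightarrow> l \<in> {l0}" for l
    by (simp only: unit_square_def vec_eq_iff forall_2 l0_def mem_Collect_eq atLeastLessThan_iff
        vector_minus_component vec_of_int_nth iff vec_lambda_beta singleton_iff)
  then have "(\<integral>\<^sup>+l. indicator unit_square (\<xi> - vec_of_int l) \<partial>count_space UNIV) =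
    (\<integral>\<^sup>+l. indicator {l0} l \<partial>count_space UNIV)"
    by (intro nn_integral_cong) (simp add: indicator_def)
  also have "\<dots> = 1" by simp
  finally show ?thesis .
qed

lemma nn_integral_lborel_translate:
  fixes f :: "'a::euclidean_space \<Rightarrow> ennreal"
  assumes [measurable]: "f \<in> borel_measurable borel"
  shows "(\<integral>\<^sup>+x. f (x + c) \<partial>lborel) = (\<integral>\<^sup>+x. f x \<partial>lborel)"
  by (subst lborel_distr_plus[of c, symmetric], subst nn_integral_distr) (auto simp: add_ac)

text \<open>Insert the partition of unity formed by the translated squares and move each tile back
  to the unit square.\<close>

lemma nn_integral_fold:
  fixes g :: "real^2 \<Rightarrow> ennreal"
  assumes [measurable]: "g \<in> borel_measurable borel"
  shows "(\<integral>\<^sup>+\<xi>. \<integral>\<^sup>+l. g (\<xi> + vec_of_int l) \<partial>count_space UNIV \<partial>U2) = (\<integral>\<^sup>+\<xi>. g \<xi> \<partial>lborel)"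
proof -
  have "(\<integral>\<^sup>+\<xi>. g \<xi> \<partial>lborel) =
     (\<integral>\<^sup>+\<xi>. \<integral>\<^sup>+l. g \<xi> * indicator unit_square (\<xi> - vec_of_int l) \<partial>count_space UNIV \<partial>lborel)"
    by (simp add: nn_integral_cmult nn_integral_indicator_lattice)
  also have "\<dots> = (\<integral>\<^sup>+l. \<integral>\<^sup>+\<xi>. g \<xi> * indicator unit_square (\<xi> - vec_of_int l) \<partial>lborel \<partial>count_space UNIV)"
    by (rule nn_integral_count_swap) (auto intro: lborel.sigma_finite_measure_axioms)
  also have "\<dots> = (\<integral>\<^sup>+l. \<integral>\<^sup>+\<xi>. g (\<xi> + vec_of_int l) \<partial>U2 \<partial>count_space UNIV)"
  proof (rule nn_integral_cong)
    fix l
    show "(\<integral>\<^sup>+\<xi>. g \<xi> * indicator unit_square (\<xi> - vec_of_int l) \<partial>lborel) = (\<integral>\<^sup>+\<xi>. g (\<xi> + vec_of_int l) \<partial>U2)"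
      using nn_integral_lborel_translate[of "\<lambda>\<xi>. g \<xi> * indicator unit_square (\<xi> - vec_of_int l)" "vec_of_int l"]
      by (simp add: nn_integral_U2 mult.commute)
  qed
  also have "\<dots> = (\<integral>\<^sup>+\<xi>. \<integral>\<^sup>+l. g (\<xi> + vec_of_int l) \<partial>count_space UNIV \<partial>U2)"
    by (rule nn_integral_count_swap[symmetric]) (auto intro: U2.sigma_finite_measure_axioms)
  finally show ?thesis ..
qed

interpretation lattice: pair_sigma_finite U2 "count_space (UNIV :: (int^2) set)"
  by (auto simp: pair_sigma_finite_def intro: sigma_finite_measure_count_space_countable U2.sigma_finite_measure_axioms)

lemma translate_measurable_pair:
  fixes g :: "real^2 \<Rightarrow> 'b::topological_space"
  assumes [measurable]: "g \<in> borel_measurable borel"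
  shows "(\<lambda>(\<xi>, l). g (\<xi> + vec_of_int l)) \<in> borel_measurable (U2 \<Otimes>\<^sub>M count_space UNIV)"
proof -
  have "(\<lambda>z. g (snd z + vec_of_int (fst z))) \<in> borel_measurable (count_space UNIV \<Otimes>\<^sub>M U2)"
    by (rule measurable_pair_measure_countable1) auto
  then show ?thesis
    by (subst measurable_pair_swap_iff) (simp add: case_prod_unfold)
qed

text \<open>The tiling as an equality of measures. In this form it also serves complex-valued
  integrands, through Fubini for the Bochner integral.\<close>

lemma lborel_eq_fold:
  "(lborel :: (real^2) measure) = distr (U2 \<Otimes>\<^sub>M count_space UNIV) borel (\<lambda>(\<xi>, l). \<xi> + vec_of_int l)"
proof (rule measure_eqI)
  have meas: "(\<lambda>(\<xi>, l). \<xi> + vec_of_int l) \<in> borel_measurable (U2 \<Otimes>\<^sub>M count_space (UNIV :: (int^2) set))"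
    by (rule translate_measurable_pair) simp
  fix A :: "(real^2) set" assume "A \<in> sets lborel"
  then have [measurable]: "A \<in> sets borel" by simp
  have "emeasure lborel A = (\<integral>\<^sup>+\<xi>. \<integral>\<^sup>+l. indicator A (\<xi> + vec_of_int l) \<partial>count_space UNIV \<partial>U2)"
    by (subst nn_integral_fold) auto
  also have "\<dots> = (\<integral>\<^sup>+z. indicator A ((\<lambda>(\<xi>, l). \<xi> + vec_of_int l) z) \<partial>(U2 \<Otimes>\<^sub>M count_space UNIV))"
    using measurable_compose[OF meas, of "indicator A :: _ \<Rightarrow> ennreal"]
      lattice.M2.nn_integral_fst[of "\<lambda>z. indicator A ((\<lambda>(\<xi>, l). \<xi> + vec_of_int l) z)" U2]
    by simp
  also have "\<dots> = (\<integral>\<^sup>+x. indicator A x \<partial>distr (U2 \<Otimes>\<^sub>M count_space UNIV) borel (\<lambda>(\<xi>, l). \<xi> + vec_of_int l))"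
    using meas by (rule nn_integral_distr[symmetric]) simp
  also have "\<dots> = emeasure (distr (U2 \<Otimes>\<^sub>M count_space UNIV) borel (\<lambda>(\<xi>, l). \<xi> + vec_of_int l)) A"
    by simp
  finally show "emeasure lborel A = emeasure (distr (U2 \<Otimes>\<^sub>M count_space UNIV) borel (\<lambda>(\<xi>, l). \<xi> + vec_of_int l)) A" .
qed simp

lemma
  fixes g :: "real^2 \<Rightarrow> complex"
  assumes "integrable lborel g"
  shows AE_integrable_fold: "AE \<xi> in U2. integrable (count_space UNIV) (\<lambda>l. g (\<xi> + vec_of_int l))"
    and integral_fold: "(LINT \<xi>|U2. LINT l|count_space UNIV. g (\<xi> + vec_of_int l)) = (LINT \<xi>|lborel. g \<xi>)"
proof -
  have [measurable]: "g \<in> borel_measurable borel" using borel_measurable_integrable[OF assms] by simp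
  have meas: "(\<lambda>(\<xi>, l). \<xi> + vec_of_int l) \<in> borel_measurable (U2 \<Otimes>\<^sub>M count_space (UNIV :: (int^2) set))"
    by (rule translate_measurable_pair) simp
  have int: "integrable (U2 \<Otimes>\<^sub>M count_space (UNIV :: (int^2) set)) (\<lambda>z. g ((\<lambda>(\<xi>, l). \<xi> + vec_of_int l) z))"
    using assms meas by (subst (asm) lborel_eq_fold) (subst (asm) integrable_distr_eq; auto)
  show "AE \<xi> in U2. integrable (count_space UNIV) (\<lambda>l. g (\<xi> + vec_of_int l))"
    using lattice.AE_integrable_fst'[OF int] by simp
  have "(LINT \<xi>|lborel. g \<xi>) = (LINT z|(U2 \<Otimes>\<^sub>M count_space (UNIV :: (int^2) set)). g ((\<lambda>(\<xi>, l). \<xi> + vec_of_int l) z))"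
    using meas by (subst lborel_eq_fold) (subst integral_distr; auto)
  then show "(LINT \<xi>|U2. LINT l|count_space UNIV. g (\<xi> + vec_of_int l)) = (LINT \<xi>|lborel. g \<xi>)"
    using lattice.integral_fst'[OF int] by simp
qed

text \<open>The periodization of \<open>g\<close>. Where the translates are not absolutely summable
  the integral takes its default value 0; for integrable \<open>g\<close> this concerns a null set,
  by \<open>AE_integrable_fold\<close>.\<close>

definition fold_lattice :: "(real^2 \<Rightarrow> complex) \<Rightarrow> real^2 \<Rightarrow> complex" where
  "fold_lattice g \<xi> = (LINT l|count_space UNIV. g (\<xi> + vec_of_int l))"

lemma fold_lattice_measurable [measurable]:
  assumes [measurable]: "g \<in> borel_measurable borel"
  shows "fold_lattice g \<in> borel_measurable borel"
proof -
  have "(\<lambda>\<xi>. LINT l|count_space UNIV. g (\<xi> + vec_of_int l)) \<in> borel_measurable U2"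
    using translate_measurable_pair[OF assms]
    by (intro lattice.M2.borel_measurable_lebesgue_integral) (simp add: case_prod_unfold)
  then show ?thesis by (simp add: fold_lattice_def[abs_def])
qed

text \<open>The characters with integer frequencies are invariant under the lattice, so the Fourier
  coefficients of the periodization are Fourier integrals of \<open>g\<close> over the
  plane.\<close>

lemma parseval_fold:
  fixes g :: "real^2 \<Rightarrow> complex"
  assumes int: "integrable lborel g"
    and fin: "sq_integral U2 (fold_lattice g) < \<infinity>"
  shows "(sq_integral (count_space UNIV) (\<lambda>m. LINT \<xi>|lborel. g \<xi> * chr (vec_of_int m \<bullet> \<xi>)))
    = sq_integral U2 (fold_lattice g)"
proof -
  have [measurable]: "g \<in> borel_measurable borel" using borel_measurable_integrable[OF int] by simp
  have "(LINT \<xi>|lborel. g \<xi> * chr (vec_of_int m \<bullet> \<xi>)) = (LINT \<xi>|U2. fold_lattice g \<xi> * chr (vec_of_int m \<bullet> \<xi>))" for m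
  proof -
    have "integrable lborel (\<lambda>\<xi>. g \<xi> * chr (vec_of_int m \<bullet> \<xi>))"
      by (rule Bochner_Integration.integrable_bound[OF int]) (auto simp: norm_mult)
    from integral_fold[OF this] show ?thesis
      by (simp add: inner_add_right chr_add fold_lattice_def)
  qed
  then show ?thesis using fin by (simp add: parseval_U2)
qed

section \<open>Diagonal and off-diagonal parts of the square of a sum\<close>

lemma nn_integral_count_split:
  fixes f :: "'a \<Rightarrow> ennreal"
  assumes "countable A" "a \<in> A"
  shows "(\<integral>\<^sup>+k. f k \<partial>count_space A) = f a + (\<integral>\<^sup>+k. f k \<partial>count_space (A - {a}))"
proof -
  have "(\<integral>\<^sup>+k. f k \<partial>count_space A) = (\<integral>\<^sup>+k. f k * indicator {a} k + f k * indicator (A - {a}) k \<partial>count_space A)"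
    by (intro nn_integral_cong) (auto simp: indicator_def)
  also have "\<dots> = (\<integral>\<^sup>+k. f k * indicator {a} k \<partial>count_space A) + (\<integral>\<^sup>+k. f k * indicator (A - {a}) k \<partial>count_space A)"
    by (intro nn_integral_add) auto
  also have "(\<integral>\<^sup>+k. f k * indicator {a} k \<partial>count_space A) = f a"
    using assms by (subst nn_integral_indicator_singleton) auto
  also have "(\<integral>\<^sup>+k. f k * indicator (A - {a}) k \<partial>count_space A) = (\<integral>\<^sup>+k. f k \<partial>count_space (A - {a}))"
    by (subst (1 2) nn_integral_count_space_indicator)
       (auto intro!: nn_integral_cong simp: indicator_def)
  finally show ?thesis .
qed

text \<open>The square of the sum is a double sum whose diagonal is \<open>E\<close>; the remaining
  terms, indexed by the difference \<open>k\<close> of the two positions, have moduli adding up to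
  \<open>X\<close>. The two claims together say that \<open>S\<close> and \<open>E\<close> differ by
  at most \<open>X\<close>.\<close>

lemma norm_integral_square_le_correlation:
  fixes a :: "'g::{ab_group_add, countable} \<Rightarrow> complex"
  assumes int: "integrable (count_space UNIV) a"
  defines "E \<equiv> \<integral>\<^sup>+l. ennreal ((cmod (a l))\<^sup>2) \<partial>count_space UNIV"
    and "X \<equiv> \<integral>\<^sup>+l. \<integral>\<^sup>+k. ennreal (cmod (a l) * cmod (a (l + k))) \<partial>count_space (UNIV - {0}) \<partial>count_space UNIV"
    and "S \<equiv> ennreal ((cmod (LINT l|count_space UNIV. a l))\<^sup>2)"
  shows "S \<le> E + X" "E \<le> S + X"
proof -
  define s where "s = (LINT l|count_space UNIV. a l)"
  have bij: "bij_betw ((+) l) UNIV UNIV" for l :: 'g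
    by (rule bij_betw_byWitness[where f' = "\<lambda>k. k - l"]) auto
  have translate: "(\<integral>\<^sup>+k. ennreal (cmod (a (l + k))) \<partial>count_space UNIV) = (\<integral>\<^sup>+k. ennreal (cmod (a k)) \<partial>count_space UNIV)" for l
    using nn_integral_bij_count_space[OF bij, of "\<lambda>k. ennreal (cmod (a k))" l] by simp
  have fin: "(\<integral>\<^sup>+k. ennreal (cmod (a k)) \<partial>count_space UNIV) < \<infinity>"
    using int by (simp add: integrable_iff_bounded)
  have "S \<le> (\<integral>\<^sup>+l. ennreal (cmod (a l)) \<partial>count_space UNIV) * (\<integral>\<^sup>+l. ennreal (cmod (a l)) \<partial>count_space UNIV)"
  proof -
    have "ennreal (cmod s) \<le> (\<integral>\<^sup>+l. ennreal (cmod (a l)) \<partial>count_space UNIV)"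
      unfolding s_def by (rule integral_norm_bound_ennreal[OF int])
    then show ?thesis unfolding S_def s_def[symmetric]
      by (simp add: power2_eq_square ennreal_mult mult_mono)
  qed
  also have "\<dots> = (\<integral>\<^sup>+l. \<integral>\<^sup>+k. ennreal (cmod (a l) * cmod (a (l + k))) \<partial>count_space UNIV \<partial>count_space UNIV)"
    by (simp add: ennreal_mult nn_integral_cmult translate nn_integral_multc)
  also have "\<dots> = (\<integral>\<^sup>+l. ennreal ((cmod (a l))\<^sup>2) + (\<integral>\<^sup>+k. ennreal (cmod (a l) * cmod (a (l + k))) \<partial>count_space (UNIV - {0})) \<partial>count_space UNIV)"
    by (subst nn_integral_count_split[of UNIV 0]) (auto simp: power2_eq_square)
  also have "\<dots> = E + X"
    unfolding E_def X_def by (rule nn_integral_add) auto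
  finally show "S \<le> E + X" .

  \<comment> \<open>An absolutely summable family is square summable, because each of its terms is
    at most the sum of all moduli.\<close>
  have int_E: "integrable (count_space UNIV) (\<lambda>l. a l * cnj (a l))"
  proof -
    have "(\<integral>\<^sup>+l. ennreal (cmod (a l * cnj (a l))) \<partial>count_space UNIV) \<le>
      (\<integral>\<^sup>+l. ennreal (cmod (a l)) \<partial>count_space UNIV) * (\<integral>\<^sup>+l. ennreal (cmod (a l)) \<partial>count_space UNIV)"
      by (subst nn_integral_cmult[symmetric])
         (auto simp: norm_mult ennreal_mult intro!: nn_integral_mono mult_right_mono nn_integral_ge_point)
    also have "\<dots> < \<infinity>" using fin by (simp add: ennreal_mult_less_top)
    finally show ?thesis by (intro integrableI_bounded) auto
  qed
  \<comment> \<open>The difference \<open>s - a l\<close> is the sum over all other indices, and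
    these are \<open>l + k\<close> with nonzero \<open>k\<close>.\<close>
  have diff: "ennreal (cmod (s - a l)) \<le> (\<integral>\<^sup>+k. ennreal (cmod (a (l + k))) \<partial>count_space (UNIV - {0}))" for l
  proof -
    have 1: "integrable (count_space UNIV) (\<lambda>k. a k * indicator {l} k)"
      by (rule Bochner_Integration.integrable_bound[OF int]) (auto simp: indicator_def)
    have 2: "integrable (count_space UNIV) (\<lambda>k. a k * indicator (-{l}) k)"
      by (rule Bochner_Integration.integrable_bound[OF int]) (auto simp: indicator_def)
    have "s = (LINT k|count_space UNIV. a k * indicator {l} k + a k * indicator (-{l}) k)"
      unfolding s_def by (intro Bochner_Integration.integral_cong) (auto simp: indicator_def)
    also have "\<dots> = (LINT k|count_space UNIV. a k * indicator {l} k) + (LINT k|count_space UNIV. a k * indicator (-{l}) k)"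
      by (rule Bochner_Integration.integral_add[OF 1 2])
    also have "(LINT k|count_space UNIV. a k * indicator {l} k) = (\<Sum>k\<in>{l}. a k * indicator {l} k)"
    proof (subst lebesgue_integral_count_space_finite_support)
      show fin: "finite {k \<in> UNIV. a k * indicator {l} k \<noteq> 0}"
        by (rule finite_subset[of _ "{l}"]) (auto simp: indicator_def split: if_splits)
      show "(\<Sum>k | k \<in> UNIV \<and> a k * indicator {l} k \<noteq> 0. a k * indicator {l} k) = (\<Sum>k\<in>{l}. a k * indicator {l} k)"
        by (rule sum.mono_neutral_left) (auto simp: indicator_def split: if_splits)
    qed
    finally have "ennreal (cmod (s - a l)) = ennreal (cmod (LINT k|count_space UNIV. a k * indicator (-{l}) k))"
      by simp
    also have "\<dots> \<le> (\<integral>\<^sup>+k. ennreal (cmod (a k * indicator (-{l}) k)) \<partial>count_space UNIV)"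
      by (rule integral_norm_bound_ennreal[OF 2])
    also have "\<dots> = (\<integral>\<^sup>+k. ennreal (cmod (a (l + k) * indicator (-{l}) (l + k))) \<partial>count_space UNIV)"
      using nn_integral_bij_count_space[OF bij, of "\<lambda>k. ennreal (cmod (a k * indicator (-{l}) k))" l] by simp
    also have "\<dots> = (\<integral>\<^sup>+k. ennreal (cmod (a (l + k))) \<partial>count_space (UNIV - {0}))"
      by (subst (2) nn_integral_count_space_indicator)
         (auto intro!: nn_integral_cong simp: indicator_def)
    finally show ?thesis .
  qed
  have int_X: "integrable (count_space UNIV) (\<lambda>l. (s - a l) * cnj (a l))"
    using int int_E by (simp add: left_diff_distrib)
  \<comment> \<open>The splitting \<open>a l = s - (s - a l)\<close>, summed against
    \<open>cnj (a l)\<close>.\<close>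
  have "(LINT l|count_space UNIV. a l * cnj (a l)) = (LINT l|count_space UNIV. s * cnj (a l)) - (LINT l|count_space UNIV. (s - a l) * cnj (a l))"
    using int int_X by (subst Bochner_Integration.integral_diff[symmetric]) (auto simp: algebra_simps)
  also have "(LINT l|count_space UNIV. s * cnj (a l)) = s * cnj s"
    using int by (simp add: s_def)
  finally have eq: "(LINT l|count_space UNIV. a l * cnj (a l)) = s * cnj s - (LINT l|count_space UNIV. (s - a l) * cnj (a l))" .
  have "E = ennreal (LINT l|count_space UNIV. (cmod (a l))\<^sup>2)"
    unfolding E_def using integrable_norm[OF int_E]
    by (intro nn_integral_eq_integral) (auto simp: norm_mult power2_eq_square)
  also have "(LINT l|count_space UNIV. (cmod (a l))\<^sup>2) = cmod (LINT l|count_space UNIV. a l * cnj (a l))"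
  proof -
    have "(LINT l|count_space UNIV. a l * cnj (a l)) = of_real (LINT l|count_space UNIV. (cmod (a l))\<^sup>2)"
      by (subst integral_complex_of_real[symmetric]) (simp flip: complex_norm_square)
    then show ?thesis by simp
  qed
  also have "ennreal \<dots> \<le> ennreal ((cmod s)\<^sup>2 + cmod (LINT l|count_space UNIV. (s - a l) * cnj (a l)))"
    unfolding eq using norm_triangle_ineq4[of "s * cnj s"]
    by (intro ennreal_leI) (simp add: norm_mult power2_eq_square)
  also have "\<dots> = S + ennreal (cmod (LINT l|count_space UNIV. (s - a l) * cnj (a l)))"
    unfolding S_def s_def[symmetric] by (rule ennreal_plus) auto
  also have "ennreal (cmod (LINT l|count_space UNIV. (s - a l) * cnj (a l))) \<le>
      (\<integral>\<^sup>+l. ennreal (cmod ((s - a l) * cnj (a l))) \<partial>count_space UNIV)"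
    by (rule integral_norm_bound_ennreal[OF int_X])
  also have "\<dots> = (\<integral>\<^sup>+l. ennreal (cmod (a l)) * ennreal (cmod (s - a l)) \<partial>count_space UNIV)"
    by (simp add: norm_mult ennreal_mult mult.commute)
  also have "\<dots> \<le> (\<integral>\<^sup>+l. ennreal (cmod (a l)) * (\<integral>\<^sup>+k. ennreal (cmod (a (l + k))) \<partial>count_space (UNIV - {0})) \<partial>count_space UNIV)"
    by (intro nn_integral_mono mult_left_mono diff) auto
  also have "\<dots> = X"
    unfolding X_def by (simp add: ennreal_mult nn_integral_cmult)
  finally show "E \<le> S + X" by (simp add: add_left_mono)
qed

text \<open>\<open>norm_integral_square_le_correlation\<close> on almost every fibre, with
  \<open>a l = g (\<xi> + vec_of_int l)\<close>, integrated over the unit square. Its first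
  inequality together with \<open>fin\<close> shows that the periodization is square integrable, and
  only then Parseval identifies \<open>S\<close>.\<close>

lemma parseval_lattice_bounds:
  fixes g :: "real^2 \<Rightarrow> complex"
  assumes int: "integrable lborel g"
  defines "E \<equiv> \<integral>\<^sup>+\<xi>. ennreal ((cmod (g \<xi>))\<^sup>2) \<partial>lborel"
    and "X \<equiv> \<integral>\<^sup>+l. \<integral>\<^sup>+\<xi>. ennreal (cmod (g \<xi>) * cmod (g (\<xi> + vec_of_int l))) \<partial>lborel \<partial>count_space (UNIV - {0})"
    and "S \<equiv> \<integral>\<^sup>+m. ennreal ((cmod (LINT \<xi>|lborel. g \<xi> * chr (vec_of_int m \<bullet> \<xi>)))\<^sup>2) \<partial>count_space UNIV"
  assumes fin: "E + X < \<infinity>"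
  shows "S \<le> E + X" "E \<le> S + X"
proof -
  have [measurable]: "g \<in> borel_measurable borel" using borel_measurable_integrable[OF int] by simp
  let ?e = "\<lambda>\<xi>. \<integral>\<^sup>+l. ennreal ((cmod (g (\<xi> + vec_of_int l)))\<^sup>2) \<partial>count_space UNIV"
  let ?x = "\<lambda>\<xi>. \<integral>\<^sup>+l. \<integral>\<^sup>+k. ennreal (cmod (g (\<xi> + vec_of_int l)) * cmod (g (\<xi> + vec_of_int l + vec_of_int k))) \<partial>count_space (UNIV - {0}) \<partial>count_space UNIV"
  have [measurable]: "?e \<in> borel_measurable borel" "?x \<in> borel_measurable borel"
    by (intro borel_measurable_nn_integral_count; simp; measurable)+
  have E: "E = (\<integral>\<^sup>+\<xi>. ?e \<xi> \<partial>U2)"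
    unfolding E_def by (subst nn_integral_fold) auto
  have "X = (\<integral>\<^sup>+\<xi>. \<integral>\<^sup>+k. ennreal (cmod (g \<xi>) * cmod (g (\<xi> + vec_of_int k))) \<partial>count_space (UNIV - {0}) \<partial>lborel)"
    unfolding X_def by (rule nn_integral_count_swap[symmetric]) (auto intro: lborel.sigma_finite_measure_axioms)
  also have "\<dots> = (\<integral>\<^sup>+\<xi>. ?x \<xi> \<partial>U2)"
    by (subst nn_integral_fold[symmetric]) (auto intro!: borel_measurable_nn_integral_count)
  finally have X: "X = (\<integral>\<^sup>+\<xi>. ?x \<xi> \<partial>U2)" .
  have AE: "AE \<xi> in U2. ennreal ((cmod (fold_lattice g \<xi>))\<^sup>2) \<le> ?e \<xi> + ?x \<xi> \<and>
      ?e \<xi> \<le> ennreal ((cmod (fold_lattice g \<xi>))\<^sup>2) + ?x \<xi>"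
    using AE_integrable_fold[OF int]
  proof eventually_elim
    case (elim \<xi>)
    from norm_integral_square_le_correlation[OF this] show ?case
      by (simp add: fold_lattice_def vec_of_int_add add_ac)
  qed
  have "sq_integral U2 (fold_lattice g) \<le> (\<integral>\<^sup>+\<xi>. ?e \<xi> + ?x \<xi> \<partial>U2)"
    using AE by (intro nn_integral_mono_AE) auto
  also have "\<dots> = E + X" unfolding E X by (rule nn_integral_add) auto
  finally have le: "sq_integral U2 (fold_lattice g) \<le> E + X" .
  have S: "S = sq_integral U2 (fold_lattice g)"
    unfolding S_def using le_less_trans[OF le fin] by (rule parseval_fold[OF int])
  show "S \<le> E + X" using le unfolding S .
  have "E \<le> (\<integral>\<^sup>+\<xi>. ennreal ((cmod (fold_lattice g \<xi>))\<^sup>2) + ?x \<xi> \<partial>U2)"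
    unfolding E using AE by (intro nn_integral_mono_AE) auto
  also have "\<dots> = S + X" unfolding S X by (rule nn_integral_add) auto
  finally show "E \<le> S + X" .
qed

section \<open>Linear changes of variables\<close>

lemma matrix_matrix_inv:
  fixes A :: "real^'n^'n"
  assumes "det A \<noteq> 0"
  shows "A ** matrix_inv A = mat 1" "matrix_inv A ** A = mat 1"
proof -
  have "\<exists>A'. A ** A' = mat 1 \<and> A' ** A = mat 1"
    using assms by (simp flip: invertible_det_nz invertible_def)
  from someI_ex[OF this] show "A ** matrix_inv A = mat 1" "matrix_inv A ** A = mat 1"
    unfolding matrix_inv_def by blast+
qed

lemma matrix_inv_mult:
  fixes A :: "real^'n^'n"
  assumes "det A \<noteq> 0"
  shows "A *v (matrix_inv A *v x) = x" "matrix_inv A *v (A *v x) = x"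
  using matrix_matrix_inv[OF assms] by (simp_all add: matrix_vector_mul_assoc)

lemma det_matrix_inv:
  fixes A :: "real^'n^'n"
  assumes "det A \<noteq> 0"
  shows "det (matrix_inv A) = 1 / det A"
proof -
  have "det A * det (matrix_inv A) = 1"
    using matrix_matrix_inv[OF assms] by (simp flip: det_mul)
  then show ?thesis using assms by (simp add: field_simps)
qed

lemma matrix_vector_measurable [measurable]:
  "(\<lambda>x. (A::real^'n^'m) *v x) \<in> borel_measurable borel"
  by (intro borel_measurable_continuous_onI linear_continuous_on) simp

text \<open>It is enough to test on boxes. The preimage of a box is its image under the inverse
  matrix, and the measure of a linear image is known for the completed measure, hence the passage
  through \<open>lebesgue\<close>.\<close>

lemma lborel_matrix_vector:
  fixes A :: "real^2^2"
  assumes "det A \<noteq> 0"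
  shows "lborel = density (distr lborel borel ((*v) A)) (\<lambda>_. ennreal \<bar>det A\<bar>)"
proof (rule lborel_eqI)
  fix l u :: "real^2" assume lu: "\<And>b. b \<in> Basis \<Longrightarrow> l \<bullet> b \<le> u \<bullet> b"
  let ?B = "matrix_inv A"
  have vim: "(*v) A -` box l u = (*v) ?B ` box l u"
    using matrix_inv_mult[OF assms] by (auto simp: image_iff) metis
  have "box l u \<in> lmeasurable" by simp
  from measurable_linear_image[OF _ this, of "(*v) ?B"] measure_linear_image[OF _ this, of "(*v) ?B"]
  have *: "(*v) ?B ` box l u \<in> lmeasurable"
    "measure lebesgue ((*v) ?B ` box l u) = \<bar>det ?B\<bar> * measure lebesgue (box l u)" by auto
  have "emeasure (density (distr lborel borel ((*v) A)) (\<lambda>_. ennreal \<bar>det A\<bar>)) (box l u) =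
      ennreal \<bar>det A\<bar> * emeasure lborel ((*v) A -` box l u)"
    by (simp add: emeasure_density nn_integral_cmult emeasure_distr)
  also have "emeasure lborel ((*v) A -` box l u) = emeasure lebesgue ((*v) ?B ` box l u)"
    unfolding vim[symmetric]
    using measurable_sets[OF matrix_vector_measurable[of A], of "box l u"] by simp
  also have "\<dots> = ennreal (\<bar>det ?B\<bar> * measure lebesgue (box l u))"
    using * by (simp add: emeasure_eq_measure2)
  also have "ennreal \<bar>det A\<bar> * \<dots> = ennreal (measure lebesgue (box l u))"
    using assms by (simp add: det_matrix_inv flip: ennreal_mult)
  also have "\<dots> = ennreal (measure lborel (box l u))" by simp
  also have "\<dots> = emeasure lborel (box l u)"
    by (rule emeasure_eq_ennreal_measure[symmetric]) (use emeasure_lborel_box_finite[of l u] in auto)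
  also have "\<dots> = (\<Prod>b\<in>Basis. (u - l) \<bullet> b)" using lu by simp
  finally show "emeasure (density (distr lborel borel ((*v) A)) (\<lambda>_. ennreal \<bar>det A\<bar>)) (box l u) =
    (\<Prod>b\<in>Basis. (u - l) \<bullet> b)" .
qed simp

lemma nn_integral_matrix_vector:
  fixes A :: "real^2^2"
  assumes "det A \<noteq> 0" and [measurable]: "f \<in> borel_measurable borel"
  shows "(\<integral>\<^sup>+x. f x \<partial>lborel) = ennreal \<bar>det A\<bar> * (\<integral>\<^sup>+x. f (A *v x) \<partial>lborel)"
  by (subst lborel_matrix_vector[OF assms(1)]) (simp add: nn_integral_density nn_integral_cmult nn_integral_distr)

lemma
  fixes A :: "real^2^2" and f :: "real^2 \<Rightarrow> complex"
  assumes A: "det A \<noteq> 0" and f: "integrable lborel f"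
  shows integrable_matrix_vector: "integrable lborel (\<lambda>x. f (A *v x))"
    and integral_matrix_vector: "(LINT x|lborel. f x) = \<bar>det A\<bar> * (LINT x|lborel. f (A *v x))"
proof -
  have [measurable]: "f \<in> borel_measurable borel" using borel_measurable_integrable[OF f] by simp
  have "integrable (density (distr lborel borel ((*v) A)) (\<lambda>_. ennreal \<bar>det A\<bar>)) f"
    using f lborel_matrix_vector[OF A] by simp
  then show "integrable lborel (\<lambda>x. f (A *v x))"
  proof (subst (asm) integrable_density)
    assume "integrable (distr lborel borel ((*v) A)) (\<lambda>x. \<bar>det A\<bar> *\<^sub>R f x)"
    then have "integrable lborel (\<lambda>x. \<bar>det A\<bar> *\<^sub>R f (A *v x))"
      by (subst (asm) integrable_distr_eq) auto
    then have "integrable lborel (\<lambda>x. (1 / \<bar>det A\<bar>) *\<^sub>R (\<bar>det A\<bar> *\<^sub>R f (A *v x)))"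
      by (rule integrable_scaleR_right)
    then show "integrable lborel (\<lambda>x. f (A *v x))" using A by simp
  qed auto
  show "(LINT x|lborel. f x) = \<bar>det A\<bar> * (LINT x|lborel. f (A *v x))"
    by (subst lborel_matrix_vector[OF A], subst integral_density)
       (auto simp: integral_distr scaleR_conv_of_real)
qed

section \<open>The Fourier transform on the plane\<close>

lemma fourier_integral_chr:
  "fourier_integral f \<xi> = (LINT x|lborel. f x * chr (- (x \<bullet> \<xi>)))"
  unfolding fourier_integral_def
  by (simp add: chr_eq_exp[of "- (_ \<bullet> _)", symmetric])

lemma integrable_mult_chr:
  fixes f :: "'a::euclidean_space \<Rightarrow> complex"
  assumes "integrable lborel f"
  shows "integrable lborel (\<lambda>x. f x * chr (\<xi> \<bullet> x))" "integrable lborel (\<lambda>x. f x * chr (- (x \<bullet> \<xi>)))"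
proof -
  note [measurable] = borel_measurable_integrable[OF assms]
  show "integrable lborel (\<lambda>x. f x * chr (\<xi> \<bullet> x))" "integrable lborel (\<lambda>x. f x * chr (- (x \<bullet> \<xi>)))"
    by (rule Bochner_Integration.integrable_bound[OF assms]; simp add: norm_mult)+
qed

lemma fourier_integral_measurable [measurable]:
  fixes f :: "'a::euclidean_space \<Rightarrow> complex"
  assumes [measurable]: "f \<in> borel_measurable borel"
  shows "fourier_integral f \<in> borel_measurable borel"
  unfolding fourier_integral_chr[abs_def] by measurable

lemma fourier_integral_add_cmult:
  fixes f g :: "'a::euclidean_space \<Rightarrow> complex"
  assumes "integrable lborel f" "integrable lborel g"
  shows "fourier_integral (\<lambda>x. f x + c * g x) \<xi> = fourier_integral f \<xi> + c * fourier_integral g \<xi>"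
  unfolding fourier_integral_chr
  using integrable_mult_chr(2)[OF assms(1), of \<xi>] integrable_mult_chr(2)[OF assms(2), of \<xi>]
  by (simp add: distrib_right mult.assoc)

lemma square_integrable_iff:
  "square_integrable f \<longleftrightarrow> f \<in> borel_measurable borel \<and> sq_integral lborel f < \<infinity>"
proof -
  have "integrable lborel (\<lambda>x. (cmod (f x))\<^sup>2) \<longleftrightarrow> sq_integral lborel f < \<infinity>"
    if "f \<in> borel_measurable borel"
  proof -
    have "(\<lambda>x. (cmod (f x))\<^sup>2) \<in> borel_measurable lborel" using that by measurable
    then show ?thesis by (simp add: integrable_iff_bounded)
  qed
  then show ?thesis by (auto simp: square_integrable_def)
qed

lemma square_integrable_add_cmult:
  assumes "square_integrable f" "square_integrable g"
  shows "square_integrable (\<lambda>x. f x + c * g x)"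
proof -
  have [measurable]: "f \<in> borel_measurable borel" "g \<in> borel_measurable borel"
    using assms by (auto simp: square_integrable_iff)
  have "sq_integral lborel (\<lambda>x. f x + c * g x) \<le>
    2 * sq_integral lborel f + 2 * sq_integral lborel (\<lambda>x. c * g x)"
    by (rule nn_integral_norm_add_square_le) auto
  also have "sq_integral lborel (\<lambda>x. c * g x) = ennreal ((cmod c)\<^sup>2) * sq_integral lborel g"
    by (simp add: norm_mult power_mult_distrib ennreal_mult nn_integral_cmult)
  finally show ?thesis
    using assms by (auto simp: square_integrable_iff ennreal_mult_less_top intro: le_less_trans)
qed

section \<open>Plancherel for bounded functions of bounded support\<close>

lemma vec_of_int_diff: "vec_of_int (k - l) = vec_of_int k - vec_of_int l"
  by (simp add: vec_eq_iff)

lemma integral_chr_U2: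
  "(LINT t|U2. chr (vec_of_int k \<bullet> t)) = (if k = 0 then 1 else 0)"
proof -
  have "integrable U2 (\<lambda>t. chr (vec_of_int k \<bullet> t))"
    by (rule U2.integrable_const_bound[of _ 1]) auto
  then have "(LINT t|U2. chr (vec_of_int k \<bullet> t)) =
     (LINT x|U01. chr (of_int (k $ 1) * x) * (LINT y|U01. chr (of_int (k $ 2) * y)))"
    by (subst integral_U2_iterated) (auto simp: inner_real2 chr_add)
  also have "\<dots> = (if k = 0 then 1 else 0)"
    unfolding integral_chr_U01 by (auto simp: vec_eq_iff forall_2 integral_chr_U01)
  finally show ?thesis .
qed

text \<open>The inner Parseval identity for the Zak transform. The minus sign in the exponent makes
  the coefficient with index \<open>m\<close> equal to \<open>a m\<close>.\<close>

lemma parseval_U2_finite: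
  assumes L: "finite L" and a: "\<And>l. l \<notin> L \<Longrightarrow> a l = 0"
  shows "sq_integral U2 (\<lambda>t. \<Sum>l\<in>L. a l * chr (- (vec_of_int l \<bullet> t))) =
    sq_integral (count_space UNIV) a"
proof -
  define h where "h t = (\<Sum>l\<in>L. a l * chr (- (vec_of_int l \<bullet> t)))" for t :: "real^2"
  have [measurable]: "h \<in> borel_measurable borel" unfolding h_def by measurable
  have bd: "cmod (h t) \<le> (\<Sum>l\<in>L. cmod (a l))" for t
    unfolding h_def by (rule order_trans[OF norm_sum]) (simp add: norm_mult)
  have "sq_integral U2 h \<le> (\<integral>\<^sup>+t. ennreal ((\<Sum>l\<in>L. cmod (a l))\<^sup>2) \<partial>U2)"
    by (intro nn_integral_mono ennreal_leI power_mono bd) auto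
  then have fin: "sq_integral U2 h < \<infinity>"
    using U2.emeasure_space_1 by (auto intro: le_less_trans)
  have "(LINT t|U2. h t * chr (vec_of_int m \<bullet> t)) = a m" for m
  proof -
    have "(LINT t|U2. h t * chr (vec_of_int m \<bullet> t)) = (LINT t|U2. (\<Sum>l\<in>L. a l * chr (vec_of_int (m - l) \<bullet> t)))"
      unfolding h_def sum_distrib_right
      by (intro Bochner_Integration.integral_cong refl sum.cong)
         (simp add: mult.assoc inner_diff_left vec_of_int_diff flip: chr_add)
    also have "\<dots> = (\<Sum>l\<in>L. a l * (LINT t|U2. chr (vec_of_int (m - l) \<bullet> t)))"
    proof (subst Bochner_Integration.integral_sum)
      show "integrable U2 (\<lambda>t. a l * chr (vec_of_int (m - l) \<bullet> t))" for l
        by (intro integrable_mult_right U2.integrable_const_bound[of _ 1]) auto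
    qed simp
    also have "\<dots> = (\<Sum>l\<in>L. if m = l then a l else 0)"
      unfolding integral_chr_U2 by (intro sum.cong) auto
    finally show ?thesis using L a by (simp add: sum.delta')
  qed
  with parseval_U2[OF _ fin] show ?thesis by (simp add: h_def)
qed

lemma finite_int2_bounded: "finite {l :: int^2. \<bar>l $ 1\<bar> \<le> N \<and> \<bar>l $ 2\<bar> \<le> N}"
proof (rule finite_subset)
  show "{l :: int^2. \<bar>l $ 1\<bar> \<le> N \<and> \<bar>l $ 2\<bar> \<le> N} \<subseteq> (\<lambda>(a, b). vector [a, b]) ` ({-N..N} \<times> {-N..N})"
  proof
    fix l :: "int^2" assume "l \<in> {l. \<bar>l $ 1\<bar> \<le> N \<and> \<bar>l $ 2\<bar> \<le> N}"
    then show "l \<in> (\<lambda>(a, b). vector [a, b]) ` ({-N..N} \<times> {-N..N})"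
      by (intro image_eqI[of _ _ "(l $ 1, l $ 2)"]) (auto simp: vec_eq_iff forall_2)
  qed
qed simp

interpretation U2_pair: pair_sigma_finite U2 U2 ..

text \<open>For fixed \<open>t\<close>, the values of the transform on \<open>t + \<int>\<^sup>2\<close> are the Fourier coefficients of the
  Zak transform \<open>W t\<close> of \<open>F\<close> (up to a unimodular factor), while for fixed \<open>x\<close> the function \<open>\<lambda>t. W t x\<close>
  has the Fourier coefficients \<open>F (x + l)\<close>. Applying Parseval in both variables gives Plancherel.\<close>

lemma plancherel_bounded:
  fixes F :: "real^2 \<Rightarrow> complex"
  assumes [measurable]: "F \<in> borel_measurable borel" and int: "integrable lborel F"
    and bd: "\<And>x. cmod (F x) \<le> R" and supp: "\<And>x. F x \<noteq> 0 \<Longrightarrow> \<bar>x $ 1\<bar> \<le> R \<and> \<bar>x $ 2\<bar> \<le> R"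
  shows "sq_integral lborel (fourier_integral F) = sq_integral lborel F"
proof -
  \<comment> \<open>For \<open>x\<close> in the unit square, \<open>F (x + vec_of_int l)\<close> can
    be nonzero only if the coordinates of \<open>l\<close> exceed \<open>R\<close> by less than 1 in
    modulus, so finitely many \<open>l\<close> matter, uniformly in \<open>x\<close>.\<close>
  define L :: "(int^2) set" where "L = {l. \<bar>l $ 1\<bar> \<le> \<lceil>R\<rceil> + 1 \<and> \<bar>l $ 2\<bar> \<le> \<lceil>R\<rceil> + 1}"
  have L: "finite L" unfolding L_def by (rule finite_int2_bounded)
  have outside: "F (x + vec_of_int l) = 0" if "x \<in> unit_square" "l \<notin> L" for x l
  proof (rule ccontr)
    assume "F (x + vec_of_int l) \<noteq> 0"
    from supp[OF this] have "\<bar>x $ 1 + of_int (l $ 1)\<bar> \<le> R" "\<bar>x $ 2 + of_int (l $ 2)\<bar> \<le> R" by auto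
    moreover have "0 \<le> x $ 1" "x $ 1 < 1" "0 \<le> x $ 2" "x $ 2 < 1"
      using that by (auto simp: unit_square_def)
    moreover have "R \<le> of_int \<lceil>R\<rceil>" by simp
    ultimately have "\<bar>of_int (l $ 1)\<bar> \<le> of_int \<lceil>R\<rceil> + (1::real)" "\<bar>of_int (l $ 2)\<bar> \<le> of_int \<lceil>R\<rceil> + (1::real)" by linarith+
    then show False using that by (simp add: L_def) linarith
  qed
  define a where "a x l = F (x + vec_of_int l)" for x l
  have [measurable]: "(\<lambda>x. a x l) \<in> borel_measurable borel" for l unfolding a_def by measurable
  define W where "W t x = (\<Sum>l\<in>L. a x l * chr (- (vec_of_int l \<bullet> t)))" for t x
  have [measurable]: "case_prod W \<in> borel_measurable (borel \<Otimes>\<^sub>M borel)" "W t \<in> borel_measurable borel" for t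
    unfolding W_def by measurable
  have AE_square: "AE x in U2. x \<in> unit_square"
    unfolding U2_density by (subst AE_density) (auto simp: indicator_def)
  \<comment> \<open>The unimodular factor \<open>chr (- (x \<bullet> t))\<close> is all that
    separates the periodization from \<open>W t\<close>; it disappears in the square norm.\<close>
  have fold: "fold_lattice (\<lambda>x. F x * chr (- (x \<bullet> t))) x = W t x * chr (- (x \<bullet> t))" if "x \<in> unit_square" for t x
  proof -
    have "fold_lattice (\<lambda>x. F x * chr (- (x \<bullet> t))) x = (\<Sum>l\<in>L. F (x + vec_of_int l) * chr (- ((x + vec_of_int l) \<bullet> t)))"
      unfolding fold_lattice_def
    proof (subst lebesgue_integral_count_space_finite_support)
      let ?f = "\<lambda>l. F (x + vec_of_int l) * chr (- ((x + vec_of_int l) \<bullet> t))"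
      have sub: "{l \<in> UNIV. ?f l \<noteq> 0} \<subseteq> L" using outside[OF that] by auto
      show "finite {l \<in> UNIV. ?f l \<noteq> 0}" using L sub by (rule finite_subset[rotated])
      show "(\<Sum>l | l \<in> UNIV \<and> ?f l \<noteq> 0. ?f l) = (\<Sum>l\<in>L. ?f l)"
        using L sub by (intro sum.mono_neutral_left) auto
    qed
    moreover have "chr (- ((x + v) \<bullet> t)) = chr (- (v \<bullet> t)) * chr (- (x \<bullet> t))" for v
      by (subst chr_add[symmetric], rule arg_cong[of _ _ chr]) (simp add: inner_add_left)
    ultimately show ?thesis
      by (simp add: W_def a_def sum_distrib_right mult.assoc)
  qed
  have fold_sq: "sq_integral U2 (\<lambda>x. fold_lattice (\<lambda>x. F x * chr (- (x \<bullet> t))) x) =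
      sq_integral U2 (W t)" for t
    using AE_square by (intro nn_integral_cong_AE) (auto simp: fold norm_mult)
  have "cmod (W t x) \<le> card L * R" for t x
  proof -
    have "cmod (W t x) \<le> (\<Sum>l\<in>L. cmod (a x l))"
      unfolding W_def by (rule order_trans[OF norm_sum]) (simp add: norm_mult)
    also have "\<dots> \<le> (\<Sum>l\<in>L. R)" unfolding a_def by (intro sum_mono bd)
    finally show ?thesis by simp
  qed
  then have "sq_integral U2 (W t) \<le> (\<integral>\<^sup>+x. ennreal ((card L * R)\<^sup>2) \<partial>U2)" for t
    by (intro nn_integral_mono ennreal_leI power_mono) auto
  then have fin: "sq_integral U2 (W t) < \<infinity>" for t
    by (rule le_less_trans) (use U2.emeasure_space_1 in simp)
  have periodize: "(sq_integral (count_space UNIV) (\<lambda>m. fourier_integral F (t + vec_of_int m))) =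
      sq_integral U2 (W t)" for t
  proof -
    let ?g = "\<lambda>x. F x * chr (- (x \<bullet> t))"
    have "(sq_integral (count_space UNIV) (\<lambda>m. fourier_integral F (t + vec_of_int m))) =
      (sq_integral (count_space UNIV) (\<lambda>m. LINT x|lborel. ?g x * chr (vec_of_int (- m) \<bullet> x)))"
      unfolding fourier_integral_chr
      by (simp add: vec_of_int_minus inner_add_right mult.assoc inner_commute flip: chr_add)
    \<comment> \<open>Reindexing by \<open>- m\<close>: the Fourier integral carries the opposite
      sign in its exponent.\<close>
    also have "\<dots> = (sq_integral (count_space UNIV) (\<lambda>m. LINT x|lborel. ?g x * chr (vec_of_int m \<bullet> x)))"
      by (rule nn_integral_bij_count_space) (rule bij_uminus)
    also have "\<dots> = sq_integral U2 (\<lambda>x. fold_lattice ?g x)"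
      using fin[of t] by (intro parseval_fold integrable_mult_chr int) (simp add: fold_sq)
    finally show ?thesis unfolding fold_sq .
  qed
  have "sq_integral lborel (fourier_integral F) =
    (\<integral>\<^sup>+t. \<integral>\<^sup>+m. ennreal ((cmod (fourier_integral F (t + vec_of_int m)))\<^sup>2) \<partial>count_space UNIV \<partial>U2)"
    by (rule nn_integral_fold[symmetric]) measurable
  also have "\<dots> = (\<integral>\<^sup>+t. \<integral>\<^sup>+x. ennreal ((cmod (W t x))\<^sup>2) \<partial>U2 \<partial>U2)"
    unfolding periodize ..
  also have "\<dots> = (\<integral>\<^sup>+x. \<integral>\<^sup>+t. ennreal ((cmod (W t x))\<^sup>2) \<partial>U2 \<partial>U2)"
    by (rule U2_pair.Fubini'[symmetric]) measurable
  also have "\<dots> = (\<integral>\<^sup>+x. \<integral>\<^sup>+l. ennreal ((cmod (a x l))\<^sup>2) \<partial>count_space UNIV \<partial>U2)"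
    using AE_square unfolding W_def
    by (intro nn_integral_cong_AE, elim eventually_mono, intro parseval_U2_finite L)
       (auto simp: a_def outside)
  also have "\<dots> = sq_integral lborel F"
    unfolding a_def by (rule nn_integral_fold) measurable
  finally show ?thesis .
qed

section \<open>Plancherel for functions that are both integrable and square integrable\<close>

lemma nn_integral_minkowski:
  assumes [measurable]: "f \<in> borel_measurable M" "g \<in> borel_measurable M"
    and A: "sq_integral M f = ennreal A" "A \<ge> 0"
    and D: "sq_integral M g = ennreal D" "D \<ge> 0"
  shows "sq_integral M (\<lambda>x. f x + g x) \<le> ennreal ((sqrt A + sqrt D)\<^sup>2)"
proof -
  let ?I = "\<integral>\<^sup>+x. ennreal (cmod (f x)) * ennreal (cmod (g x)) \<partial>M"
  have "?I\<^sup>2 \<le> ennreal A * ennreal D"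
    using Cauchy_Schwarz_nn_integral[of "\<lambda>x. ennreal (cmod (f x))" M "\<lambda>x. ennreal (cmod (g x))"] A D
    by (simp add: ennreal_power)
  also have "\<dots> = (ennreal (sqrt (A * D)))\<^sup>2"
    using A D by (simp add: ennreal_power ennreal_mult[symmetric])
  finally have I2: "?I\<^sup>2 \<le> (ennreal (sqrt (A * D)))\<^sup>2" .
  have I: "?I \<le> ennreal (sqrt (A * D))"
  proof (cases ?I)
    case (real r)
    then have "ennreal (r\<^sup>2) \<le> ennreal ((sqrt (A * D))\<^sup>2)"
      using I2 A D by (simp only: ennreal_power real_sqrt_ge_zero mult_nonneg_nonneg)
    then have "r \<le> sqrt (A * D)"
      using A D by (subst (asm) ennreal_le_iff) (auto intro: power2_le_imp_le)
    then show ?thesis unfolding real by (rule ennreal_leI)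
  next
    case top
    then have "top \<le> ennreal ((sqrt (A * D))\<^sup>2)"
      using I2 A D by (simp only: ennreal_power real_sqrt_ge_zero mult_nonneg_nonneg) (simp add: power2_eq_square)
    then show ?thesis by (simp add: top_unique)
  qed
  have "sq_integral M (\<lambda>x. f x + g x) \<le>
    (\<integral>\<^sup>+x. ennreal ((cmod (f x))\<^sup>2) + ennreal ((cmod (g x))\<^sup>2) + 2 * (ennreal (cmod (f x)) * ennreal (cmod (g x))) \<partial>M)"
  proof (rule nn_integral_mono)
    fix x
    have "(cmod (f x + g x))\<^sup>2 \<le> (cmod (f x) + cmod (g x))\<^sup>2"
      by (intro power_mono norm_triangle_ineq) auto
    then have "(cmod (f x + g x))\<^sup>2 \<le> (cmod (f x))\<^sup>2 + (cmod (g x))\<^sup>2 + 2 * (cmod (f x) * cmod (g x))"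
      by (simp add: power2_sum)
    then have "ennreal ((cmod (f x + g x))\<^sup>2) \<le> ennreal ((cmod (f x))\<^sup>2 + (cmod (g x))\<^sup>2 + 2 * (cmod (f x) * cmod (g x)))"
      by (rule ennreal_leI)
    also have "\<dots> = ennreal ((cmod (f x))\<^sup>2) + ennreal ((cmod (g x))\<^sup>2) + 2 * (ennreal (cmod (f x)) * ennreal (cmod (g x)))"
      by (simp add: ennreal_mult)
    finally show "ennreal ((cmod (f x + g x))\<^sup>2) \<le>
      ennreal ((cmod (f x))\<^sup>2) + ennreal ((cmod (g x))\<^sup>2) + 2 * (ennreal (cmod (f x)) * ennreal (cmod (g x)))" .
  qed
  also have "\<dots> = ennreal A + ennreal D + 2 * ?I"
    by (simp add: nn_integral_add nn_integral_cmult A D)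
  also have "\<dots> \<le> ennreal A + ennreal D + 2 * ennreal (sqrt (A * D))"
    by (intro add_left_mono mult_left_mono I) auto
  also have "\<dots> = ennreal ((sqrt A + sqrt D)\<^sup>2)"
  proof -
    have "(sqrt A + sqrt D)\<^sup>2 = A + D + 2 * sqrt (A * D)"
      using A D by (simp add: power2_sum real_sqrt_mult)
    then show ?thesis using A D by (simp add: ennreal_mult)
  qed
  finally show ?thesis .
qed

text \<open>The reverse triangle inequality for the norms \<open>sqrt (N n)\<close> and
  \<open>sqrt A\<close>, from two uses of Minkowski. The estimate with factor 2 would not give
  convergence of norms.\<close>

lemma nn_integral_square_LIMSEQ:
  assumes [measurable]: "\<And>n::nat. F n \<in> borel_measurable M" "f \<in> borel_measurable M"
    and fin: "sq_integral M f < \<infinity>"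
    and finF: "\<And>n. (sq_integral M (F n)) < \<infinity>"
    and lim: "(\<lambda>n. sqdist M (F n) f) \<longlonglongrightarrow> 0"
  shows "(\<lambda>n. \<integral>\<^sup>+x. ennreal ((cmod (F n x))\<^sup>2) \<partial>M) \<longlonglongrightarrow> sq_integral M f"
proof -
  define A where "A = enn2real (sq_integral M f)"
  define N where "N n = enn2real (sq_integral M (F n))" for n
  define D where "D n = enn2real (sqdist M (F n) f)" for n
  have A: "sq_integral M f = ennreal A" "A \<ge> 0" using fin by (auto simp: A_def)
  have N: "sq_integral M (F n) = ennreal (N n)" "N n \<ge> 0" for n using finF by (auto simp: N_def)
  have "sqdist M (F n) f < \<infinity>" for n
    using nn_integral_norm_add_square_le[of "F n" M "\<lambda>x. - f x"] fin finF[of n]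
    by (auto simp: sqdist_def ennreal_mult_less_top intro: le_less_trans)
  then have D: "sqdist M (F n) f = ennreal (D n)" "D n \<ge> 0" for n by (auto simp: D_def)
  have "(\<lambda>n. D n) \<longlonglongrightarrow> 0"
    using lim unfolding D using D by (simp add: tendsto_ennreal_iff flip: ennreal_0)
  then have "(\<lambda>n. sqrt (D n)) \<longlonglongrightarrow> sqrt 0" by (intro tendsto_intros)
  then have D0: "(\<lambda>n. sqrt (D n)) \<longlonglongrightarrow> 0" by simp
  have "\<bar>sqrt (N n) - sqrt A\<bar> \<le> sqrt (D n)" for n
  proof -
    have D': "sq_integral M (\<lambda>x. f x - F n x) = ennreal (D n)"
      using D(1)[of n] by (simp add: sqdist_def norm_minus_commute)
    have "ennreal (N n) \<le> ennreal ((sqrt A + sqrt (D n))\<^sup>2)"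
      using nn_integral_minkowski[OF _ _ A D(1)[unfolded sqdist_def] D(2), of n] N by simp
    then have "N n \<le> (sqrt A + sqrt (D n))\<^sup>2" using A D by (simp add: ennreal_le_iff)
    then have 1: "sqrt (N n) \<le> sqrt A + sqrt (D n)" using A D by (intro real_le_lsqrt) auto
    have "ennreal A \<le> ennreal ((sqrt (N n) + sqrt (D n))\<^sup>2)"
      using nn_integral_minkowski[of "F n" M "\<lambda>x. f x - F n x" "N n" "D n"] N D D' A by simp
    then have "A \<le> (sqrt (N n) + sqrt (D n))\<^sup>2" using N D by (simp add: ennreal_le_iff)
    then have "sqrt A \<le> sqrt (N n) + sqrt (D n)" using N D by (intro real_le_lsqrt) auto
    with 1 show ?thesis by linarith
  qed
  then have "(\<lambda>n. sqrt (N n) - sqrt A) \<longlonglongrightarrow> 0"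
    by (intro Lim_null_comparison[OF _ D0]) auto
  then have "(\<lambda>n. sqrt (N n)) \<longlonglongrightarrow> sqrt A" by (simp add: LIM_zero_iff)
  from tendsto_power[OF this, of 2] have "(\<lambda>n. N n) \<longlonglongrightarrow> A"
    by (simp only: real_sqrt_pow2[OF N(2)] real_sqrt_pow2[OF A(2)])
  then show ?thesis unfolding N A by (rule tendsto_ennrealI)
qed

text \<open>Truncate both the values and the domain of \<open>F\<close>. The transforms of the
  truncations converge pointwise by integrability. That they converge in L2 as well, to a limit not
  yet known to be square integrable, comes from Fatou's lemma, because the difference of two
  truncations is again covered by \<open>plancherel_bounded\<close>.\<close>

lemma plancherel_L1_L2:
  fixes F :: "real^2 \<Rightarrow> complex"
  assumes int: "integrable lborel F" and sq: "square_integrable F"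
  shows "sq_integral lborel (fourier_integral F) = sq_integral lborel F"
proof -
  define T where "T R x = (cmod (F x) \<le> real R \<and> \<bar>x $ 1\<bar> \<le> real R \<and> \<bar>x $ 2\<bar> \<le> real R)" for R :: nat and x :: "real^2"
  define FR where "FR F R x = (if T R x then F x else 0)" for F :: "real^2 \<Rightarrow> complex" and R x
  have [measurable]: "F \<in> borel_measurable borel" using sq by (simp add: square_integrable_iff)
  have [measurable]: "Measurable.pred borel (T R)" for R unfolding T_def by measurable
  have FR_meas [measurable]: "G \<in> borel_measurable borel \<Longrightarrow> FR G R \<in> borel_measurable borel" for G R
  proof -
    assume [measurable]: "G \<in> borel_measurable borel"
    show ?thesis unfolding FR_def by measurable
  qed
  have FR_int: "integrable lborel (FR F R)" for R
    by (rule Bochner_Integration.integrable_bound[OF int]) (auto simp: FR_def)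
  have evT: "eventually (\<lambda>R. T R x) sequentially" for x
  proof -
    obtain n :: nat where n: "max (cmod (F x)) (max \<bar>x $ 1\<bar> \<bar>x $ 2\<bar>) \<le> real n"
      using real_arch_simple by blast
    then have "T R x" if "R \<ge> n" for R
    proof -
      have "real n \<le> real R" using that by simp
      then show ?thesis using n unfolding T_def by linarith
    qed
    then show ?thesis unfolding eventually_sequentially by blast
  qed
  have lim: "(\<lambda>R. FR F R x) \<longlonglongrightarrow> F x" for x
    by (rule tendsto_eventually, rule eventually_mono[OF evT[of x]]) (simp add: FR_def)
  have planch_R: "sq_integral lborel (fourier_integral (FR F R)) = sq_integral lborel (FR F R)" for R
    by (rule plancherel_bounded[where R = "real R"]) (auto simp: FR_int FR_def T_def split: if_splits)
  have fourier_lim: "(\<lambda>R. fourier_integral (FR F R) \<xi>) \<longlonglongrightarrow> fourier_integral F \<xi>" for \<xi>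
    unfolding fourier_integral_chr
  proof (rule integral_dominated_convergence[where w = "\<lambda>x. cmod (F x)"])
    show "AE x in lborel. (\<lambda>R. FR F R x * chr (- (x \<bullet> \<xi>))) \<longlonglongrightarrow> F x * chr (- (x \<bullet> \<xi>))"
      by (intro AE_I2 tendsto_intros lim)
    show "AE x in lborel. cmod (FR F R x * chr (- (x \<bullet> \<xi>))) \<le> cmod (F x)" for R
      by (intro AE_I2) (auto simp: FR_def norm_mult)
  qed (use int in auto)
  have fin: "sq_integral lborel F < \<infinity>" using sq by (simp add: square_integrable_iff)
  have FR_le: "sq_integral lborel (FR F R) \<le> sq_integral lborel F" for R
    by (intro nn_integral_mono ennreal_leI power_mono) (auto simp: FR_def)
  have dist_le: "sq_integral lborel (\<lambda>x. FR F S x - FR F R x) \<le> sqdist lborel (FR F R) F" if "R \<le> S" for R S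
    unfolding sqdist_def
    by (intro nn_integral_mono ennreal_leI power_mono) (use that in \<open>auto simp: FR_def T_def norm_minus_commute\<close>)
  have dist_lim: "(\<lambda>R. sqdist lborel (FR F R) F) \<longlonglongrightarrow> 0"
  proof (rule sqdist_LIMSEQ_dominated[where w = "\<lambda>x. cmod (F x)"])
    show "cmod (FR F R x - F x) \<le> cmod (F x)" for R x by (auto simp: FR_def)
  qed (use fin lim in auto)
  \<comment> \<open>Fatou in the outer parameter \<open>S\<close> with \<open>R\<close>
    fixed.\<close>
  have fourier_dist: "sqdist lborel (fourier_integral (FR F R)) (fourier_integral F) \<le> sqdist lborel (FR F R) F" for R
  proof -
    have "(\<lambda>S. fourier_integral (FR F S) \<xi> - fourier_integral (FR F R) \<xi>) \<longlonglongrightarrow> fourier_integral F \<xi> - fourier_integral (FR F R) \<xi>" for \<xi>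
      by (intro tendsto_intros fourier_lim)
    then have "(\<lambda>S. ennreal ((cmod (fourier_integral (FR F S) \<xi> - fourier_integral (FR F R) \<xi>))\<^sup>2)) \<longlonglongrightarrow>
      ennreal ((cmod (fourier_integral F \<xi> - fourier_integral (FR F R) \<xi>))\<^sup>2)" for \<xi>
      by (rule tendsto_ennrealI[OF tendsto_power[OF tendsto_norm]])
    then have eq: "ennreal ((cmod (fourier_integral F \<xi> - fourier_integral (FR F R) \<xi>))\<^sup>2) =
      liminf (\<lambda>S. ennreal ((cmod (fourier_integral (FR F S) \<xi> - fourier_integral (FR F R) \<xi>))\<^sup>2))" for \<xi>
      using lim_imp_Liminf[OF sequentially_bot] by metis
    have "sqdist lborel (fourier_integral (FR F R)) (fourier_integral F) =
      (\<integral>\<^sup>+\<xi>. liminf (\<lambda>S. ennreal ((cmod (fourier_integral (FR F S) \<xi> - fourier_integral (FR F R) \<xi>))\<^sup>2)) \<partial>lborel)"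
      unfolding sqdist_def eq[symmetric] by (simp add: norm_minus_commute)
    also have "\<dots> \<le> liminf (\<lambda>S. \<integral>\<^sup>+\<xi>. ennreal ((cmod (fourier_integral (FR F S) \<xi> - fourier_integral (FR F R) \<xi>))\<^sup>2) \<partial>lborel)"
      by (rule nn_integral_liminf) measurable
    also have "\<dots> \<le> limsup (\<lambda>S. \<integral>\<^sup>+\<xi>. ennreal ((cmod (fourier_integral (FR F S) \<xi> - fourier_integral (FR F R) \<xi>))\<^sup>2) \<partial>lborel)"
      by (rule Liminf_le_Limsup) simp
    also have "\<dots> \<le> sqdist lborel (FR F R) F"
    proof (rule Limsup_bounded)
      show "\<forall>\<^sub>F S in sequentially. (sq_integral lborel (\<lambda>\<xi>. fourier_integral (FR F S) \<xi> - fourier_integral (FR F R) \<xi>)) \<le> sqdist lborel (FR F R) F"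
        using eventually_ge_at_top[of R]
      proof eventually_elim
        case (elim S)
        let ?G = "\<lambda>x. FR F S x + (- 1) * FR F R x"
        have G: "?G x = (if T S x \<and> \<not> T R x then F x else 0)" for x
          using elim by (auto simp: FR_def T_def)
        have "sq_integral lborel (\<lambda>\<xi>. fourier_integral ?G \<xi>) = sq_integral lborel (\<lambda>x. ?G x)"
        proof (rule plancherel_bounded[where R = "real S"])
          show "integrable lborel ?G" using FR_int by (intro Bochner_Integration.integrable_add integrable_mult_right)
          show "cmod (?G x) \<le> real S" for x unfolding G by (auto simp: T_def)
          show "\<bar>x $ 1\<bar> \<le> real S \<and> \<bar>x $ 2\<bar> \<le> real S" if "?G x \<noteq> 0" for x
            using that unfolding G by (auto simp: T_def split: if_splits)
        qed measurable
        moreover have "fourier_integral ?G \<xi> = fourier_integral (FR F S) \<xi> - fourier_integral (FR F R) \<xi>" for \<xi>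
          by (subst fourier_integral_add_cmult[OF FR_int FR_int]) simp
        ultimately show ?case using dist_le[OF elim] by simp
      qed
    qed
    finally show ?thesis .
  qed
  have lim1: "(\<lambda>R. sqdist lborel (fourier_integral (FR F R)) (fourier_integral F)) \<longlonglongrightarrow> 0"
    by (rule tendsto_sandwich[OF _ _ tendsto_const dist_lim]) (auto simp: fourier_dist)
  have finR: "sq_integral lborel (fourier_integral (FR F R)) < \<infinity>" for R
    unfolding planch_R using FR_le fin by (rule le_less_trans)
  have finF: "sq_integral lborel (fourier_integral F) < \<infinity>"
  proof -
    have "sq_integral lborel (\<lambda>x. fourier_integral (FR F 0) x + (fourier_integral F x - fourier_integral (FR F 0) x))
      \<le> 2 * sq_integral lborel (fourier_integral (FR F 0)) + 2 * sqdist lborel (fourier_integral F) (fourier_integral (FR F 0))"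
      unfolding sqdist_def by (rule nn_integral_norm_add_square_le) measurable
    also have "sqdist lborel (fourier_integral F) (fourier_integral (FR F 0)) \<le> sqdist lborel (FR F 0) F"
      using fourier_dist[of 0] by (simp add: sqdist_def norm_minus_commute)
    also have "sqdist lborel (FR F 0) F \<le> sq_integral lborel F"
      unfolding sqdist_def by (intro nn_integral_mono ennreal_leI power_mono) (auto simp: FR_def)
    finally have "sq_integral lborel (fourier_integral F) \<le>
       2 * sq_integral lborel (fourier_integral (FR F 0)) + 2 * sq_integral lborel F"
      by (simp add: add_left_mono mult_left_mono)
    also have "\<dots> < \<infinity>" using fin finR[of 0] by (simp add: ennreal_mult_less_top)
    finally show ?thesis .
  qed
  have "(\<lambda>R. \<integral>\<^sup>+x. ennreal ((cmod (fourier_integral (FR F R) x))\<^sup>2) \<partial>lborel) \<longlonglongrightarrow> sq_integral lborel (fourier_integral F)"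
    by (rule nn_integral_square_LIMSEQ[OF _ _ finF finR lim1]) measurable
  moreover have "(\<lambda>R. \<integral>\<^sup>+x. ennreal ((cmod (FR F R x))\<^sup>2) \<partial>lborel) \<longlonglongrightarrow> sq_integral lborel F"
    using FR_le fin by (intro nn_integral_square_LIMSEQ dist_lim) (auto intro: le_less_trans)
  ultimately show ?thesis unfolding planch_R by (rule LIMSEQ_unique)
qed

section \<open>The transform on L2: norms, inner products and affine maps\<close>

lemma L2_converges_sqdist: "L2_converges F f \<longleftrightarrow> (\<lambda>n. sqdist lborel (F n) f) \<longlonglongrightarrow> 0"
  by (simp add: L2_converges_def sqdist_def)

lemma is_fourier_transformE:
  assumes "is_fourier_transform f g"
  obtains F where "square_integrable f" "square_integrable g" "f \<in> borel_measurable borel" "g \<in> borel_measurable borel"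
    "\<And>n. integrable lborel (F n)" "\<And>n. square_integrable (F n)" "\<And>n. F n \<in> borel_measurable borel"
    "(\<lambda>n. sqdist lborel (F n) f) \<longlonglongrightarrow> 0" "(\<lambda>n. sqdist lborel (fourier_integral (F n)) g) \<longlonglongrightarrow> 0"
  using assms unfolding is_fourier_transform_def L2_converges_sqdist by (auto simp: square_integrable_iff)

lemma is_fourier_transform_measurable:
  assumes "is_fourier_transform f g"
  shows "f \<in> borel_measurable borel" "g \<in> borel_measurable borel"
  using assms by (auto elim: is_fourier_transformE)

lemma is_fourier_transform_add_cmult:
  fixes f f' g g' :: "'a::euclidean_space \<Rightarrow> complex"
  assumes "is_fourier_transform f g" "is_fourier_transform f' g'"
  shows "is_fourier_transform (\<lambda>x. f x + c * f' x) (\<lambda>\<xi>. g \<xi> + c * g' \<xi>)"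
proof -
  obtain F where F: "square_integrable f" "square_integrable g" "f \<in> borel_measurable borel" "g \<in> borel_measurable borel"
    "\<And>n. integrable lborel (F n)" "\<And>n. square_integrable (F n)" "\<And>n. F n \<in> borel_measurable borel"
    "(\<lambda>n. sqdist lborel (F n) f) \<longlonglongrightarrow> 0" "(\<lambda>n. sqdist lborel (fourier_integral (F n)) g) \<longlonglongrightarrow> 0"
    using is_fourier_transformE[OF assms(1)] by blast
  obtain F' where F': "square_integrable f'" "square_integrable g'" "f' \<in> borel_measurable borel" "g' \<in> borel_measurable borel"
    "\<And>n. integrable lborel (F' n)" "\<And>n. square_integrable (F' n)" "\<And>n. F' n \<in> borel_measurable borel"
    "(\<lambda>n. sqdist lborel (F' n) f') \<longlonglongrightarrow> 0" "(\<lambda>n. sqdist lborel (fourier_integral (F' n)) g') \<longlonglongrightarrow> 0"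
    using is_fourier_transformE[OF assms(2)] by blast
  note [measurable] = F(3,4,7) F'(3,4,7)
  have lim: "(\<lambda>n. sqdist lborel (\<lambda>x. G n x + c * G' n x) (\<lambda>x. h x + c * h' x)) \<longlonglongrightarrow> 0"
    if [measurable]: "\<And>n. G n \<in> borel_measurable borel" "\<And>n. G' n \<in> borel_measurable borel"
      "h \<in> borel_measurable borel" "h' \<in> borel_measurable borel"
    and "(\<lambda>n. sqdist lborel (G n) h) \<longlonglongrightarrow> 0" "(\<lambda>n. sqdist lborel (G' n) h') \<longlonglongrightarrow> 0"
    for G G' :: "nat \<Rightarrow> 'a \<Rightarrow> complex" and h h'
  proof (rule tendsto_sandwich[OF _ _ tendsto_const])
    have "(\<lambda>n. 2 * sqdist lborel (G n) h + 2 * (ennreal ((cmod c)\<^sup>2) * sqdist lborel (G' n) h')) \<longlonglongrightarrow>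
      2 * 0 + 2 * (ennreal ((cmod c)\<^sup>2) * 0)"
      by (intro tendsto_add ennreal_tendsto_cmult that) auto
    then show "(\<lambda>n. 2 * sqdist lborel (G n) h + 2 * (ennreal ((cmod c)\<^sup>2) * sqdist lborel (G' n) h')) \<longlonglongrightarrow> 0"
      by simp
    show "\<forall>\<^sub>F n in sequentially. sqdist lborel (\<lambda>x. G n x + c * G' n x) (\<lambda>x. h x + c * h' x) \<le>
      2 * sqdist lborel (G n) h + 2 * (ennreal ((cmod c)\<^sup>2) * sqdist lborel (G' n) h')"
    proof (intro always_eventually allI)
      fix n
      show "sqdist lborel (\<lambda>x. G n x + c * G' n x) (\<lambda>x. h x + c * h' x) \<le>
      2 * sqdist lborel (G n) h + 2 * (ennreal ((cmod c)\<^sup>2) * sqdist lborel (G' n) h')"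
        by (subst sqdist_cmult[symmetric]; (rule sqdist_add_le)?; measurable)
    qed
  qed auto
  have fi: "fourier_integral (\<lambda>x. F n x + c * F' n x) = (\<lambda>\<xi>. fourier_integral (F n) \<xi> + c * fourier_integral (F' n) \<xi>)" for n
    using F(5) F'(5) by (intro ext fourier_integral_add_cmult)
  show ?thesis
    unfolding is_fourier_transform_def L2_converges_sqdist
  proof (intro conjI exI[of _ "\<lambda>n x. F n x + c * F' n x"] allI)
    show "(\<lambda>n. sqdist lborel (fourier_integral (\<lambda>x. F n x + c * F' n x)) (\<lambda>\<xi>. g \<xi> + c * g' \<xi>)) \<longlonglongrightarrow> 0"
      unfolding fi by (intro lim F F') measurable
    show "(\<lambda>n. sqdist lborel (\<lambda>x. F n x + c * F' n x) (\<lambda>x. f x + c * f' x)) \<longlonglongrightarrow> 0"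
      by (intro lim F F')
  qed (use F F' in \<open>auto intro!: square_integrable_add_cmult\<close>)
qed

lemma is_fourier_transform_cmult:
  fixes f g :: "'a::euclidean_space \<Rightarrow> complex"
  assumes "is_fourier_transform f g"
  shows "is_fourier_transform (\<lambda>x. c * f x) (\<lambda>\<xi>. c * g \<xi>)"
  using is_fourier_transform_add_cmult[OF assms assms, of "c - 1"] by (simp add: algebra_simps)

lemma is_fourier_transform_norm:
  fixes f g :: "real^2 \<Rightarrow> complex"
  assumes "is_fourier_transform f g"
  shows "sq_integral lborel f = sq_integral lborel g"
proof -
  obtain F where F: "square_integrable f" "square_integrable g" "f \<in> borel_measurable borel" "g \<in> borel_measurable borel"
    "\<And>n. integrable lborel (F n)" "\<And>n. square_integrable (F n)" "\<And>n. F n \<in> borel_measurable borel"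
    "(\<lambda>n. sqdist lborel (F n) f) \<longlonglongrightarrow> 0" "(\<lambda>n. sqdist lborel (fourier_integral (F n)) g) \<longlonglongrightarrow> 0"
    using is_fourier_transformE[OF assms(1)] by blast
  note [measurable] = F(3,4,7)
  have eq: "sq_integral lborel (fourier_integral (F n)) = sq_integral lborel (F n)" for n
    by (rule plancherel_L1_L2) (use F in auto)
  have "(\<lambda>n. \<integral>\<^sup>+x. ennreal ((cmod (F n x))\<^sup>2) \<partial>lborel) \<longlonglongrightarrow> sq_integral lborel f"
    by (rule nn_integral_square_LIMSEQ) (use F in \<open>auto simp: square_integrable_iff\<close>)
  moreover have "(\<lambda>n. \<integral>\<^sup>+x. ennreal ((cmod (fourier_integral (F n) x))\<^sup>2) \<partial>lborel) \<longlonglongrightarrow> sq_integral lborel g"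
    by (rule nn_integral_square_LIMSEQ) (use F in \<open>auto simp: square_integrable_iff eq\<close>)
  ultimately show ?thesis unfolding eq by (rule LIMSEQ_unique)
qed

lemma L2_norm_square:
  assumes "square_integrable f"
  shows "ennreal ((L2_norm f)\<^sup>2) = sq_integral lborel f"
proof -
  have "integrable lborel (\<lambda>x. (cmod (f x))\<^sup>2)" using assms by (simp add: square_integrable_def)
  then show ?thesis by (simp add: L2_norm_def nn_integral_eq_integral)
qed

lemma cnj_measurable [measurable]: "cnj \<in> borel_measurable borel"
  by (intro borel_measurable_continuous_onI continuous_intros)

lemma square_integrable_product:
  assumes "square_integrable f" "square_integrable g"
  shows "integrable lborel (\<lambda>x. f x * cnj (g x))"
proof -
  have [measurable]: "f \<in> borel_measurable borel" "g \<in> borel_measurable borel"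
    using assms by (auto simp: square_integrable_iff)
  show ?thesis
  proof (rule Bochner_Integration.integrable_bound)
    show "integrable lborel (\<lambda>x. (cmod (f x))\<^sup>2 + (cmod (g x))\<^sup>2)"
      using assms by (simp add: square_integrable_def)
    show "AE x in lborel. norm (f x * cnj (g x)) \<le> norm ((cmod (f x))\<^sup>2 + (cmod (g x))\<^sup>2)"
    proof (rule AE_I2)
      fix x
      have "0 \<le> (cmod (f x) - cmod (g x))\<^sup>2" by simp
      then have "2 * (cmod (f x) * cmod (g x)) \<le> (cmod (f x))\<^sup>2 + (cmod (g x))\<^sup>2"
        by (simp add: power2_diff)
      moreover have "0 \<le> cmod (f x) * cmod (g x)" by simp
      ultimately show "norm (f x * cnj (g x)) \<le> norm ((cmod (f x))\<^sup>2 + (cmod (g x))\<^sup>2)"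
        unfolding norm_mult complex_mod_cnj real_norm_def by linarith
    qed
  qed measurable
qed

lemma L2_norm_add_cmult:
  fixes f g :: "'a::euclidean_space \<Rightarrow> complex"
  assumes "square_integrable f" "square_integrable g"
  shows "(L2_norm (\<lambda>x. f x + c * g x))\<^sup>2 =
    (L2_norm f)\<^sup>2 + (cmod c)\<^sup>2 * (L2_norm g)\<^sup>2 + 2 * Re (cnj c * L2_inner f g)"
proof -
  have int: "integrable lborel (\<lambda>x. (cmod (f x))\<^sup>2)" "integrable lborel (\<lambda>x. (cmod (g x))\<^sup>2)"
    using assms by (auto simp: square_integrable_def)
  have intc: "integrable lborel (\<lambda>x. cnj c * (f x * cnj (g x)))"
    using square_integrable_product[OF assms] by simp
  have exp: "(cmod (u + c * v))\<^sup>2 = (cmod u)\<^sup>2 + (cmod c)\<^sup>2 * (cmod v)\<^sup>2 + 2 * Re (cnj c * (u * cnj v))" for u v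
    by (simp only: cmod_power2) (simp add: power2_eq_square algebra_simps)
  have "(L2_norm (\<lambda>x. f x + c * g x))\<^sup>2 = (LINT x|lborel. (cmod (f x + c * g x))\<^sup>2)"
    by (simp add: L2_norm_def)
  also have "\<dots> = (LINT x|lborel. (cmod (f x))\<^sup>2 + (cmod c)\<^sup>2 * (cmod (g x))\<^sup>2 + 2 * Re (cnj c * (f x * cnj (g x))))"
    by (simp only: exp)
  also have "\<dots> = (LINT x|lborel. (cmod (f x))\<^sup>2) + (cmod c)\<^sup>2 * (LINT x|lborel. (cmod (g x))\<^sup>2) +
      2 * Re (LINT x|lborel. cnj c * (f x * cnj (g x)))"
    using int integrable_Re[OF intc] integral_Re[OF intc]
    by (simp del: times_complex.simps complex_cnj)
  moreover have "(L2_norm h)\<^sup>2 = (LINT x|lborel. (cmod (h x))\<^sup>2)" for h :: "'a \<Rightarrow> complex"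
    by (simp add: L2_norm_def)
  ultimately show ?thesis by (simp add: L2_inner_def)
qed

text \<open>Polarization: the norms of the combinations with \<open>c = 1\<close> and
  \<open>c = \<i>\<close> determine the real and the imaginary part of the inner product.\<close>

lemma is_fourier_transform_inner:
  fixes f g :: "real^2 \<Rightarrow> complex"
  assumes "is_fourier_transform f g" "is_fourier_transform f' g'"
  shows "L2_inner f f' = L2_inner g g'"
proof -
  have sq: "square_integrable f" "square_integrable g" "square_integrable f'" "square_integrable g'"
    using assms by (auto simp: is_fourier_transform_def)
  have norm: "(L2_norm u)\<^sup>2 = (L2_norm v)\<^sup>2" if "is_fourier_transform u v" for u v :: "real^2 \<Rightarrow> complex"
  proof -
    have "square_integrable u" "square_integrable v" using that by (auto simp: is_fourier_transform_def)
    from this[THEN L2_norm_square] is_fourier_transform_norm[OF that]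
    have "ennreal ((L2_norm u)\<^sup>2) = ennreal ((L2_norm v)\<^sup>2)" by simp
    then show ?thesis by (simp add: ennreal_inj)
  qed
  have "Re (cnj c * L2_inner f f') = Re (cnj c * L2_inner g g')" for c
    using norm[OF is_fourier_transform_add_cmult[OF assms, of c]] norm[OF assms(1)] norm[OF assms(2)]
      L2_norm_add_cmult[OF sq(1,3), of c] L2_norm_add_cmult[OF sq(2,4), of c] by simp
  from this[of 1] this[of \<i>] show ?thesis by (simp add: complex_eq_iff)
qed

lemma integral_lborel_translate:
  fixes f :: "'a::euclidean_space \<Rightarrow> complex"
  assumes [measurable]: "f \<in> borel_measurable borel"
  shows "(LINT x|lborel. f (x + c)) = (LINT x|lborel. f x)"
  by (subst lborel_distr_plus[of c, symmetric], subst integral_distr) (auto simp: add_ac)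

lemma nn_integral_affine:
  fixes B :: "real^2^2" and f :: "real^2 \<Rightarrow> ennreal"
  assumes "det B \<noteq> 0" and [measurable]: "f \<in> borel_measurable borel"
  shows "(\<integral>\<^sup>+x. f (B *v x - b) \<partial>lborel) = ennreal (1 / \<bar>det B\<bar>) * (\<integral>\<^sup>+x. f x \<partial>lborel)"
proof -
  have "(\<integral>\<^sup>+x. f x \<partial>lborel) = (\<integral>\<^sup>+x. f (x - b) \<partial>lborel)"
    using nn_integral_lborel_translate[of f "- b"] by simp
  also have "\<dots> = ennreal \<bar>det B\<bar> * (\<integral>\<^sup>+x. f (B *v x - b) \<partial>lborel)"
    using assms by (intro nn_integral_matrix_vector) auto
  finally show ?thesis
    using assms(1) by (simp flip: ennreal_mult mult.assoc)
qed

lemma integrable_affine: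
  fixes B :: "real^2^2" and f :: "real^2 \<Rightarrow> complex"
  assumes B: "det B \<noteq> 0" and f: "integrable lborel f"
  shows "integrable lborel (\<lambda>x. f (B *v x - b))"
proof -
  have [measurable]: "f \<in> borel_measurable borel" using borel_measurable_integrable[OF f] by simp
  have "(\<integral>\<^sup>+x. ennreal (cmod (f (B *v x - b))) \<partial>lborel) = ennreal (1 / \<bar>det B\<bar>) * (\<integral>\<^sup>+x. ennreal (cmod (f x)) \<partial>lborel)"
    by (rule nn_integral_affine[OF B, of "\<lambda>y. ennreal (cmod (f y))"]) measurable
  also have "\<dots> < \<infinity>" using f by (simp add: integrable_iff_bounded ennreal_mult_less_top)
  finally show ?thesis by (intro integrableI_bounded) auto
qed

lemma square_integrable_affine:
  fixes B :: "real^2^2"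
  assumes B: "det B \<noteq> 0" and f: "square_integrable f"
  shows "square_integrable (\<lambda>x. f (B *v x - b))"
proof -
  have [measurable]: "f \<in> borel_measurable borel" using f by (simp add: square_integrable_iff)
  have "sq_integral lborel (\<lambda>x. f (B *v x - b)) = ennreal (1 / \<bar>det B\<bar>) * sq_integral lborel f"
    by (rule nn_integral_affine[OF B, of "\<lambda>y. ennreal ((cmod (f y))\<^sup>2)"]) measurable
  also have "\<dots> < \<infinity>" using f by (simp add: square_integrable_iff ennreal_mult_less_top)
  finally show ?thesis by (simp add: square_integrable_iff)
qed

text \<open>The hypothesis \<open>dual\<close> says that \<open>T\<close> is the inverse transpose
  of \<open>B\<close>. Stated with inner products, it can be checked in coordinates for the shearlet
  matrices without computing an inverse.\<close>

lemma fourier_integral_affine: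
  fixes B T :: "real^2^2" and f :: "real^2 \<Rightarrow> complex"
  assumes det: "det B * det T = 1" and dual: "\<And>x \<xi>. (B *v x) \<bullet> (T *v \<xi>) = x \<bullet> \<xi>"
    and f: "integrable lborel f"
  shows "fourier_integral (\<lambda>x. f (B *v x - b)) \<xi> = \<bar>det T\<bar> * chr (- (b \<bullet> (T *v \<xi>))) * fourier_integral f (T *v \<xi>)"
proof -
  have B: "det B \<noteq> 0" using det by auto
  have [measurable]: "f \<in> borel_measurable borel" using borel_measurable_integrable[OF f] by simp
  let ?G = "\<lambda>y. f (y - b) * chr (- (y \<bullet> (T *v \<xi>)))"
  have int: "integrable lborel ?G"
    using integrable_affine[of "mat 1" f b] f by (intro integrable_mult_chr) (auto simp: det_I)
  have "\<bar>det T\<bar> * \<bar>det B\<bar> = 1" using det by (simp flip: abs_mult) (simp add: mult.commute)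
  then have detTB: "complex_of_real \<bar>det T\<bar> * of_real \<bar>det B\<bar> = 1"
    by (simp only: of_real_mult[symmetric] of_real_1)
  have "fourier_integral (\<lambda>x. f (B *v x - b)) \<xi> = (LINT x|lborel. ?G (B *v x))"
    by (simp add: fourier_integral_chr dual)
  also have "\<dots> = of_real \<bar>det T\<bar> * (of_real \<bar>det B\<bar> * (LINT x|lborel. ?G (B *v x)))"
    unfolding mult.assoc[symmetric] detTB by simp
  also have "of_real \<bar>det B\<bar> * (LINT x|lborel. ?G (B *v x)) = (LINT y|lborel. ?G y)"
    using integral_matrix_vector[OF B int] by simp
  also have "\<dots> = (LINT y|lborel. ?G (y + b))"
    by (rule integral_lborel_translate[symmetric]) measurable
  also have "\<dots> = (LINT y|lborel. chr (- (b \<bullet> (T *v \<xi>))) * (f y * chr (- (y \<bullet> (T *v \<xi>)))))"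
    by (simp add: inner_add_left chr_add[of "- _" "- _", simplified] mult_ac)
  also have "\<dots> = chr (- (b \<bullet> (T *v \<xi>))) * fourier_integral f (T *v \<xi>)"
    by (simp add: fourier_integral_chr)
  finally show ?thesis by (simp add: mult_ac)
qed

lemma is_fourier_transform_affine:
  fixes B T :: "real^2^2" and f :: "real^2 \<Rightarrow> complex"
  assumes det: "det B * det T = 1" and dual: "\<And>x \<xi>. (B *v x) \<bullet> (T *v \<xi>) = x \<bullet> \<xi>"
    and f: "is_fourier_transform f g"
  shows "is_fourier_transform (\<lambda>x. f (B *v x - b)) (\<lambda>\<xi>. \<bar>det T\<bar> * chr (- (b \<bullet> (T *v \<xi>))) * g (T *v \<xi>))"
proof -
  have B: "det B \<noteq> 0" and T: "det T \<noteq> 0" using det by auto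
  obtain F where F: "square_integrable f" "square_integrable g" "f \<in> borel_measurable borel" "g \<in> borel_measurable borel"
    "\<And>n. integrable lborel (F n)" "\<And>n. square_integrable (F n)" "\<And>n. F n \<in> borel_measurable borel"
    "(\<lambda>n. sqdist lborel (F n) f) \<longlonglongrightarrow> 0" "(\<lambda>n. sqdist lborel (fourier_integral (F n)) g) \<longlonglongrightarrow> 0"
    using is_fourier_transformE[OF f] by blast
  note [measurable] = F(3,4,7)
  let ?m = "\<lambda>g \<xi>. \<bar>det T\<bar> * chr (- (b \<bullet> (T *v \<xi>))) * g (T *v \<xi>)"
  have sq_m: "square_integrable (?m g)"
  proof -
    have "square_integrable (\<lambda>\<xi>. g (T *v \<xi>))" using square_integrable_affine[OF T F(2), of 0] by simp
    then have "sq_integral lborel (\<lambda>x. g (T *v x)) < \<infinity>" by (simp add: square_integrable_iff)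
    then have "ennreal ((det T)\<^sup>2) * sq_integral lborel (\<lambda>x. g (T *v x)) < \<infinity>"
      by (simp add: ennreal_mult_less_top)
    then show ?thesis
      by (simp add: square_integrable_iff norm_mult power_mult_distrib ennreal_mult nn_integral_cmult)
  qed
  show ?thesis
    unfolding is_fourier_transform_def L2_converges_sqdist
  proof (intro conjI exI[of _ "\<lambda>n x. F n (B *v x - b)"] allI)
    show "square_integrable (\<lambda>x. f (B *v x - b))" "square_integrable (\<lambda>x. F n (B *v x - b))"
      "integrable lborel (\<lambda>x. F n (B *v x - b))" for n
      using F B by (auto intro!: square_integrable_affine integrable_affine)
    have "sqdist lborel (\<lambda>x. F n (B *v x - b)) (\<lambda>x. f (B *v x - b)) = ennreal (1 / \<bar>det B\<bar>) * sqdist lborel (F n) f" for n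
      unfolding sqdist_def by (rule nn_integral_affine[OF B, of "\<lambda>y. ennreal ((cmod (F n y - f y))\<^sup>2)"]) measurable
    moreover have "(\<lambda>n. ennreal (1 / \<bar>det B\<bar>) * sqdist lborel (F n) f) \<longlonglongrightarrow> ennreal (1 / \<bar>det B\<bar>) * 0"
      by (intro ennreal_tendsto_cmult F) auto
    ultimately show "(\<lambda>n. sqdist lborel (\<lambda>x. F n (B *v x - b)) (\<lambda>x. f (B *v x - b))) \<longlonglongrightarrow> 0" by simp
    have fi: "fourier_integral (\<lambda>x. F n (B *v x - b)) = ?m (fourier_integral (F n))" for n
      using F by (intro ext fourier_integral_affine det dual)
    have "sqdist lborel (?m (fourier_integral (F n))) (?m g) =
        ennreal ((det T)\<^sup>2) * (ennreal (1 / \<bar>det T\<bar>) * sqdist lborel (fourier_integral (F n)) g)" for n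
    proof -
      have "sqdist lborel (?m (fourier_integral (F n))) (?m g) =
         (\<integral>\<^sup>+\<xi>. ennreal ((det T)\<^sup>2) * ennreal ((cmod (fourier_integral (F n) (T *v \<xi> - 0) - g (T *v \<xi> - 0)))\<^sup>2) \<partial>lborel)"
        unfolding sqdist_def right_diff_distrib[symmetric]
        by (simp add: norm_mult power_mult_distrib ennreal_mult)
      also have "\<dots> = ennreal ((det T)\<^sup>2) * sq_integral lborel (\<lambda>\<xi>. fourier_integral (F n) (T *v \<xi> - 0) - g (T *v \<xi> - 0))"
        by (rule nn_integral_cmult) measurable
      also have "sq_integral lborel (\<lambda>\<xi>. fourier_integral (F n) (T *v \<xi> - 0) - g (T *v \<xi> - 0)) =
          ennreal (1 / \<bar>det T\<bar>) * sqdist lborel (fourier_integral (F n)) g"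
        unfolding sqdist_def
        by (rule nn_integral_affine[OF T, of "\<lambda>y. ennreal ((cmod (fourier_integral (F n) y - g y))\<^sup>2)"]) measurable
      finally show ?thesis .
    qed
    moreover have "(\<lambda>n. ennreal ((det T)\<^sup>2) * (ennreal (1 / \<bar>det T\<bar>) * sqdist lborel (fourier_integral (F n)) g))
        \<longlonglongrightarrow> ennreal ((det T)\<^sup>2) * (ennreal (1 / \<bar>det T\<bar>) * 0)"
      by (intro ennreal_tendsto_cmult F) auto
    ultimately show "(\<lambda>n. sqdist lborel (fourier_integral (\<lambda>x. F n (B *v x - b))) (?m g)) \<longlonglongrightarrow> 0"
      unfolding fi by simp
  qed (use F sq_m in auto)
qed

lemma is_fourier_transform_integrable:
  fixes f :: "real^2 \<Rightarrow> complex"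
  assumes "integrable lborel f" "square_integrable f"
  shows "is_fourier_transform f (fourier_integral f)"
proof -
  have [measurable]: "f \<in> borel_measurable borel" using assms by (simp add: square_integrable_iff)
  have "square_integrable (fourier_integral f)"
    using assms by (auto simp: square_integrable_iff plancherel_L1_L2)
  then show ?thesis
    unfolding is_fourier_transform_def L2_converges_sqdist
    using assms by (intro conjI exI[of _ "\<lambda>_. f"]) (auto simp: sqdist_def)
qed

text \<open>The witness is a modulation of \<open>\<bar>b\<bar>\<^sup>2\<close>, where \<open>b\<close> is the transform of the indicator
  of the unit square: its transform is a translate of the autocorrelation of that indicator.\<close>

lemma L2_cone_nontrivial: "\<exists>f\<in>L2_cone. L2_norm f > 0"
proof -
  define q where "q = (indicator unit_square :: real^2 \<Rightarrow> complex)"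
  define b where "b = fourier_integral q"
  \<comment> \<open>The autocorrelation vanishes outside the square of side 2 around 0. Moved by 3
    along the first axis, this square becomes the product of [2,4] and [-1,1], which lies in the
    cone.\<close>
  define \<xi>0 :: "real^2" where "\<xi>0 = vector [3, 0]"
  define f where "f x = b x * cnj (b x) * chr (x \<bullet> \<xi>0)" for x
  have [measurable]: "q \<in> borel_measurable borel" unfolding q_def by measurable
  have [measurable]: "b \<in> borel_measurable borel" unfolding b_def by measurable
  have [measurable]: "f \<in> borel_measurable borel" unfolding f_def by measurable
  have "emeasure lborel unit_square = (\<integral>\<^sup>+x. 1 \<partial>U2)"
    by (subst nn_integral_U2) auto
  then have square: "emeasure lborel unit_square = 1" using U2.emeasure_space_1 by simp
  have norm_q: "ennreal ((cmod (q x))\<^sup>2) = indicator unit_square x" "ennreal (cmod (q x)) = indicator unit_square x" for x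
    by (auto simp: q_def indicator_def)
  have q: "integrable lborel q" "square_integrable q"
    by (auto simp: square_integrable_iff integrable_iff_bounded norm_q square)
  have ft_q: "is_fourier_transform q b" unfolding b_def by (rule is_fourier_transform_integrable[OF q])
  then have sq_b: "square_integrable b" by (simp add: is_fourier_transform_def)
  have norm_b: "sq_integral lborel b = 1"
    using is_fourier_transform_norm[OF ft_q] by (simp add: norm_q square)
  \<comment> \<open>Needed for square integrability of \<open>f\<close>: as |b| <= 1, the fourth
    power of |b| is at most its square.\<close>
  have b_le: "cmod (b x) \<le> 1" for x
  proof -
    have "ennreal (cmod (b x)) \<le> (\<integral>\<^sup>+y. ennreal (cmod (q y * chr (- (y \<bullet> x)))) \<partial>lborel)"
      unfolding b_def fourier_integral_chr
      by (rule integral_norm_bound_ennreal) (rule integrable_mult_chr(2)[OF q(1)])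
    also have "\<dots> = 1" by (simp add: norm_mult norm_q square)
    finally show ?thesis by simp
  qed
  have f_norm: "cmod (f x) = (cmod (b x))\<^sup>2" for x
    by (simp add: f_def norm_mult power2_eq_square)
  have f: "integrable lborel f" "square_integrable f"
  proof -
    show "integrable lborel f"
      using norm_b by (simp add: integrable_iff_bounded f_norm)
    have "sq_integral lborel f \<le> sq_integral lborel b"
    proof (intro nn_integral_mono ennreal_leI)
      fix x
      have "(cmod (b x))\<^sup>2 \<le> 1" using b_le[of x] by (simp add: power_le_one)
      then show "(cmod (f x))\<^sup>2 \<le> (cmod (b x))\<^sup>2"
        unfolding f_norm by (simp add: power2_eq_square mult_left_le)
    qed
    then show "square_integrable f" unfolding norm_b by (auto simp: square_integrable_iff intro: le_less_trans)
  qed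
  \<comment> \<open>The translate of \<open>q\<close> by \<open>\<xi> - \<xi>0\<close> has as
    transform a modulation of \<open>b\<close>, so the Fourier integral of \<open>f\<close> is an
    inner product of transforms, and Plancherel turns it into the autocorrelation.\<close>
  have transform: "fourier_integral f \<xi> = (LINT y|lborel. q (y - (\<xi> - \<xi>0)) * cnj (q y))" for \<xi>
  proof -
    let ?a = "\<xi> - \<xi>0"
    have ft: "is_fourier_transform (\<lambda>x. q (mat 1 *v x - ?a)) (\<lambda>x. \<bar>det (mat 1 :: real^2^2)\<bar> * chr (- (?a \<bullet> (mat 1 *v x))) * b (mat 1 *v x))"
      by (rule is_fourier_transform_affine[OF _ _ ft_q]) (auto simp: det_I)
    have chr_eq: "chr (x \<bullet> \<xi>0) * chr (- (x \<bullet> \<xi>)) = chr (- (?a \<bullet> x))" for x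
      by (simp add: inner_diff_left inner_diff_right inner_commute[of x] flip: chr_add)
    have "fourier_integral f \<xi> = (LINT x|lborel. \<bar>det (mat 1 :: real^2^2)\<bar> * chr (- (?a \<bullet> (mat 1 *v x))) * b (mat 1 *v x) * cnj (b x))"
      unfolding fourier_integral_chr f_def mult.assoc chr_eq
      by (simp add: det_I mult_ac)
    also have "\<dots> = L2_inner (\<lambda>x. q (mat 1 *v x - ?a)) q"
      unfolding is_fourier_transform_inner[OF ft ft_q] by (simp add: L2_inner_def)
    finally show ?thesis by (simp add: L2_inner_def)
  qed
  define U where "U = {\<xi> :: real^2. \<bar>\<xi> $ 1 - 3\<bar> > 1} \<union> {\<xi>. \<bar>\<xi> $ 2\<bar> > 1}"
  have "open U"
    unfolding U_def by (intro open_Un open_Collect_less continuous_intros)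
  moreover have "fourier_integral f \<xi> = 0" if "\<xi> \<in> U" for \<xi>
  proof -
    have "q (y - (\<xi> - \<xi>0)) * cnj (q y) = 0" for y
    proof (rule ccontr)
      assume "q (y - (\<xi> - \<xi>0)) * cnj (q y) \<noteq> 0"
      then have "y - (\<xi> - \<xi>0) \<in> unit_square" "y \<in> unit_square"
        by (auto simp: q_def indicator_def split: if_splits)
      then have "0 \<le> y $ 1 - (\<xi> $ 1 - 3)" "y $ 1 - (\<xi> $ 1 - 3) < 1" "0 \<le> y $ 1" "y $ 1 < 1"
        "0 \<le> y $ 2 - \<xi> $ 2" "y $ 2 - \<xi> $ 2 < 1" "0 \<le> y $ 2" "y $ 2 < 1"
        by (auto simp: unit_square_def \<xi>0_def)
      then show False using that by (auto simp: U_def)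
    qed
    then show ?thesis unfolding transform by (simp only: Bochner_Integration.integral_zero)
  qed
  moreover have "- U \<subseteq> shear_cone"
    by (auto simp: U_def shear_cone_def abs_divide divide_le_eq)
  ultimately have "ess_support (fourier_integral f) \<subseteq> shear_cone"
    unfolding ess_support_def by blast
  then have "f \<in> L2_cone"
    unfolding L2_cone_def using is_fourier_transform_integrable[OF f] by blast
  moreover have "L2_norm f \<noteq> 0"
  proof
    assume "L2_norm f = 0"
    then have "sq_integral lborel f = 0"
      using L2_norm_square[OF f(2)] by simp
    then have "AE x in lborel. f x = 0"
      by (subst (asm) nn_integral_0_iff_AE) auto
    then have "AE x in lborel. ennreal ((cmod (b x))\<^sup>2) = 0"
      by eventually_elim (simp add: f_norm[symmetric])
    then have "sq_integral lborel b = 0"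
      by (subst nn_integral_0_iff_AE) auto
    then show False using norm_b by simp
  qed
  moreover have "L2_norm f \<ge> 0" by (simp add: L2_norm_def)
  ultimately show ?thesis by (intro bexI[of _ f]) linarith+
qed

section \<open>The frame inequality\<close>

text \<open>The union of all open sets on which \<open>g\<close> vanishes almost everywhere is
  uncountable; by Lindelof countably many of them have the same union, and their exceptional sets
  together are null.\<close>

lemma ess_support_AE_zero:
  assumes "ess_support g \<subseteq> C"
  shows "AE \<xi> in lborel. \<xi> \<notin> C \<longrightarrow> g \<xi> = 0"
proof -
  define \<U> where "\<U> = {U. open U \<and> (AE \<xi> in lborel. \<xi> \<in> U \<longrightarrow> g \<xi> = 0)}"
  obtain \<V> where \<V>: "\<V> \<subseteq> \<U>" "countable \<V>" "\<Union>\<V> = \<Union>\<U>"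
    using Lindelof[of \<U>] unfolding \<U>_def by blast
  have "AE \<xi> in lborel. \<forall>U\<in>\<V>. \<xi> \<in> U \<longrightarrow> g \<xi> = 0"
    using \<V> by (subst AE_ball_countable) (auto simp: \<U>_def)
  moreover have "- C \<subseteq> \<Union>\<V>"
    using assms unfolding \<V>(3) by (auto simp: ess_support_def \<U>_def)
  ultimately show ?thesis by (elim eventually_mono) blast
qed

text \<open>The substitution by \<open>N\<close> straightens the lattice to the integer lattice. It
  multiplies \<open>E\<close> and \<open>X\<close> by |det N| and \<open>S\<close> by its square,
  and one factor cancels.\<close>

lemma parseval_matrix_bounds:
  fixes g :: "real^2 \<Rightarrow> complex" and N :: "real^2^2"
  assumes int: "integrable lborel g" and N: "det N \<noteq> 0"
  defines "E \<equiv> \<integral>\<^sup>+\<xi>. ennreal ((cmod (g \<xi>))\<^sup>2) \<partial>lborel"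
    and "X \<equiv> \<integral>\<^sup>+l. \<integral>\<^sup>+\<xi>. ennreal (cmod (g \<xi>) * cmod (g (\<xi> + matrix_inv N *v vec_of_int l))) \<partial>lborel \<partial>count_space (UNIV - {0})"
    and "S \<equiv> \<integral>\<^sup>+m. ennreal ((cmod (LINT \<xi>|lborel. g \<xi> * chr (vec_of_int m \<bullet> (N *v \<xi>))))\<^sup>2) \<partial>count_space UNIV"
  assumes fin: "E + X < \<infinity>"
  shows "ennreal \<bar>det N\<bar> * S \<le> E + X" "E \<le> ennreal \<bar>det N\<bar> * S + X"
proof -
  have [measurable]: "g \<in> borel_measurable borel" using borel_measurable_integrable[OF int] by simp
  let ?h = "\<lambda>\<zeta>. g (matrix_inv N *v \<zeta>)" and ?d = "ennreal \<bar>det N\<bar>"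
  have "det (matrix_inv N) \<noteq> 0" using N by (simp add: det_matrix_inv)
  then have inth: "integrable lborel ?h" using int by (rule integrable_matrix_vector)
  have E: "(sq_integral lborel ?h) = ?d * E"
    unfolding E_def by (subst nn_integral_matrix_vector[OF N]) (auto simp: matrix_inv_mult[OF N])
  have X: "(\<integral>\<^sup>+l. \<integral>\<^sup>+\<xi>. ennreal (cmod (?h \<xi>) * cmod (?h (\<xi> + vec_of_int l))) \<partial>lborel \<partial>count_space (UNIV - {0})) = ?d * X"
  proof -
    have "(\<integral>\<^sup>+\<xi>. ennreal (cmod (?h \<xi>) * cmod (?h (\<xi> + vec_of_int l))) \<partial>lborel) =
      ?d * (\<integral>\<^sup>+\<xi>. ennreal (cmod (g \<xi>) * cmod (g (\<xi> + matrix_inv N *v vec_of_int l))) \<partial>lborel)" for l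
      by (subst nn_integral_matrix_vector[OF N])
         (auto simp: matrix_inv_mult[OF N] matrix_vector_right_distrib)
    then show ?thesis unfolding X_def by (simp add: nn_integral_cmult)
  qed
  have "(LINT \<xi>|lborel. ?h \<xi> * chr (vec_of_int m \<bullet> \<xi>)) =
      \<bar>det N\<bar> * (LINT \<xi>|lborel. g \<xi> * chr (vec_of_int m \<bullet> (N *v \<xi>)))" for m
    using integral_matrix_vector[OF N integrable_mult_chr(1)[OF inth, of "vec_of_int m"]]
    by (simp add: matrix_inv_mult[OF N])
  note eq = this
  have S: "(sq_integral (count_space UNIV) (\<lambda>m. LINT \<xi>|lborel. ?h \<xi> * chr (vec_of_int m \<bullet> \<xi>))) = ?d * (?d * S)"
  proof -
    have "ennreal ((cmod (of_real \<bar>det N\<bar> * z))\<^sup>2) = ?d * (?d * ennreal ((cmod z)\<^sup>2))" for z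
    proof -
      have "(cmod (of_real \<bar>det N\<bar> * z))\<^sup>2 = \<bar>det N\<bar> * (\<bar>det N\<bar> * (cmod z)\<^sup>2)"
        by (simp only: norm_mult norm_of_real abs_abs power_mult_distrib power2_eq_square[of "\<bar>det N\<bar>"] mult.assoc)
      then show ?thesis by (simp only: ennreal_mult abs_ge_zero mult_nonneg_nonneg zero_le_power2)
    qed
    with eq show ?thesis unfolding S_def by (simp only: nn_integral_cmult) (simp add: nn_integral_cmult)
  qed
  have "?d * E + ?d * X < \<infinity>"
    using fin by (simp add: ennreal_mult_less_top)
  then have "?d * (?d * S) \<le> ?d * E + ?d * X" "?d * E \<le> ?d * (?d * S) + ?d * X"
    using parseval_lattice_bounds[OF inth] unfolding E X S by auto
  then have *: "?d * (?d * S) \<le> ?d * (E + X)" "?d * E \<le> ?d * (?d * S + X)"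
    by (simp_all add: distrib_left)
  have cancel: "a \<le> b" if "?d * a \<le> ?d * b" for a b
  proof -
    have "ennreal (1 / \<bar>det N\<bar>) * (?d * a) \<le> ennreal (1 / \<bar>det N\<bar>) * (?d * b)"
      using that by (rule mult_left_mono) simp
    moreover have "ennreal (1 / \<bar>det N\<bar>) * ?d = 1"
      using N by (simp add: ennreal_mult[symmetric])
    ultimately show ?thesis by (simp add: mult.assoc[symmetric])
  qed
  show "?d * S \<le> E + X" "E \<le> ?d * S + X" using *[THEN cancel] by auto
qed

text \<open>With \<open>T = cone_mat (j, k)\<close>, the transform of a shearlet is a modulation of
  \<open>sqrt (det T) * p (T *v \<xi>)\<close>.\<close>

definition cone_mat :: "nat \<times> int \<Rightarrow> real^2^2" where
  "cone_mat = (\<lambda>(j, k). transpose (shear_mat (of_int k)) ** dil_mat (1 / 2 ^ j))"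

definition cone_index :: "(nat \<times> int) set" where
  "cone_index = {(j, k). k \<in> shears j}"

lemma cone_mat_nth:
  "(cone_mat (j, k) *v \<xi>) $ 1 = \<xi> $ 1 / 2 ^ j"
  "(cone_mat (j, k) *v \<xi>) $ 2 = k * (\<xi> $ 1 / 2 ^ j) + \<xi> $ 2 / sqrt (2 ^ j)"
  by (simp_all add: cone_mat_def matrix_matrix_mult_def matrix_vector_mult_def sum_2
      transpose_def shear_mat_def dil_mat_def real_sqrt_divide)

lemma det_cone_mat: "det (cone_mat (j, k)) = 1 / (2 ^ j * sqrt (2 ^ j))"
  by (simp add: cone_mat_def det_mul det_transpose) (simp add: det_2 shear_mat_def dil_mat_def real_sqrt_divide)

lemma det_cone_mat_pos: "det (cone_mat a) > 0"
  by (cases a) (simp add: det_cone_mat)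

lemma samp_mat_nth: "(samp_mat c *v x) $ 1 = c $ 1 * x $ 1" "(samp_mat c *v x) $ 2 = c $ 2 * x $ 2"
  by (simp_all add: samp_mat_def matrix_vector_mult_def sum_2)

lemma det_samp_mat: "det (samp_mat c) = c $ 1 * c $ 2"
  by (simp add: samp_mat_def det_2)

lemma samp_mat_symmetric: "(samp_mat c *v x) \<bullet> y = x \<bullet> (samp_mat c *v y)"
  by (simp add: inner_real2 samp_mat_nth)

text \<open>An affine change of variables: \<open>cone_mat (j, k)\<close> is the inverse transpose
  of the matrix inside \<open>shearlet\<close>, as \<open>dual\<close> verifies in
  coordinates.\<close>

lemma shearlet_transform:
  assumes "is_fourier_transform \<psi> p"
  shows "is_fourier_transform (shearlet \<psi> c (j, k, m))
    (\<lambda>\<xi>. sqrt (det (cone_mat (j, k))) * chr (- ((samp_mat c *v vec_of_int m) \<bullet> (cone_mat (j, k) *v \<xi>))) *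
       p (cone_mat (j, k) *v \<xi>))"
proof -
  let ?B = "shear_mat (- of_int k) ** dil_mat (2 ^ j)" and ?T = "cone_mat (j, k)"
  have B_nth: "(?B *v x) $ 1 = 2 ^ j * x $ 1 - k * (sqrt (2 ^ j) * x $ 2)" "(?B *v x) $ 2 = sqrt (2 ^ j) * x $ 2" for x
    by (simp_all add: matrix_matrix_mult_def matrix_vector_mult_def sum_2 shear_mat_def dil_mat_def)
  have "det ?B = 2 ^ j * sqrt (2 ^ j)"
    by (simp add: det_mul) (simp add: det_2 shear_mat_def dil_mat_def)
  then have det: "det ?B * det ?T = 1" by (simp add: det_cone_mat)
  have dual: "(?B *v x) \<bullet> (?T *v \<xi>) = x \<bullet> \<xi>" for x \<xi>
  proof -
    have "sqrt (2 ^ j) \<noteq> 0" "sqrt (2 ^ j) * sqrt (2 ^ j) = (2 :: real) ^ j" by simp_all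
    then show ?thesis
      unfolding inner_real2 B_nth cone_mat_nth by (simp add: field_simps)
  qed
  \<comment> \<open>The determinant is 2^(-3j/2), so the normalization 2^(3j/4) is the inverse of
    its square root.\<close>
  have scale: "2 powr (3 * real j / 4) * det ?T = sqrt (det ?T)"
  proof -
    have "det ?T = 2 powr (- (3 * real j / 2))"
      by (simp add: det_cone_mat powr_half_sqrt[symmetric] powr_realpow[symmetric] powr_powr
          powr_minus_divide powr_add[symmetric])
    then show ?thesis by (simp add: powr_half_sqrt[symmetric] powr_powr flip: powr_add)
  qed
  have scalec: "complex_of_real (2 powr (3 * real j / 4)) * of_real (det ?T) = of_real (sqrt (det ?T))"
    by (simp only: of_real_mult[symmetric] scale)
  have "is_fourier_transform (\<lambda>x. of_real (2 powr (3 * real j / 4)) * \<psi> (?B *v x - samp_mat c *v vec_of_int m))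
    (\<lambda>\<xi>. of_real (2 powr (3 * real j / 4)) * (\<bar>det ?T\<bar> * chr (- ((samp_mat c *v vec_of_int m) \<bullet> (?T *v \<xi>))) * p (?T *v \<xi>)))"
    by (intro is_fourier_transform_cmult is_fourier_transform_affine det dual assms)
  then show ?thesis
    using det_cone_mat_pos[of "(j, k)"] by (simp add: shearlet_def scalec mult.assoc[symmetric])
qed

text \<open>Brings the coefficient into the shape required by \<open>parseval_matrix_bounds\<close>
  with \<open>N = samp_mat c ** cone_mat (j, k)\<close>. The diagonal matrix
  \<open>samp_mat c\<close> is symmetric and moves to the frequency side of the inner
  product.\<close>

lemma shearlet_coefficient:
  assumes f: "is_fourier_transform f g" and p: "is_fourier_transform \<psi> p"
  shows "(cmod (L2_inner f (shearlet \<psi> c (j, k, m))))\<^sup>2 = det (cone_mat (j, k)) *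
    (cmod (LINT \<xi>|lborel. g \<xi> * cnj (p (cone_mat (j, k) *v \<xi>)) *
       chr (vec_of_int m \<bullet> ((samp_mat c ** cone_mat (j, k)) *v \<xi>))))\<^sup>2"
proof -
  let ?T = "cone_mat (j, k)"
  have "L2_inner f (shearlet \<psi> c (j, k, m)) = (LINT \<xi>|lborel. of_real (sqrt (det ?T)) * (g \<xi> * cnj (p (?T *v \<xi>)) *
       chr (vec_of_int m \<bullet> ((samp_mat c ** ?T) *v \<xi>))))"
    unfolding is_fourier_transform_inner[OF f shearlet_transform[OF p]]
    by (simp add: L2_inner_def cnj_chr samp_mat_symmetric matrix_vector_mul_assoc mult_ac)
  also have "\<dots> = of_real (sqrt (det ?T)) * (LINT \<xi>|lborel. g \<xi> * cnj (p (?T *v \<xi>)) *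
       chr (vec_of_int m \<bullet> ((samp_mat c ** ?T) *v \<xi>)))"
    by simp
  finally show ?thesis
    using det_cone_mat_pos[of "(j, k)"] by (simp add: norm_mult power_mult_distrib)
qed

section \<open>Sums over the index sets and essential bounds of \<open>Phi\<close>\<close>

lemma finite_shears: "finite (shears j)"
  by (rule finite_subset[of _ "{- \<lceil>2 powr (real j / 2)\<rceil>..\<lceil>2 powr (real j / 2)\<rceil>}"]) (auto simp: shears_def)

lemma nn_integral_cone_index:
  "(\<integral>\<^sup>+a. f a \<partial>count_space cone_index) = (\<Sum>j. \<Sum>k\<in>shears j. f (j, k))"
proof -
  have "(\<integral>\<^sup>+a. f a \<partial>count_space cone_index) = (\<integral>\<^sup>+a. f a * indicator cone_index a \<partial>count_space UNIV)"
    by (rule nn_integral_count_space_indicator) simp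
  also have "\<dots> = (\<integral>\<^sup>+j. \<integral>\<^sup>+k. f (j, k) * indicator cone_index (j, k) \<partial>count_space UNIV \<partial>count_space UNIV)"
    by (rule nn_integral_fst_count_space[symmetric])
  also have "\<dots> = (\<integral>\<^sup>+j. \<integral>\<^sup>+k. f (j, k) * indicator (shears j) k \<partial>count_space UNIV \<partial>count_space UNIV)"
    by (simp add: cone_index_def indicator_def)
  also have "\<dots> = (\<integral>\<^sup>+j. \<integral>\<^sup>+k. f (j, k) \<partial>count_space (shears j) \<partial>count_space UNIV)"
    by (simp add: nn_integral_count_space_indicator[symmetric])
  also have "\<dots> = (\<Sum>j. \<Sum>k\<in>shears j. f (j, k))"
    by (simp add: nn_integral_count_space_nat nn_integral_count_space_finite finite_shears)
  finally show ?thesis .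
qed

lemma Phi_eq_nn_integral:
  "Phi p \<xi> \<omega> = (\<integral>\<^sup>+a. ennreal (cmod (p (cone_mat a *v \<xi>)) * cmod (p (cone_mat a *v \<xi> + \<omega>))) \<partial>count_space cone_index)"
  by (simp add: nn_integral_cone_index Phi_def cone_mat_def Let_def)

lemma frame_sum_shearlet_index:
  "frame_sum shearlet_index g f =
    (\<integral>\<^sup>+a. \<integral>\<^sup>+m. ennreal ((cmod (L2_inner f (g (fst a, snd a, m))))\<^sup>2) \<partial>count_space UNIV \<partial>count_space cone_index)"
proof -
  let ?F = "\<lambda>i. ennreal ((cmod (L2_inner f (g i)))\<^sup>2)"
  have "frame_sum shearlet_index g f = (\<integral>\<^sup>+i. ?F i * indicator shearlet_index i \<partial>count_space UNIV)"
    by (simp add: frame_sum_def infsum_eq_nn_integral nn_integral_count_space_indicator)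
  also have "\<dots> = (\<integral>\<^sup>+j. \<integral>\<^sup>+k. \<integral>\<^sup>+m. ?F (j, k, m) * indicator shearlet_index (j, k, m) \<partial>count_space UNIV \<partial>count_space UNIV \<partial>count_space UNIV)"
    by (simp add: nn_integral_fst_count_space[symmetric])
  also have "\<dots> = (\<integral>\<^sup>+j. \<integral>\<^sup>+k. (\<integral>\<^sup>+m. ?F (j, k, m) \<partial>count_space UNIV) * indicator cone_index (j, k) \<partial>count_space UNIV \<partial>count_space UNIV)"
    by (intro nn_integral_cong) (auto simp: shearlet_index_def cone_index_def indicator_def)
  also have "\<dots> = (\<integral>\<^sup>+a. (\<integral>\<^sup>+m. ?F (fst a, snd a, m) \<partial>count_space UNIV) * indicator cone_index a \<partial>count_space UNIV)"
    using nn_integral_fst_count_space[of "\<lambda>a. (\<integral>\<^sup>+m. ?F (fst a, snd a, m) \<partial>count_space UNIV) * indicator cone_index a"]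
    by simp
  also have "\<dots> = (\<integral>\<^sup>+a. \<integral>\<^sup>+m. ?F (fst a, snd a, m) \<partial>count_space UNIV \<partial>count_space cone_index)"
    by (rule nn_integral_count_space_indicator[symmetric]) simp
  finally show ?thesis .
qed

lemma shear_cone_borel [measurable]: "shear_cone \<in> sets borel"
proof -
  have "Measurable.pred borel (\<lambda>\<xi>::real^2. \<bar>\<xi> $ 1\<bar> \<ge> 1 \<and> \<bar>\<xi> $ 2 / \<xi> $ 1\<bar> \<le> 1)" by measurable
  then show ?thesis unfolding shear_cone_def by simp
qed

lemma AE_restrict_shear_cone:
  "(AE \<xi> in restrict_space lborel shear_cone. P \<xi>) \<longleftrightarrow> (AE \<xi> in lborel. \<xi> \<in> shear_cone \<longrightarrow> P \<xi>)"
  by (rule AE_restrict_space_iff) simp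

lemma Phi_measurable [measurable]:
  assumes [measurable]: "p \<in> borel_measurable borel"
  shows "(\<lambda>\<xi>. Phi p \<xi> \<omega>) \<in> borel_measurable borel"
  unfolding Phi_eq_nn_integral by (intro borel_measurable_nn_integral_count) auto

lemma AE_Phi_le_Gamma: "AE \<xi> in lborel. \<xi> \<in> shear_cone \<longrightarrow> Phi p \<xi> \<omega> \<le> Gamma_sup p \<omega>"
  unfolding Gamma_sup_def AE_restrict_shear_cone[symmetric] by (rule esssup_AE)

lemma AE_Phi_le_L_sup: "AE \<xi> in lborel. \<xi> \<in> shear_cone \<longrightarrow> Phi p \<xi> 0 \<le> L_sup p"
  unfolding L_sup_def AE_restrict_shear_cone[symmetric] by (rule esssup_AE)

text \<open>The supremum in \<open>essinf\<close> is not attained by definition. A sequence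
  increasing to \<open>z\<close> from strictly below has countably many exceptional null sets, so
  the bound passes to \<open>z\<close> itself.\<close>

lemma AE_Phi_ge:
  assumes "z \<le> L_inf p" "z < \<infinity>"
  shows "AE \<xi> in lborel. \<xi> \<in> shear_cone \<longrightarrow> z \<le> Phi p \<xi> 0"
proof (cases "z = 0")
  case False
  have AE_less: "AE \<xi> in lborel. \<xi> \<in> shear_cone \<longrightarrow> u \<le> Phi p \<xi> 0" if "u < z" for u
  proof -
    from that assms have "u < L_inf p" by simp
    then obtain w where w: "u < w" "AE \<xi> in restrict_space lborel shear_cone. w \<le> Phi p \<xi> 0"
      unfolding L_inf_def essinf_def less_Sup_iff by blast
    from w(2) show ?thesis
      unfolding AE_restrict_shear_cone by eventually_elim (use w(1) in auto)
  qed
  obtain u :: "nat \<Rightarrow> ennreal" where u: "\<And>n. u n < z" "u \<longlonglongrightarrow> z"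
    using approx_from_below_dense_linorder[of 0 z] False by (auto simp: zero_less_iff_neq_zero)
  have "AE \<xi> in lborel. \<forall>n. \<xi> \<in> shear_cone \<longrightarrow> u n \<le> Phi p \<xi> 0"
    by (subst AE_all_countable) (intro allI AE_less u(1))
  then show ?thesis
    by eventually_elim (use u(2) in \<open>auto intro: LIMSEQ_le_const2\<close>)
qed auto

lemma nn_integral_Phi:
  assumes [measurable]: "p \<in> borel_measurable borel" "g \<in> borel_measurable borel"
  shows "(\<integral>\<^sup>+a. \<integral>\<^sup>+\<xi>. ennreal ((cmod (g \<xi>))\<^sup>2) * ennreal (cmod (p (cone_mat a *v \<xi>)) * cmod (p (cone_mat a *v \<xi> + \<omega>))) \<partial>lborel \<partial>count_space cone_index) =
    (\<integral>\<^sup>+\<xi>. ennreal ((cmod (g \<xi>))\<^sup>2) * Phi p \<xi> \<omega> \<partial>lborel)"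
  unfolding Phi_eq_nn_integral
  by (subst nn_integral_count_swap[symmetric])
     (auto simp: nn_integral_cmult intro: lborel.sigma_finite_measure_axioms)

lemma nn_integral_Phi_le:
  assumes [measurable]: "p \<in> borel_measurable borel" "g \<in> borel_measurable borel"
    and g: "AE \<xi> in lborel. \<xi> \<notin> shear_cone \<longrightarrow> g \<xi> = 0"
    and le: "AE \<xi> in lborel. \<xi> \<in> shear_cone \<longrightarrow> Phi p \<xi> \<omega> \<le> z"
  shows "(\<integral>\<^sup>+\<xi>. ennreal ((cmod (g \<xi>))\<^sup>2) * Phi p \<xi> \<omega> \<partial>lborel) \<le> z * sq_integral lborel g"
proof -
  have "(\<integral>\<^sup>+\<xi>. ennreal ((cmod (g \<xi>))\<^sup>2) * Phi p \<xi> \<omega> \<partial>lborel) \<le> (\<integral>\<^sup>+\<xi>. z * ennreal ((cmod (g \<xi>))\<^sup>2) \<partial>lborel)"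
  proof (rule nn_integral_mono_AE, use g le in eventually_elim)
    case (elim \<xi>)
    show ?case
    proof (cases "\<xi> \<in> shear_cone")
      case True
      then show ?thesis using elim by (subst mult.commute) (auto intro: mult_right_mono)
    qed (use elim in auto)
  qed
  then show ?thesis by (simp add: nn_integral_cmult)
qed

lemma nn_integral_Phi_ge:
  assumes [measurable]: "p \<in> borel_measurable borel" "g \<in> borel_measurable borel"
    and g: "AE \<xi> in lborel. \<xi> \<notin> shear_cone \<longrightarrow> g \<xi> = 0"
    and ge: "AE \<xi> in lborel. \<xi> \<in> shear_cone \<longrightarrow> z \<le> Phi p \<xi> \<omega>"
  shows "z * sq_integral lborel g \<le> (\<integral>\<^sup>+\<xi>. ennreal ((cmod (g \<xi>))\<^sup>2) * Phi p \<xi> \<omega> \<partial>lborel)"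
proof -
  have "(\<integral>\<^sup>+\<xi>. z * ennreal ((cmod (g \<xi>))\<^sup>2) \<partial>lborel) \<le> (\<integral>\<^sup>+\<xi>. ennreal ((cmod (g \<xi>))\<^sup>2) * Phi p \<xi> \<omega> \<partial>lborel)"
  proof (rule nn_integral_mono_AE, use g ge in eventually_elim)
    case (elim \<xi>)
    show ?case
    proof (cases "\<xi> \<in> shear_cone")
      case True
      then show ?thesis using elim by (subst mult.commute) (auto intro: mult_left_mono)
    qed (use elim in auto)
  qed
  then show ?thesis by (simp add: nn_integral_cmult)
qed

text \<open>Cauchy-Schwarz over all pairs of an index \<open>a\<close> and a frequency \<open>\<xi>\<close>; the translation by
  \<open>- (matrix_inv (cone_mat a) *v \<omega>)\<close> in the second factor is what produces \<open>\<Gamma>(- \<omega>)\<close>.\<close>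

lemma cross_term_le:
  fixes p g :: "real^2 \<Rightarrow> complex"
  assumes [measurable]: "p \<in> borel_measurable borel" "g \<in> borel_measurable borel"
    and g: "AE \<xi> in lborel. \<xi> \<notin> shear_cone \<longrightarrow> g \<xi> = 0"
    and fin: "Gamma_sup p \<omega> < \<infinity>" "Gamma_sup p (- \<omega>) < \<infinity>" "sq_integral lborel g < \<infinity>"
  shows "(\<integral>\<^sup>+a. \<integral>\<^sup>+\<xi>. ennreal (cmod (g \<xi>) * cmod (g (\<xi> + matrix_inv (cone_mat a) *v \<omega>)) *
      (cmod (p (cone_mat a *v \<xi>)) * cmod (p (cone_mat a *v \<xi> + \<omega>)))) \<partial>lborel \<partial>count_space cone_index)
    \<le> ennreal_sqrt (Gamma_sup p \<omega> * Gamma_sup p (- \<omega>)) * sq_integral lborel g"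
proof -
  interpret C: pair_sigma_finite "count_space cone_index" "lborel :: (real^2) measure"
    by (auto simp: pair_sigma_finite_def intro: sigma_finite_measure_count_space_countable lborel.sigma_finite_measure_axioms)
  let ?M = "count_space cone_index \<Otimes>\<^sub>M (lborel :: (real^2) measure)"
  \<comment> \<open>The weight formed by the two values of \<open>p\<close> is divided evenly
    between the two Cauchy-Schwarz factors.\<close>
  define w where "w a \<xi> = sqrt (cmod (p (cone_mat a *v \<xi>)) * cmod (p (cone_mat a *v \<xi> + \<omega>)))" for a \<xi>
  define u where "u a \<xi> = ennreal (cmod (g \<xi>) * w a \<xi>)" for a \<xi>
  define v where "v a \<xi> = ennreal (cmod (g (\<xi> + matrix_inv (cone_mat a) *v \<omega>)) * w a \<xi>)" for a \<xi>
  have w2: "w a \<xi> * w a \<xi> = cmod (p (cone_mat a *v \<xi>)) * cmod (p (cone_mat a *v \<xi> + \<omega>))" "w a \<xi> \<ge> 0" for a \<xi>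
    by (simp_all add: w_def)
  have [measurable]: "w a \<in> borel_measurable borel" for a unfolding w_def by measurable
  have [measurable]: "u a \<in> borel_measurable borel" "v a \<in> borel_measurable borel" for a
    unfolding u_def v_def by measurable
  have [measurable]: "(\<lambda>z. u (fst z) (snd z)) \<in> borel_measurable ?M" "(\<lambda>z. v (fst z) (snd z)) \<in> borel_measurable ?M"
    by (intro measurable_pair_measure_countable1; simp)+
  define G where "G = sq_integral lborel g"
  have iterate: "(\<integral>\<^sup>+z. f (fst z) (snd z) \<partial>?M) = (\<integral>\<^sup>+a. \<integral>\<^sup>+\<xi>. f a \<xi> \<partial>lborel \<partial>count_space cone_index)"
    if "(\<lambda>z. f (fst z) (snd z)) \<in> borel_measurable ?M" for f :: "nat \<times> int \<Rightarrow> real^2 \<Rightarrow> ennreal"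
    using lborel.nn_integral_fst[OF that] by simp
  have u2: "(\<integral>\<^sup>+z. (u (fst z) (snd z))\<^sup>2 \<partial>?M) \<le> Gamma_sup p \<omega> * G"
  proof -
    have "(\<integral>\<^sup>+z. (u (fst z) (snd z))\<^sup>2 \<partial>?M) = (\<integral>\<^sup>+a. \<integral>\<^sup>+\<xi>. (u a \<xi>)\<^sup>2 \<partial>lborel \<partial>count_space cone_index)"
      by (rule iterate) measurable
    also have "\<dots> = (\<integral>\<^sup>+\<xi>. ennreal ((cmod (g \<xi>))\<^sup>2) * Phi p \<xi> \<omega> \<partial>lborel)"
      unfolding nn_integral_Phi[OF assms(1,2), symmetric]
      by (intro nn_integral_cong)
         (simp add: u_def w2 ennreal_power ennreal_mult power_mult_distrib power2_eq_square[of "w _ _"] w2)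
    also have "\<dots> \<le> Gamma_sup p \<omega> * G"
      unfolding G_def by (intro nn_integral_Phi_le g AE_Phi_le_Gamma) measurable
    finally show ?thesis .
  qed
  have v2: "(\<integral>\<^sup>+z. (v (fst z) (snd z))\<^sup>2 \<partial>?M) \<le> Gamma_sup p (- \<omega>) * G"
  proof -
    have "(\<integral>\<^sup>+z. (v (fst z) (snd z))\<^sup>2 \<partial>?M) = (\<integral>\<^sup>+a. \<integral>\<^sup>+\<xi>. (v a \<xi>)\<^sup>2 \<partial>lborel \<partial>count_space cone_index)"
      by (rule iterate) measurable
    also have "\<dots> = (\<integral>\<^sup>+\<xi>. ennreal ((cmod (g \<xi>))\<^sup>2) * Phi p \<xi> (- \<omega>) \<partial>lborel)"
      unfolding nn_integral_Phi[OF assms(1,2), symmetric]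
    proof (rule nn_integral_cong)
      fix a
      let ?s = "matrix_inv (cone_mat a) *v \<omega>"
      have det: "det (cone_mat a) \<noteq> 0" using det_cone_mat_pos[of a] by simp
      have "(\<integral>\<^sup>+\<xi>. (v a \<xi>)\<^sup>2 \<partial>lborel) = (\<integral>\<^sup>+\<xi>. (v a (\<xi> + (- ?s)))\<^sup>2 \<partial>lborel)"
        by (rule nn_integral_lborel_translate[symmetric]) measurable
      also have "\<dots> = (\<integral>\<^sup>+\<xi>. ennreal ((cmod (g \<xi>))\<^sup>2) * ennreal (cmod (p (cone_mat a *v \<xi>)) * cmod (p (cone_mat a *v \<xi> + - \<omega>))) \<partial>lborel)"
      proof (rule nn_integral_cong)
        fix \<xi>
        \<comment> \<open>After the translation the two arguments of \<open>p\<close> are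
          \<open>cone_mat a *v \<xi> - \<omega>\<close> and \<open>cone_mat a *v \<xi>\<close>: the
          same product with \<open>- \<omega>\<close> in place of \<open>\<omega>\<close>.\<close>
        have "cone_mat a *v (\<xi> + - ?s) = cone_mat a *v \<xi> + - \<omega>"
          using matrix_inv_mult(1)[OF det, of \<omega>] by (simp add: matrix_vector_mult_diff_distrib)
        then have "w a (\<xi> + - ?s) * w a (\<xi> + - ?s) = cmod (p (cone_mat a *v \<xi>)) * cmod (p (cone_mat a *v \<xi> + - \<omega>))"
          unfolding w2 by simp
        then show "(v a (\<xi> + (- ?s)))\<^sup>2 = ennreal ((cmod (g \<xi>))\<^sup>2) * ennreal (cmod (p (cone_mat a *v \<xi>)) * cmod (p (cone_mat a *v \<xi> + - \<omega>)))"
          using w2(2)[of a "\<xi> + - ?s"]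
          by (simp add: v_def ennreal_power ennreal_mult power_mult_distrib power2_eq_square[of "w _ _"])
      qed
      finally show "(\<integral>\<^sup>+\<xi>. (v a \<xi>)\<^sup>2 \<partial>lborel) =
        (\<integral>\<^sup>+\<xi>. ennreal ((cmod (g \<xi>))\<^sup>2) * ennreal (cmod (p (cone_mat a *v \<xi>)) * cmod (p (cone_mat a *v \<xi> + - \<omega>))) \<partial>lborel)" .
    qed
    also have "\<dots> \<le> Gamma_sup p (- \<omega>) * G"
      unfolding G_def by (intro nn_integral_Phi_le g AE_Phi_le_Gamma) measurable
    finally show ?thesis .
  qed
  let ?I = "\<integral>\<^sup>+z. u (fst z) (snd z) * v (fst z) (snd z) \<partial>?M"
  have "(\<integral>\<^sup>+a. \<integral>\<^sup>+\<xi>. ennreal (cmod (g \<xi>) * cmod (g (\<xi> + matrix_inv (cone_mat a) *v \<omega>)) *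
      (cmod (p (cone_mat a *v \<xi>)) * cmod (p (cone_mat a *v \<xi> + \<omega>)))) \<partial>lborel \<partial>count_space cone_index) =
      (\<integral>\<^sup>+a. \<integral>\<^sup>+\<xi>. u a \<xi> * v a \<xi> \<partial>lborel \<partial>count_space cone_index)"
    unfolding w2(1)[symmetric]
    by (intro nn_integral_cong) (simp add: u_def v_def w2 ennreal_mult'[symmetric] mult_ac)
  also have "\<dots> = ?I" by (rule iterate[symmetric]) measurable
  finally have I: "(\<integral>\<^sup>+a. \<integral>\<^sup>+\<xi>. ennreal (cmod (g \<xi>) * cmod (g (\<xi> + matrix_inv (cone_mat a) *v \<omega>)) *
      (cmod (p (cone_mat a *v \<xi>)) * cmod (p (cone_mat a *v \<xi> + \<omega>)))) \<partial>lborel \<partial>count_space cone_index) = ?I" .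
  obtain x where x: "Gamma_sup p \<omega> = ennreal x" "x \<ge> 0" using fin(1) by (cases "Gamma_sup p \<omega>") auto
  obtain y where y: "Gamma_sup p (- \<omega>) = ennreal y" "y \<ge> 0" using fin(2) by (cases "Gamma_sup p (- \<omega>)") auto
  obtain h where h: "G = ennreal h" "h \<ge> 0" using fin(3) unfolding G_def[symmetric] by (cases G) auto
  have "?I\<^sup>2 \<le> (\<integral>\<^sup>+z. (u (fst z) (snd z))\<^sup>2 \<partial>?M) * (\<integral>\<^sup>+z. (v (fst z) (snd z))\<^sup>2 \<partial>?M)"
    by (rule Cauchy_Schwarz_nn_integral) measurable
  also have "\<dots> \<le> (Gamma_sup p \<omega> * G) * (Gamma_sup p (- \<omega>) * G)"
    by (rule mult_mono[OF u2 v2]) auto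
  also have "\<dots> = ennreal ((sqrt (x * y) * h)\<^sup>2)"
    using x y h by (simp add: power_mult_distrib power2_eq_square[of h] ennreal_mult[symmetric] mult_ac)
  finally have I2: "?I\<^sup>2 \<le> ennreal ((sqrt (x * y) * h)\<^sup>2)" .
  have "?I \<le> ennreal (sqrt (x * y) * h)"
  proof (cases ?I)
    case (real r)
    then have "ennreal (r\<^sup>2) \<le> ennreal ((sqrt (x * y) * h)\<^sup>2)"
      using I2 by (simp only: ennreal_power)
    then have "r \<le> sqrt (x * y) * h"
      using x y h by (subst (asm) ennreal_le_iff) (auto intro: power2_le_imp_le)
    then show ?thesis unfolding real by (rule ennreal_leI)
  next
    case top
    have "top \<le> ennreal ((sqrt (x * y) * h)\<^sup>2)" using I2 unfolding top by (simp add: power2_eq_square)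
    then show ?thesis by (simp add: top_unique)
  qed
  also have "\<dots> = ennreal_sqrt (Gamma_sup p \<omega> * Gamma_sup p (- \<omega>)) * G"
    using x y h by (simp add: ennreal_sqrt_def ennreal_mult[symmetric])
  finally show ?thesis unfolding I G_def .
qed

lemma R_sum_eq_nn_integral:
  "R_sum p c = (\<integral>\<^sup>+m. ennreal_sqrt (Gamma_sup p (matrix_inv (samp_mat c) *v vec_of_int m) *
     Gamma_sup p (- (matrix_inv (samp_mat c) *v vec_of_int m))) \<partial>count_space (UNIV - {0}))"
  by (simp add: R_sum_def infsum_eq_nn_integral Let_def)

lemma matrix_inv_product:
  fixes A B :: "real^'n^'n"
  assumes "det A \<noteq> 0" "det B \<noteq> 0"
  shows "matrix_inv (A ** B) *v x = matrix_inv B *v (matrix_inv A *v x)"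
proof -
  have "(A ** B) *v (matrix_inv B *v (matrix_inv A *v x)) = x"
    using assms by (simp add: matrix_inv_mult flip: matrix_vector_mul_assoc)
  moreover have "det (A ** B) \<noteq> 0" using assms by (simp add: det_mul)
  ultimately show ?thesis using matrix_inv_mult(2) by metis
qed

text \<open>\<open>parseval_matrix_bounds\<close> summed over all scales and shears. Multiplying by
  the determinant of the sampling matrix avoids division; \<open>z\<close> is a finite stand-in for
  \<open>L_inf p\<close>.\<close>

lemma frame_sum_bounds:
  assumes p: "is_fourier_transform \<psi> p" and f: "f \<in> L2_cone" and c: "0 < c $ 1" "0 < c $ 2"
    and Gamma: "\<And>\<omega>. Gamma_sup p \<omega> < \<infinity>" and R: "R_sum p c < \<infinity>" and L: "L_sup p < \<infinity>"
  shows "ennreal \<bar>det (samp_mat c)\<bar> * frame_sum shearlet_index (shearlet \<psi> c) f \<le> (L_sup p + R_sum p c) * ennreal ((L2_norm f)\<^sup>2)"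
    and "z \<le> L_inf p \<Longrightarrow> z < \<infinity> \<Longrightarrow> z * ennreal ((L2_norm f)\<^sup>2) \<le>
      ennreal \<bar>det (samp_mat c)\<bar> * frame_sum shearlet_index (shearlet \<psi> c) f + R_sum p c * ennreal ((L2_norm f)\<^sup>2)"
proof -
  obtain g where ft: "is_fourier_transform f g" and "ess_support g \<subseteq> shear_cone"
    using f by (auto simp: L2_cone_def)
  then have supp: "AE \<xi> in lborel. \<xi> \<notin> shear_cone \<longrightarrow> g \<xi> = 0" by (intro ess_support_AE_zero)
  note [measurable] = is_fourier_transform_measurable[OF ft] is_fourier_transform_measurable[OF p]
  have sq: "square_integrable f" "square_integrable g" "square_integrable p"
    using ft p by (auto simp: is_fourier_transform_def)
  have norm: "sq_integral lborel g = ennreal ((L2_norm f)\<^sup>2)"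
    using is_fourier_transform_norm[OF ft] L2_norm_square[OF sq(1)] by simp
  let ?F = "ennreal ((L2_norm f)\<^sup>2)" and ?D = "ennreal \<bar>det (samp_mat c)\<bar>"
  have detM: "det (samp_mat c) \<noteq> 0" "det (samp_mat c) > 0" using c by (auto simp: det_samp_mat)
  have detT: "det (cone_mat a) \<noteq> 0" for a using det_cone_mat_pos[of a] by simp
  define G where "G a \<xi> = g \<xi> * cnj (p (cone_mat a *v \<xi>))" for a \<xi>
  define N where "N a = samp_mat c ** cone_mat a" for a
  define E where "E a = sq_integral lborel (G a)" for a
  define X where "X a = (\<integral>\<^sup>+l. \<integral>\<^sup>+\<xi>. ennreal (cmod (G a \<xi>) * cmod (G a (\<xi> + matrix_inv (N a) *v vec_of_int l))) \<partial>lborel \<partial>count_space (UNIV - {0}))" for a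
  define S where "S a = (sq_integral (count_space UNIV) (\<lambda>m. LINT \<xi>|lborel. G a \<xi> * chr (vec_of_int m \<bullet> (N a *v \<xi>))))" for a
  have [measurable]: "G a \<in> borel_measurable borel" for a unfolding G_def by measurable
  have detN: "det (N a) \<noteq> 0" for a using detM detT[of a] by (simp add: N_def det_mul)
  have intG: "integrable lborel (G a)" for a
    unfolding G_def using sq square_integrable_affine[OF detT, of p a 0]
    by (intro square_integrable_product) auto
  have E_total: "(\<integral>\<^sup>+a. E a \<partial>count_space cone_index) = (\<integral>\<^sup>+\<xi>. ennreal ((cmod (g \<xi>))\<^sup>2) * Phi p \<xi> 0 \<partial>lborel)"
    unfolding nn_integral_Phi[OF is_fourier_transform_measurable(2)[OF p] is_fourier_transform_measurable(2)[OF ft], symmetric]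
    by (rule nn_integral_cong)
       (simp add: E_def G_def norm_mult power_mult_distrib ennreal_mult power2_eq_square[of "cmod (p _)"])
  have X_total: "(\<integral>\<^sup>+a. X a \<partial>count_space cone_index) \<le> R_sum p c * ?F"
  proof -
    let ?w = "\<lambda>l. matrix_inv (samp_mat c) *v vec_of_int l"
    have shift: "cone_mat a *v (\<xi> + matrix_inv (cone_mat a) *v \<omega>) = cone_mat a *v \<xi> + \<omega>" for a \<xi> \<omega>
      using detT by (simp add: matrix_vector_right_distrib matrix_inv_mult)
    have "(\<integral>\<^sup>+a. X a \<partial>count_space cone_index) =
      (\<integral>\<^sup>+a. \<integral>\<^sup>+l. \<integral>\<^sup>+\<xi>. ennreal (cmod (g \<xi>) * cmod (g (\<xi> + matrix_inv (cone_mat a) *v ?w l)) *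
      (cmod (p (cone_mat a *v \<xi>)) * cmod (p (cone_mat a *v \<xi> + ?w l)))) \<partial>lborel \<partial>count_space (UNIV - {0}) \<partial>count_space cone_index)"
      unfolding X_def N_def
      by (intro nn_integral_cong) (simp add: matrix_inv_product[OF detM(1) detT] G_def norm_mult shift mult_ac)
    also have "\<dots> = (\<integral>\<^sup>+l. \<integral>\<^sup>+a. \<integral>\<^sup>+\<xi>. ennreal (cmod (g \<xi>) * cmod (g (\<xi> + matrix_inv (cone_mat a) *v ?w l)) *
      (cmod (p (cone_mat a *v \<xi>)) * cmod (p (cone_mat a *v \<xi> + ?w l)))) \<partial>lborel \<partial>count_space cone_index \<partial>count_space (UNIV - {0}))"
      by (rule nn_integral_count_swap) (auto intro: sigma_finite_measure_count_space_countable)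
    also have "\<dots> \<le> (\<integral>\<^sup>+l. ennreal_sqrt (Gamma_sup p (?w l) * Gamma_sup p (- ?w l)) * ?F \<partial>count_space (UNIV - {0}))"
      unfolding norm[symmetric]
      by (intro nn_integral_mono cross_term_le supp Gamma) (auto simp: norm)
    also have "\<dots> = R_sum p c * ?F"
      unfolding R_sum_eq_nn_integral by (rule nn_integral_multc) simp
    finally show ?thesis .
  qed
  have E_le: "(\<integral>\<^sup>+a. E a \<partial>count_space cone_index) \<le> L_sup p * ?F"
    unfolding E_total norm[symmetric] by (intro nn_integral_Phi_le supp AE_Phi_le_L_sup) measurable
  \<comment> \<open>Each scale and shear is bounded by the totals, which the finiteness of
    \<open>L_sup p\<close> and \<open>R_sum p c\<close> controls. This provides the hypothesis under
    which Parseval was proved.\<close>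
  have fin: "E a + X a < \<infinity>" if "a \<in> cone_index" for a
  proof -
    have "E a \<le> (\<integral>\<^sup>+a. E a \<partial>count_space cone_index)" "X a \<le> (\<integral>\<^sup>+a. X a \<partial>count_space cone_index)"
      using that by (auto intro: nn_integral_ge_point)
    then have "E a \<le> L_sup p * ?F" "X a \<le> R_sum p c * ?F" using E_le X_total by auto
    moreover have "L_sup p * ?F < \<infinity>" "R_sum p c * ?F < \<infinity>" using R L by (auto simp: ennreal_mult_less_top)
    ultimately show ?thesis by (auto intro: le_less_trans)
  qed
  \<comment> \<open>The normalization of the shearlets contributes \<open>det (cone_mat a)\<close>,
    which combines with the determinant of \<open>samp_mat c\<close> to that of
    \<open>N a\<close>.\<close>
  have W: "?D * frame_sum shearlet_index (shearlet \<psi> c) f = (\<integral>\<^sup>+a. ennreal \<bar>det (N a)\<bar> * S a \<partial>count_space cone_index)"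
  proof -
    have "frame_sum shearlet_index (shearlet \<psi> c) f = (\<integral>\<^sup>+a. ennreal (det (cone_mat a)) * S a \<partial>count_space cone_index)"
      unfolding frame_sum_shearlet_index shearlet_coefficient[OF ft p] S_def G_def N_def
      using det_cone_mat_pos by (simp add: ennreal_mult less_imp_le nn_integral_cmult)
    then have "?D * frame_sum shearlet_index (shearlet \<psi> c) f = (\<integral>\<^sup>+a. ?D * (ennreal (det (cone_mat a)) * S a) \<partial>count_space cone_index)"
      by (simp add: nn_integral_cmult)
    also have "\<dots> = (\<integral>\<^sup>+a. ennreal \<bar>det (N a)\<bar> * S a \<partial>count_space cone_index)"
    proof (rule nn_integral_cong)
      fix a
      have "?D * ennreal (det (cone_mat a)) = ennreal \<bar>det (N a)\<bar>"
        using det_cone_mat_pos[of a] detM by (simp add: N_def det_mul abs_mult ennreal_mult[symmetric])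
      then show "?D * (ennreal (det (cone_mat a)) * S a) = ennreal \<bar>det (N a)\<bar> * S a"
        by (simp add: mult.assoc[symmetric])
    qed
    finally show ?thesis .
  qed
  have bounds: "ennreal \<bar>det (N a)\<bar> * S a \<le> E a + X a" "E a \<le> ennreal \<bar>det (N a)\<bar> * S a + X a" if "a \<in> cone_index" for a
    using parseval_matrix_bounds[OF intG detN, of a] fin[OF that] unfolding E_def X_def S_def by auto
  have "?D * frame_sum shearlet_index (shearlet \<psi> c) f \<le> (\<integral>\<^sup>+a. E a + X a \<partial>count_space cone_index)"
    unfolding W by (intro nn_integral_mono bounds) simp
  also have "\<dots> = (\<integral>\<^sup>+a. E a \<partial>count_space cone_index) + (\<integral>\<^sup>+a. X a \<partial>count_space cone_index)"
    by (rule nn_integral_add) auto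
  also have "\<dots> \<le> (L_sup p + R_sum p c) * ?F"
    unfolding distrib_right by (intro add_mono E_le X_total)
  finally show "?D * frame_sum shearlet_index (shearlet \<psi> c) f \<le> (L_sup p + R_sum p c) * ?F" .
  assume z: "z \<le> L_inf p" "z < \<infinity>"
  have "z * ?F \<le> (\<integral>\<^sup>+a. E a \<partial>count_space cone_index)"
    unfolding E_total norm[symmetric] by (intro nn_integral_Phi_ge supp AE_Phi_ge z) measurable
  also have "\<dots> \<le> (\<integral>\<^sup>+a. ennreal \<bar>det (N a)\<bar> * S a + X a \<partial>count_space cone_index)"
    by (intro nn_integral_mono bounds) simp
  also have "\<dots> = ?D * frame_sum shearlet_index (shearlet \<psi> c) f + (\<integral>\<^sup>+a. X a \<partial>count_space cone_index)"
    unfolding W by (rule nn_integral_add) auto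
  also have "\<dots> \<le> ?D * frame_sum shearlet_index (shearlet \<psi> c) f + R_sum p c * ?F"
    by (intro add_left_mono X_total)
  finally show "z * ?F \<le> ?D * frame_sum shearlet_index (shearlet \<psi> c) f + R_sum p c * ?F" .
qed

section \<open>Summation over dilations and shears\<close>

text \<open>Both sums are telescoped against the bounded increasing function \<open>t / (1 + t)\<close>.\<close>

lemma sum_dyadic_le:
  assumes "t > 0"
  shows "(\<Sum>j<n. (t / 2 ^ j) / (1 + (t / 2 ^ j)\<^sup>2)) \<le> (4 :: real)"
proof -
  define g :: "real \<Rightarrow> real" where "g s = s / (1 + s)" for s
  have step: "s / (1 + s\<^sup>2) \<le> 4 * (g s - g (s / 2))" if "s > 0" for s
  proof -
    have "g s - g (s / 2) = s / ((1 + s) * (2 + s))"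
      using that by (simp add: g_def field_simps)
    \<comment> \<open>The right side minus the left side is 3(s - 1/2)^2 + 5/4.\<close>
    moreover have "(1 + s) * (2 + s) \<le> 4 * (1 + s\<^sup>2)"
    proof -
      have "0 \<le> (s - 1 / 2)\<^sup>2" by simp
      then show ?thesis by (simp add: power2_eq_square algebra_simps)
    qed
    then have "s / (4 * (1 + s\<^sup>2)) \<le> s / ((1 + s) * (2 + s))"
      using that by (intro divide_left_mono) (auto simp: add_pos_pos)
    moreover have "4 * (s / (4 * (1 + s\<^sup>2))) = s / (1 + s\<^sup>2)" by (subst times_divide_eq_right) (rule mult_divide_mult_cancel_left, simp)
    ultimately show ?thesis by (metis mult_left_mono zero_le_numeral)
  qed
  have "(\<Sum>j<n. (t / 2 ^ j) / (1 + (t / 2 ^ j)\<^sup>2)) \<le> 4 * (g t - g (t / 2 ^ n))"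
  proof (induction n)
    case (Suc n)
    have "(t / 2 ^ n) / (1 + (t / 2 ^ n)\<^sup>2) \<le> 4 * (g (t / 2 ^ n) - g (t / 2 ^ n / 2))"
      using assms by (intro step) auto
    with Suc show ?case by (simp add: mult.commute)
  qed simp
  also have "\<dots> \<le> 4 * (1 - 0)"
    using assms by (intro mult_left_mono diff_mono) (auto simp: g_def)
  finally show ?thesis by simp
qed

lemma sum_arithmetic_nat_le:
  assumes "x > 0"
  shows "(\<Sum>i<n. 1 / (1 + (real i * x)\<^sup>2)) \<le> 1 + 2 / x"
proof -
  define g :: "real \<Rightarrow> real" where "g s = s / (1 + s)" for s
  \<comment> \<open>Increments of \<open>g\<close> are compared with the terms from index 1 on; the
    term with index 0 is the summand 1 of the bound.\<close>
  have step: "1 / (1 + (real (Suc i) * x)\<^sup>2) \<le> 2 / x * (g (real (Suc i) * x) - g (real i * x))" for i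
  proof -
    define s where "s = real i * x"
    have s: "s \<ge> 0" "real (Suc i) * x = s + x" using assms by (auto simp: s_def algebra_simps)
    have "g (s + x) - g s = x / ((1 + s + x) * (1 + s))"
      using s assms by (simp add: g_def field_simps add_eq_0_iff)
    then have "2 / x * (g (s + x) - g s) = 2 / ((1 + s + x) * (1 + s))"
      using assms by simp
    moreover have "(1 + s + x) * (1 + s) \<le> 2 * (1 + (s + x)\<^sup>2)"
    proof -
      have "(1 + s + x) * (1 + s) \<le> (1 + s + x) * (1 + s + x)"
        using s assms by (intro mult_left_mono) auto
      also have "\<dots> \<le> 2 * (1 + (s + x)\<^sup>2)"
        using sum_squares_bound[of 1 "s + x"] by (simp add: power2_eq_square algebra_simps)
      finally show ?thesis .
    qed
    then have "2 / (2 * (1 + (s + x)\<^sup>2)) \<le> 2 / ((1 + s + x) * (1 + s))"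
      using s assms by (intro divide_left_mono) (auto simp: add_pos_nonneg)
    moreover have "2 / (2 * (1 + (s + x)\<^sup>2)) = 1 / (1 + (s + x)\<^sup>2)"
      using mult_divide_mult_cancel_left[of 2 1 "1 + (s + x)\<^sup>2"] by simp
    ultimately show ?thesis unfolding s s_def[symmetric] by metis
  qed
  have "(\<Sum>i<Suc n. 1 / (1 + (real i * x)\<^sup>2)) \<le> 1 + 2 / x * g (real n * x)" for n
  proof (induction n)
    case (Suc n)
    then show ?case using step[of n] unfolding sum.lessThan_Suc[of _ "Suc n"] right_diff_distrib by linarith
  qed (simp add: g_def)
  also have "1 + 2 / x * g (real n * x) \<le> 1 + 2 / x * 1" for n
    using assms by (intro add_left_mono mult_left_mono) (auto simp: g_def divide_le_eq add_pos_nonneg)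
  finally have "(\<Sum>i<Suc n. 1 / (1 + (real i * x)\<^sup>2)) \<le> 1 + 2 / x" by simp
  moreover have "0 \<le> 1 / (1 + (real n * x)\<^sup>2)" by simp
  ultimately show ?thesis unfolding sum.lessThan_Suc by linarith
qed

lemma finite_int_bound:
  assumes "finite S"
  shows "\<exists>N. \<forall>k\<in>S. \<bar>k\<bar> < int N"
proof (intro exI ballI)
  fix k assume "k \<in> S"
  then have "nat \<bar>k\<bar> \<le> (\<Sum>k\<in>S. nat \<bar>k\<bar>)" using assms by (intro member_le_sum) auto
  then show "\<bar>k\<bar> < int (Suc (\<Sum>k\<in>S. nat \<bar>k\<bar>))" by linarith
qed

text \<open>For k = i >= 0 the point k x + r is at least i x, and for k = -i - 1 its modulus is i x
  + (x - r), again at least i x. So both halves are dominated by the one-sided sum.\<close>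

lemma sum_arithmetic_int_le_aux:
  fixes x r :: real
  assumes S: "finite S" and x: "x > 0" and r: "0 \<le> r" "r < x"
  shows "(\<Sum>k\<in>S. 1 / (1 + (of_int k * x + r)\<^sup>2)) \<le> 2 + 4 / x"
proof -
  obtain N where N: "\<And>k. k \<in> S \<Longrightarrow> \<bar>k\<bar> < int N" using finite_int_bound[OF S] by blast
  have "(\<Sum>k\<in>S. 1 / (1 + (of_int k * x + r)\<^sup>2)) \<le>
    (\<Sum>k\<in>int ` {..<N} \<union> (\<lambda>i. - int i - 1) ` {..<N}. 1 / (1 + (of_int k * x + r)\<^sup>2))"
  proof (intro sum_mono2)
    show "S \<subseteq> int ` {..<N} \<union> (\<lambda>i. - int i - 1) ` {..<N}"
    proof
      fix k assume "k \<in> S"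
      show "k \<in> int ` {..<N} \<union> (\<lambda>i. - int i - 1) ` {..<N}"
      proof (cases "k \<ge> 0")
        case True
        then have "k \<in> int ` {..<N}" using N[OF \<open>k \<in> S\<close>] by (intro image_eqI[of _ _ "nat k"]) auto
        then show ?thesis by blast
      next
        case False
        then have "k \<in> (\<lambda>i. - int i - 1) ` {..<N}" using N[OF \<open>k \<in> S\<close>] by (intro image_eqI[of _ _ "nat (- k - 1)"]) auto
        then show ?thesis by blast
      qed
    qed
  qed auto
  also have "\<dots> \<le> (\<Sum>k\<in>int ` {..<N}. 1 / (1 + (of_int k * x + r)\<^sup>2)) + (\<Sum>k\<in>(\<lambda>i. - int i - 1) ` {..<N}. 1 / (1 + (of_int k * x + r)\<^sup>2))"
    by (subst sum.union_disjoint) auto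
  also have "(\<Sum>k\<in>int ` {..<N}. 1 / (1 + (of_int k * x + r)\<^sup>2)) = (\<Sum>i<N. 1 / (1 + (real i * x + r)\<^sup>2))"
    by (subst sum.reindex) auto
  also have "\<dots> \<le> (\<Sum>i<N. 1 / (1 + (real i * x)\<^sup>2))"
    using x r by (intro sum_mono divide_left_mono add_left_mono power_mono mult_pos_pos add_pos_nonneg) auto
  also have "\<dots> \<le> 1 + 2 / x" by (rule sum_arithmetic_nat_le[OF x])
  also have "(\<Sum>k\<in>(\<lambda>i. - int i - 1) ` {..<N}. 1 / (1 + (of_int k * x + r)\<^sup>2)) = (\<Sum>i<N. 1 / (1 + (of_int (- int i - 1) * x + r)\<^sup>2))"
    by (subst sum.reindex) (auto intro: inj_onI)
  also have "\<dots> \<le> (\<Sum>i<N. 1 / (1 + (real i * x)\<^sup>2))"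
  proof (intro sum_mono divide_left_mono add_left_mono mult_pos_pos add_pos_nonneg)
    fix i
    have "(of_int (- int i - 1) * x + r)\<^sup>2 = (real i * x + (x - r))\<^sup>2"
      by (simp add: power2_eq_square algebra_simps)
    moreover have "(real i * x)\<^sup>2 \<le> (real i * x + (x - r))\<^sup>2"
      using x r by (intro power_mono) auto
    ultimately show "(real i * x)\<^sup>2 \<le> (of_int (- int i - 1) * x + r)\<^sup>2" by simp
  qed auto
  also have "\<dots> \<le> 1 + 2 / x" by (rule sum_arithmetic_nat_le[OF x])
  finally show ?thesis by simp
qed

text \<open>Reduce \<open>y\<close> modulo \<open>x\<close> by shifting the summation index; a
  negative \<open>x\<close> is handled by reflecting it. The bound is uniform in \<open>y\<close>,
  and this is what makes the bound on \<open>Phi\<close> uniform in the second coordinate and in the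
  shift.\<close>

lemma sum_arithmetic_int_le:
  fixes x y :: real
  assumes S: "finite S" and x: "x \<noteq> 0"
  shows "(\<Sum>k\<in>S. 1 / (1 + (of_int k * x + y)\<^sup>2)) \<le> 2 + 4 / \<bar>x\<bar>"
proof -
  have pos: "(\<Sum>k\<in>S. 1 / (1 + (of_int k * x + y)\<^sup>2)) \<le> 2 + 4 / x" if S: "finite S" and x: "x > 0" for S and x :: real
  proof -
    define q where "q = \<lfloor>y / x\<rfloor>"
    define r where "r = y - of_int q * x"
    have "of_int q \<le> y / x" "y / x < of_int q + 1" unfolding q_def by linarith+
    then have r: "0 \<le> r" "r < x" using x by (auto simp: r_def field_simps)
    have "(\<Sum>k\<in>S. 1 / (1 + (of_int k * x + y)\<^sup>2)) = (\<Sum>k\<in>(\<lambda>k. k + q) ` S. 1 / (1 + (of_int k * x + r)\<^sup>2))"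
    proof (subst sum.reindex)
      have "of_int (k + q) * x + r = of_int k * x + y" for k by (simp add: r_def algebra_simps)
      then show "(\<Sum>k\<in>S. 1 / (1 + (of_int k * x + y)\<^sup>2)) = sum ((\<lambda>k. 1 / (1 + (of_int k * x + r)\<^sup>2)) \<circ> (\<lambda>k. k + q)) S"
        by (simp only: o_def)
    qed (auto intro: inj_onI)
    also have "\<dots> \<le> 2 + 4 / x" using S x r by (intro sum_arithmetic_int_le_aux) auto
    finally show ?thesis .
  qed
  show ?thesis
  proof (cases "x > 0")
    case False
    have "(\<Sum>k\<in>S. 1 / (1 + (of_int k * x + y)\<^sup>2)) = (\<Sum>k\<in>uminus ` S. 1 / (1 + (of_int k * (- x) + y)\<^sup>2))"
    proof (subst sum.reindex)
      have "of_int (- k) * (- x) + y = of_int k * x + y" for k by simp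
      then show "(\<Sum>k\<in>S. 1 / (1 + (of_int k * x + y)\<^sup>2)) = sum ((\<lambda>k. 1 / (1 + (of_int k * (- x) + y)\<^sup>2)) \<circ> uminus) S"
        by (simp only: o_def)
    qed (auto intro: inj_onI)
    also have "\<dots> \<le> 2 + 4 / (- x)" using S x False by (intro pos) auto
    finally show ?thesis using False by simp
  qed (use pos[OF S] in auto)
qed

section \<open>Weights that dominate the generator\<close>

definition freq_weight :: "real \<Rightarrow> real" where
  "freq_weight x = x\<^sup>2 / (1 + x\<^sup>2) ^ 3"

text \<open>Decay of order 4, as \<open>phi_hat\<close> has it. The weight
  \<open>freq_weight\<close> is this one times x^2 / (1 + x^2), which records a double zero of the
  high-pass filter at the origin.\<close>

definition decay_weight :: "real \<Rightarrow> real" where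
  "decay_weight y = 1 / (1 + y\<^sup>2)\<^sup>2"

lemma freq_weight_nonneg: "0 \<le> freq_weight x" and decay_weight_nonneg: "0 \<le> decay_weight y"
  by (simp_all add: freq_weight_def decay_weight_def)

lemma freq_weight_le_1: "freq_weight x \<le> 1"
proof -
  have "x\<^sup>2 \<le> (1 + x\<^sup>2) ^ 1" by simp
  also have "\<dots> \<le> (1 + x\<^sup>2) ^ 3" by (rule power_increasing) auto
  finally show ?thesis
    unfolding freq_weight_def by (subst divide_le_eq_1_pos) (auto simp: add_pos_nonneg)
qed

lemma decay_weight_le: "decay_weight y \<le> 1 / (1 + y\<^sup>2)" "decay_weight y \<le> 1"
proof -
  have "(1 + y\<^sup>2) ^ 1 \<le> (1 + y\<^sup>2)\<^sup>2" by (rule power_increasing) auto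
  then show *: "decay_weight y \<le> 1 / (1 + y\<^sup>2)"
    unfolding decay_weight_def
    by (intro divide_left_mono mult_pos_pos zero_less_power) (auto simp: add_pos_nonneg)
  have "1 / (1 + y\<^sup>2) \<le> 1" by (subst divide_le_eq_1_pos) (auto simp: add_pos_nonneg)
  with * show "decay_weight y \<le> 1" by linarith
qed

lemma cube_mult_decay_weight_le: "\<bar>y\<bar> ^ 3 * decay_weight y \<le> 1"
proof -
  define a where "a = \<bar>y\<bar>"
  have a: "a \<ge> 0" "y\<^sup>2 = a\<^sup>2" by (auto simp: a_def)
  \<comment> \<open>The expression equals (1 + a^2)^2 - a^3.\<close>
  have "0 \<le> (a\<^sup>2 - a / 2)\<^sup>2 + 7 / 4 * a\<^sup>2 + 1" by simp
  then have "a ^ 3 \<le> (1 + a\<^sup>2)\<^sup>2" by (simp add: power2_eq_square power3_eq_cube algebra_simps)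
  then show ?thesis unfolding decay_weight_def a a_def[symmetric] by (simp add: divide_le_eq)
qed

lemma cube_mult_freq_weight_le: "\<bar>x\<bar> ^ 3 * freq_weight x \<le> 1"
proof -
  have "x\<^sup>2 / (1 + x\<^sup>2) \<le> 1" by (subst divide_le_eq_1_pos) (auto simp: add_pos_nonneg)
  moreover have "freq_weight x = decay_weight x * (x\<^sup>2 / (1 + x\<^sup>2))"
    by (simp add: freq_weight_def decay_weight_def power3_eq_cube power2_eq_square)
  ultimately have "freq_weight x \<le> decay_weight x * 1"
    using decay_weight_nonneg[of x] by (metis mult_left_mono)
  then have "\<bar>x\<bar> ^ 3 * freq_weight x \<le> \<bar>x\<bar> ^ 3 * decay_weight x"
    by (intro mult_left_mono) auto
  then show ?thesis using cube_mult_decay_weight_le[of x] by linarith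
qed

lemma cube_le_of_half_le:
  fixes w y :: real
  assumes "\<bar>w\<bar> / 2 \<le> \<bar>y\<bar>"
  shows "\<bar>w\<bar> ^ 3 \<le> 8 * \<bar>y\<bar> ^ 3"
proof -
  have "\<bar>w\<bar> ^ 3 \<le> (2 * \<bar>y\<bar>) ^ 3" using assms by (intro power_mono) auto
  then show ?thesis by (simp add: power_mult_distrib)
qed

text \<open>One of |y| and |y + w| is at least |w|/2. The corresponding factor absorbs the cube of
  |w|, and the other one is left for the sum over the shears, which tolerates any offset.\<close>

lemma decay_weight_product_le:
  "\<bar>w\<bar> ^ 3 * (decay_weight y * decay_weight (y + w)) \<le> 8 * (1 / (1 + y\<^sup>2) + 1 / (1 + (y + w)\<^sup>2))"
proof -
  have main: "\<bar>w\<bar> ^ 3 * (decay_weight u * decay_weight v) \<le> 8 * (1 / (1 + v\<^sup>2))" if "\<bar>w\<bar> / 2 \<le> \<bar>u\<bar>" for u v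
  proof -
    have "\<bar>w\<bar> ^ 3 * decay_weight u \<le> 8 * \<bar>u\<bar> ^ 3 * decay_weight u"
      by (intro mult_right_mono cube_le_of_half_le that decay_weight_nonneg)
    also have "\<dots> \<le> 8" using cube_mult_decay_weight_le[of u] by simp
    finally have "\<bar>w\<bar> ^ 3 * decay_weight u * decay_weight v \<le> 8 * (1 / (1 + v\<^sup>2))"
      by (intro mult_mono decay_weight_le decay_weight_nonneg) auto
    then show ?thesis by (simp add: mult.assoc)
  qed
  have nn: "0 \<le> 1 / (1 + y\<^sup>2)" "0 \<le> 1 / (1 + (y + w)\<^sup>2)" by auto
  show ?thesis
  proof (cases "\<bar>w\<bar> / 2 \<le> \<bar>y\<bar>")
    case True
    from main[OF this, of "y + w"] nn show ?thesis by argo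
  next
    case False
    then have "\<bar>w\<bar> / 2 \<le> \<bar>y + w\<bar>" by linarith
    from main[OF this, of y] nn show ?thesis by (simp only: mult.commute[of "decay_weight y"]) argo
  qed
qed

text \<open>The same alternative, but here the remaining factor must be the one in \<open>x\<close>:
  as the scale varies, \<open>x\<close> runs through a dyadic sequence, while \<open>x + w\<close>
  accumulates at \<open>w\<close>, so the scales cannot be summed through it. Where |x| has to pay
  for the cube, the factor 1 + |x|^3 remains on the right.\<close>

lemma freq_weight_product_le:
  "\<bar>w\<bar> ^ 3 * (freq_weight x * freq_weight (x + w)) \<le> 8 * ((1 + \<bar>x\<bar> ^ 3) * freq_weight x)"
proof (cases "\<bar>w\<bar> / 2 \<le> \<bar>x\<bar>")
  case True
  have "\<bar>w\<bar> ^ 3 * (freq_weight x * freq_weight (x + w)) \<le> (8 * \<bar>x\<bar> ^ 3) * (freq_weight x * 1)"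
    by (intro mult_mono cube_le_of_half_le True mult_nonneg_nonneg freq_weight_nonneg freq_weight_le_1) auto
  also have "\<dots> \<le> 8 * ((1 + \<bar>x\<bar> ^ 3) * freq_weight x)"
    using freq_weight_nonneg[of x] by (simp add: algebra_simps)
  finally show ?thesis .
next
  case False
  then have half: "\<bar>w\<bar> / 2 \<le> \<bar>x + w\<bar>" by linarith
  have "\<bar>w\<bar> ^ 3 * freq_weight (x + w) \<le> (8 * \<bar>x + w\<bar> ^ 3) * freq_weight (x + w)"
    by (intro mult_right_mono cube_le_of_half_le half freq_weight_nonneg)
  also have "\<dots> \<le> 8" using cube_mult_freq_weight_le[of "x + w"] by simp
  finally have "(\<bar>w\<bar> ^ 3 * freq_weight (x + w)) * freq_weight x \<le> 8 * freq_weight x"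
    by (intro mult_right_mono freq_weight_nonneg)
  moreover have "0 \<le> \<bar>x\<bar> ^ 3 * freq_weight x" by (intro mult_nonneg_nonneg freq_weight_nonneg) auto
  ultimately show ?thesis by (simp add: algebra_simps)
qed

definition max_abs :: "real^2 \<Rightarrow> real" where
  "max_abs \<omega> = max \<bar>\<omega> $ 1\<bar> \<bar>\<omega> $ 2\<bar>"

text \<open>The cube is charged to the larger coordinate of \<open>\<omega>\<close>, while the other
  variable contributes its crude bound. The constant is 9 = 1 + 8, the 1 coming from the summand 1
  in \<open>1 + max_abs \<omega> ^ 3\<close>.\<close>

lemma weight_product_le:
  "(1 + max_abs \<omega> ^ 3) * (freq_weight x * freq_weight (x + \<omega> $ 1) * (decay_weight y * decay_weight (y + \<omega> $ 2)))
    \<le> 9 * ((1 + \<bar>x\<bar> ^ 3) * freq_weight x) * (1 / (1 + y\<^sup>2) + 1 / (1 + (y + \<omega> $ 2)\<^sup>2))"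
proof -
  let ?A = "freq_weight x * freq_weight (x + \<omega> $ 1)" and ?B = "decay_weight y * decay_weight (y + \<omega> $ 2)"
  let ?A' = "(1 + \<bar>x\<bar> ^ 3) * freq_weight x" and ?B' = "1 / (1 + y\<^sup>2) + 1 / (1 + (y + \<omega> $ 2)\<^sup>2)"
  have nn: "0 \<le> ?A" "0 \<le> ?B" "0 \<le> ?A'" "0 \<le> ?B'"
    by (auto intro!: mult_nonneg_nonneg add_nonneg_nonneg freq_weight_nonneg decay_weight_nonneg)
  have A: "?A \<le> ?A'"
  proof -
    have "?A \<le> freq_weight x * 1" by (intro mult_left_mono freq_weight_le_1 freq_weight_nonneg)
    moreover have "0 \<le> \<bar>x\<bar> ^ 3 * freq_weight x" by (intro mult_nonneg_nonneg freq_weight_nonneg) auto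
    ultimately show ?thesis by (simp add: algebra_simps)
  qed
  have B: "?B \<le> ?B'"
  proof -
    have "?B \<le> 1 / (1 + y\<^sup>2) * 1" by (intro mult_mono decay_weight_le decay_weight_nonneg) auto
    moreover have "0 \<le> 1 / (1 + (y + \<omega> $ 2)\<^sup>2)" by simp
    ultimately show ?thesis by linarith
  qed
  have 1: "?A * ?B \<le> ?A' * ?B'" by (intro mult_mono A B nn)
  have "max_abs \<omega> ^ 3 * (?A * ?B) \<le> 8 * (?A' * ?B')"
  proof (cases "\<bar>\<omega> $ 2\<bar> \<le> \<bar>\<omega> $ 1\<bar>")
    case True
    then have "max_abs \<omega> ^ 3 * (?A * ?B) = (\<bar>\<omega> $ 1\<bar> ^ 3 * ?A) * ?B" by (simp add: max_abs_def)
    also have "\<dots> \<le> (8 * ?A') * ?B'"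
      using nn by (intro mult_mono freq_weight_product_le B) auto
    finally show ?thesis by (simp only: mult.assoc)
  next
    case False
    then have "max_abs \<omega> ^ 3 * (?A * ?B) = ?A * (\<bar>\<omega> $ 2\<bar> ^ 3 * ?B)" by (simp add: max_abs_def)
    also have "\<dots> \<le> ?A' * (8 * ?B')"
      using nn by (intro mult_mono decay_weight_product_le A) (auto intro: mult_nonneg_nonneg)
    finally show ?thesis by (simp only: mult_ac)
  qed
  moreover have "(1 + max_abs \<omega> ^ 3) * (?A * ?B) = ?A * ?B + max_abs \<omega> ^ 3 * (?A * ?B)"
    by (subst distrib_right) simp
  moreover have "w \<le> 9 * v" if "u \<le> 8 * v" "w = z + u" "z \<le> v" for u v w z :: real
    using that by linarith
  ultimately have "(1 + max_abs \<omega> ^ 3) * (?A * ?B) \<le> 9 * (?A' * ?B')"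
    using 1 by blast
  then show ?thesis by (simp only: mult.assoc)
qed

text \<open>The factor 1 + 1/|x| is the cost of the sum over the shears, the right-hand side a term
  of \<open>sum_dyadic_le\<close>. Both sides are of order |x| near 0 and of order 1/|x| at
  infinity.\<close>

lemma freq_weight_dyadic_le:
  assumes "x \<noteq> 0"
  shows "(1 + \<bar>x\<bar> ^ 3) * freq_weight x * (1 + 1 / \<bar>x\<bar>) \<le> 2 * (\<bar>x\<bar> / (1 + \<bar>x\<bar>\<^sup>2))"
proof -
  define t where "t = \<bar>x\<bar>"
  have t: "t > 0" "x\<^sup>2 = t\<^sup>2" using assms by (auto simp: t_def)
  have ineq: "(1 + t ^ 3) * (t + 1) \<le> 2 * (1 + t\<^sup>2)\<^sup>2"
  proof -
    \<comment> \<open>The expression is the difference of the two sides of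
      \<open>ineq\<close>.\<close>
    have "0 \<le> (t\<^sup>2 - t / 2)\<^sup>2 + 15 / 4 * t\<^sup>2 - t + 1"
    proof -
      have "0 \<le> (t - 1 / 2)\<^sup>2" by simp
      then have "0 \<le> t\<^sup>2 - t + 1" by (simp add: power2_eq_square algebra_simps)
      moreover have "0 \<le> 11 / 4 * t\<^sup>2" "0 \<le> (t\<^sup>2 - t / 2)\<^sup>2" by auto
      ultimately show ?thesis by linarith
    qed
    then show ?thesis by (simp add: power2_eq_square power3_eq_cube algebra_simps)
  qed
  have "(1 + t ^ 3) * freq_weight x * (1 + 1 / t) = ((1 + t ^ 3) * (t + 1)) * (t / (1 + t\<^sup>2) ^ 3)"
  proof -
    have "t\<^sup>2 * (1 + 1 / t) = (t + 1) * t" using t by (simp add: field_simps power2_eq_square)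
    then have "(1 + t ^ 3) * (t\<^sup>2 * (1 + 1 / t)) / (1 + t\<^sup>2) ^ 3 = (1 + t ^ 3) * ((t + 1) * t) / (1 + t\<^sup>2) ^ 3"
      by simp
    then show ?thesis unfolding freq_weight_def t by (simp add: mult_ac)
  qed
  also have "\<dots> \<le> (2 * (1 + t\<^sup>2)\<^sup>2) * (t / (1 + t\<^sup>2) ^ 3)"
    using t by (intro mult_right_mono ineq) auto
  also have "\<dots> = 2 * (t / (1 + t\<^sup>2))"
  proof -
    have "1 + t\<^sup>2 > 0" by (simp add: add_pos_nonneg)
    then have "1 + t\<^sup>2 \<noteq> 0" by linarith
    then show ?thesis by (simp add: power2_eq_square[of "1 + t\<^sup>2"] power3_eq_cube)
  qed
  finally show ?thesis by (simp add: t_def)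
qed

text \<open>The constant is 576 = 9 * 8 * 2 * 4: 9 from \<open>weight_product_le\<close>, 8 from the
  two sums over shears, each at most 4(1 + 1/|x|), 2 from \<open>freq_weight_dyadic_le\<close> and 4
  from the sum over the scales.\<close>

lemma Phi_le:
  assumes C: "C \<ge> 0" "\<And>\<eta>. cmod (p \<eta>) \<le> C * (freq_weight (\<eta> $ 1) * decay_weight (\<eta> $ 2))"
    and \<xi>: "\<xi> $ 1 \<noteq> 0"
  shows "Phi p \<xi> \<omega> \<le> ennreal (576 * C\<^sup>2 / (1 + max_abs \<omega> ^ 3))"
proof -
  define s where "s = 1 + max_abs \<omega> ^ 3"
  have s: "s > 0" unfolding s_def max_abs_def by (intro add_pos_nonneg zero_le_power) auto
  define a where "a j = (\<Sum>k\<in>shears j. cmod (p (cone_mat (j, k) *v \<xi>)) * cmod (p (cone_mat (j, k) *v \<xi> + \<omega>)))" for j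
  have a_nn: "a j \<ge> 0" for j unfolding a_def by (intro sum_nonneg) auto
  have Phi: "Phi p \<xi> \<omega> = (\<Sum>j. ennreal (a j))"
    unfolding Phi_eq_nn_integral nn_integral_cone_index a_def by (simp add: sum_ennreal)
  have a_le: "s * a j \<le> 144 * C\<^sup>2 * ((\<bar>\<xi> $ 1\<bar> / 2 ^ j) / (1 + (\<bar>\<xi> $ 1\<bar> / 2 ^ j)\<^sup>2))" for j
  proof -
    define x where "x = \<xi> $ 1 / 2 ^ j"
    define y where "y k = of_int k * x + \<xi> $ 2 / sqrt (2 ^ j)" for k :: int
    have x: "x \<noteq> 0" using \<xi> by (simp add: x_def)
    have nth: "(cone_mat (j, k) *v \<xi>) $ 1 = x" "(cone_mat (j, k) *v \<xi>) $ 2 = y k" for k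
      by (simp_all add: cone_mat_nth x_def y_def)
    let ?A' = "(1 + \<bar>x\<bar> ^ 3) * freq_weight x"
    have A'nn: "?A' \<ge> 0" by (intro mult_nonneg_nonneg freq_weight_nonneg) auto
    have term_le: "s * (cmod (p (cone_mat (j, k) *v \<xi>)) * cmod (p (cone_mat (j, k) *v \<xi> + \<omega>))) \<le>
      C\<^sup>2 * (9 * ?A' * (1 / (1 + (y k)\<^sup>2) + 1 / (1 + (y k + \<omega> $ 2)\<^sup>2)))" for k
    proof -
      have "cmod (p (cone_mat (j, k) *v \<xi>)) * cmod (p (cone_mat (j, k) *v \<xi> + \<omega>)) \<le>
         (C * (freq_weight x * decay_weight (y k))) * (C * (freq_weight (x + \<omega> $ 1) * decay_weight (y k + \<omega> $ 2)))"
        using C(2)[of "cone_mat (j, k) *v \<xi>"] C(2)[of "cone_mat (j, k) *v \<xi> + \<omega>"] C(1)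
        unfolding vector_add_component nth
        by (intro mult_mono) (auto intro!: mult_nonneg_nonneg freq_weight_nonneg decay_weight_nonneg)
      then have "s * (cmod (p (cone_mat (j, k) *v \<xi>)) * cmod (p (cone_mat (j, k) *v \<xi> + \<omega>))) \<le>
        s * ((C * (freq_weight x * decay_weight (y k))) * (C * (freq_weight (x + \<omega> $ 1) * decay_weight (y k + \<omega> $ 2))))"
        using s by (intro mult_left_mono) auto
      also have "\<dots> = C\<^sup>2 * (s * (freq_weight x * freq_weight (x + \<omega> $ 1) * (decay_weight (y k) * decay_weight (y k + \<omega> $ 2))))"
        by (simp add: power2_eq_square mult_ac)
      also have "\<dots> \<le> C\<^sup>2 * (9 * ?A' * (1 / (1 + (y k)\<^sup>2) + 1 / (1 + (y k + \<omega> $ 2)\<^sup>2)))"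
        unfolding s_def by (intro mult_left_mono weight_product_le) auto
      finally show ?thesis .
    qed
    have "s * a j \<le> (\<Sum>k\<in>shears j. C\<^sup>2 * (9 * ?A' * (1 / (1 + (y k)\<^sup>2) + 1 / (1 + (y k + \<omega> $ 2)\<^sup>2))))"
      unfolding a_def sum_distrib_left by (intro sum_mono term_le)
    also have "\<dots> = C\<^sup>2 * (9 * ?A' * ((\<Sum>k\<in>shears j. 1 / (1 + (y k)\<^sup>2)) + (\<Sum>k\<in>shears j. 1 / (1 + (y k + \<omega> $ 2)\<^sup>2))))"
      by (simp only: sum_distrib_left sum.distrib distrib_left)
    also have "\<dots> \<le> C\<^sup>2 * (9 * ?A' * ((2 + 4 / \<bar>x\<bar>) + (2 + 4 / \<bar>x\<bar>)))"
    proof (intro mult_left_mono add_mono)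
      show "(\<Sum>k\<in>shears j. 1 / (1 + (y k)\<^sup>2)) \<le> 2 + 4 / \<bar>x\<bar>"
        unfolding y_def by (rule sum_arithmetic_int_le[OF finite_shears x])
      show "(\<Sum>k\<in>shears j. 1 / (1 + (y k + \<omega> $ 2)\<^sup>2)) \<le> 2 + 4 / \<bar>x\<bar>"
        unfolding y_def add.assoc by (rule sum_arithmetic_int_le[OF finite_shears x])
    qed (use A'nn in auto)
    also have "\<dots> \<le> C\<^sup>2 * (9 * ?A' * (8 * (1 + 1 / \<bar>x\<bar>)))"
      using A'nn by (intro mult_left_mono) auto
    also have "\<dots> = C\<^sup>2 * 72 * (?A' * (1 + 1 / \<bar>x\<bar>))" by (simp only: mult_ac) simp
    also have "\<dots> \<le> C\<^sup>2 * 72 * (2 * (\<bar>x\<bar> / (1 + \<bar>x\<bar>\<^sup>2)))"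
      by (intro mult_left_mono freq_weight_dyadic_le x) auto
    finally show ?thesis by (simp add: x_def abs_divide)
  qed
  have partial: "(\<Sum>j<n. ennreal (a j)) \<le> ennreal (576 * C\<^sup>2 / s)" for n
  proof -
    have "s * (\<Sum>j<n. a j) \<le> (\<Sum>j<n. 144 * C\<^sup>2 * ((\<bar>\<xi> $ 1\<bar> / 2 ^ j) / (1 + (\<bar>\<xi> $ 1\<bar> / 2 ^ j)\<^sup>2)))"
      unfolding sum_distrib_left by (intro sum_mono a_le)
    also have "\<dots> = 144 * C\<^sup>2 * (\<Sum>j<n. (\<bar>\<xi> $ 1\<bar> / 2 ^ j) / (1 + (\<bar>\<xi> $ 1\<bar> / 2 ^ j)\<^sup>2))"
      by (rule sum_distrib_left[symmetric])
    also have "\<dots> \<le> 144 * C\<^sup>2 * 4"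
      using \<xi> by (intro mult_left_mono sum_dyadic_le) auto
    finally have "(\<Sum>j<n. a j) \<le> 576 * C\<^sup>2 / s" using s by (simp add: field_simps)
    then show ?thesis using a_nn by (simp add: sum_ennreal ennreal_leI)
  qed
  have "(\<Sum>j. ennreal (a j)) = (SUP n. \<Sum>j<n. ennreal (a j))" by (rule suminf_eq_SUP)
  also have "\<dots> \<le> ennreal (576 * C\<^sup>2 / s)" by (intro SUP_least partial)
  finally show ?thesis unfolding Phi s_def .
qed

lemma shear_cone_nonzero: "\<xi> \<in> shear_cone \<Longrightarrow> \<xi> $ 1 \<noteq> 0"
  by (auto simp: shear_cone_def)

lemma
  assumes [measurable]: "p \<in> borel_measurable borel" and C: "C \<ge> 0" "\<And>\<eta>. cmod (p \<eta>) \<le> C * (freq_weight (\<eta> $ 1) * decay_weight (\<eta> $ 2))"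
  shows Gamma_sup_le: "Gamma_sup p \<omega> \<le> ennreal (576 * C\<^sup>2 / (1 + max_abs \<omega> ^ 3))"
    and L_sup_le: "L_sup p \<le> ennreal (576 * C\<^sup>2)"
proof -
  have meas: "(\<lambda>\<xi>. Phi p \<xi> \<omega>) \<in> borel_measurable (restrict_space lborel shear_cone)" for \<omega>
    by (rule measurable_restrict_space1) simp
  show "Gamma_sup p \<omega> \<le> ennreal (576 * C\<^sup>2 / (1 + max_abs \<omega> ^ 3))"
    unfolding Gamma_sup_def
    by (rule esssup_I[OF meas]) (auto simp: AE_restrict_shear_cone intro!: AE_I2 Phi_le C dest: shear_cone_nonzero)
  have "Phi p \<xi> 0 \<le> ennreal (576 * C\<^sup>2)" if "\<xi> \<in> shear_cone" for \<xi>
    using Phi_le[OF C shear_cone_nonzero[OF that], of 0] by (simp add: max_abs_def)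
  then show "L_sup p \<le> ennreal (576 * C\<^sup>2)"
    unfolding L_sup_def by (intro esssup_I meas) (auto simp: AE_restrict_shear_cone)
qed

section \<open>The lattice sum and the size of R(c)\<close>

lemma nn_integral_int_powr_finite:
  "(\<integral>\<^sup>+k. ennreal ((1 + \<bar>of_int k\<bar>) powr (- 3 / 2)) \<partial>count_space (UNIV :: int set)) < \<infinity>"
proof -
  define h where "h n = (1 + real n) powr (- 3 / 2)" for n
  have "summable (\<lambda>n. real n powr (- 3 / 2))" by (simp add: summable_real_powr_iff)
  then have "summable (\<lambda>n. real (Suc n) powr (- 3 / 2))" by (rule summable_Suc_iff[THEN iffD2])
  then have h: "summable h" by (simp add: h_def[abs_def] add.commute)
  have h_nn: "h n \<ge> 0" for n by (simp add: h_def)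
  have "(\<Sum>k\<in>F. ennreal ((1 + \<bar>of_int k\<bar>) powr (- 3 / 2))) \<le> ennreal (2 * suminf h)" if F: "finite F" for F :: "int set"
  proof -
    obtain N where N: "\<And>k. k \<in> F \<Longrightarrow> \<bar>k\<bar> < int N" using finite_int_bound[OF F] by blast
    have sub: "F \<subseteq> int ` {..<N} \<union> (\<lambda>i. - int i) ` {..<N}"
    proof
      fix k assume "k \<in> F"
      show "k \<in> int ` {..<N} \<union> (\<lambda>i. - int i) ` {..<N}"
      proof (cases "k \<ge> 0")
        case True
        then have "k \<in> int ` {..<N}" using N[OF \<open>k \<in> F\<close>] by (intro image_eqI[of _ _ "nat k"]) auto
        then show ?thesis by blast
      next
        case False
        then have "k \<in> (\<lambda>i. - int i) ` {..<N}" using N[OF \<open>k \<in> F\<close>] by (intro image_eqI[of _ _ "nat (- k)"]) auto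
        then show ?thesis by blast
      qed
    qed
    let ?f = "\<lambda>k::int. (1 + \<bar>of_int k\<bar>) powr (- 3 / 2) :: real"
    have "(\<Sum>k\<in>F. ?f k) \<le> (\<Sum>k\<in>int ` {..<N} \<union> (\<lambda>i. - int i) ` {..<N}. ?f k)"
      by (intro sum_mono2 sub) auto
    also have "\<dots> \<le> (\<Sum>k\<in>int ` {..<N}. ?f k) + (\<Sum>k\<in>(\<lambda>i. - int i) ` {..<N}. ?f k)"
      using sum.union_inter[of "int ` {..<N}" "(\<lambda>i. - int i) ` {..<N}" ?f]
        sum_nonneg[of "int ` {..<N} \<inter> (\<lambda>i. - int i) ` {..<N}" ?f] by simp
    also have "\<dots> = (\<Sum>i<N. h i) + (\<Sum>i<N. h i)"
      by (subst (1 2) sum.reindex) (auto simp: h_def intro: inj_onI)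
    also have "\<dots> \<le> suminf h + suminf h"
      using h h_nn by (intro add_mono sum_le_suminf) auto
    finally have "(\<Sum>k\<in>F. ?f k) \<le> 2 * suminf h" by simp
    then show ?thesis by (subst sum_ennreal) (auto intro: ennreal_leI)
  qed
  then have "(\<integral>\<^sup>+k. ennreal ((1 + \<bar>of_int k\<bar>) powr (- 3 / 2)) \<partial>count_space (UNIV :: int set)) \<le> ennreal (2 * suminf h)"
    by (subst nn_integral_count_space_eq_SUP) (auto intro: SUP_least)
  then show ?thesis by (rule le_less_trans) simp
qed

text \<open>The maximum dominates both coordinates, so its inverse cube can be shared evenly between
  them, with the summable exponent 3/2 for each. The 8 is the cube of the 2 in 1 + |m_i| <=
  2M.\<close>

lemma nn_integral_lattice_cube_finite:
  "(\<integral>\<^sup>+m. ennreal (1 / max_abs (vec_of_int m) ^ 3) \<partial>count_space (UNIV - {0 :: int^2})) < \<infinity>"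
proof -
  let ?h = "\<lambda>k::int. (1 + \<bar>of_int k\<bar>) powr (- 3 / 2) :: real"
  let ?H = "\<integral>\<^sup>+k. ennreal (?h k) \<partial>count_space UNIV"
  have le: "1 / max_abs (vec_of_int m) ^ 3 \<le> 8 * (?h (m $ 1) * ?h (m $ 2))" if "m \<noteq> 0" for m :: "int^2"
  proof -
    define M where "M = max_abs (vec_of_int m)"
    have "m $ 1 \<noteq> 0 \<or> m $ 2 \<noteq> 0" using that by (auto simp: vec_eq_iff forall_2)
    then have M: "M \<ge> 1" unfolding M_def max_abs_def by (auto simp: le_max_iff_disj)
    have half: "(1 + \<bar>real_of_int (m $ i)\<bar>) \<le> 2 * M" if "i = 1 \<or> i = 2" for i
      using that M unfolding M_def max_abs_def by auto
    have "(2 * M) powr (- 3 / 2) \<le> ?h (m $ i)" if "i = 1 \<or> i = 2" for i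
      using half[OF that] by (intro powr_mono2') auto
    then have "(2 * M) powr (- 3 / 2) * (2 * M) powr (- 3 / 2) \<le> ?h (m $ 1) * ?h (m $ 2)"
      by (intro mult_mono) auto
    moreover have "(2 * M) powr (- 3 / 2) * (2 * M) powr (- 3 / 2) = 1 / (8 * M ^ 3)"
      using M by (simp add: powr_add[symmetric] powr_minus_divide powr_numeral power_mult_distrib)
    ultimately show ?thesis unfolding M_def by simp
  qed
  have "(\<integral>\<^sup>+m. ennreal (1 / max_abs (vec_of_int m) ^ 3) \<partial>count_space (UNIV - {0 :: int^2})) \<le>
     (\<integral>\<^sup>+m. ennreal (8 * (?h (m $ 1) * ?h (m $ 2))) \<partial>count_space (UNIV - {0 :: int^2}))"
    by (intro nn_integral_mono ennreal_leI le) auto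
  also have "\<dots> \<le> (\<integral>\<^sup>+m. ennreal (8 * (?h (m $ 1) * ?h (m $ 2))) \<partial>count_space (UNIV :: (int^2) set))"
    by (subst nn_integral_count_split[of UNIV 0]) auto
  also have "\<dots> = (\<integral>\<^sup>+a. \<integral>\<^sup>+b. 8 * (ennreal (?h a) * ennreal (?h b)) \<partial>count_space UNIV \<partial>count_space UNIV)"
    unfolding nn_integral_count_int2 by (simp add: ennreal_mult)
  also have "\<dots> = 8 * (?H * ?H)"
    by (simp add: nn_integral_cmult nn_integral_multc)
  also have "\<dots> < \<infinity>" using nn_integral_int_powr_finite by (simp add: ennreal_mult_less_top)
  finally show ?thesis .
qed

text \<open>As c_2 <= c_1, the point with \<open>samp_mat c *v \<omega> = vec_of_int m\<close> has
  maximum norm at least that of m divided by c_1. The decay of \<open>Gamma_sup\<close> therefore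
  yields the cube of c_1.\<close>

lemma R_sum_le:
  assumes [measurable]: "p \<in> borel_measurable borel" and C: "C \<ge> 0" "\<And>\<eta>. cmod (p \<eta>) \<le> C * (freq_weight (\<eta> $ 1) * decay_weight (\<eta> $ 2))"
    and c: "0 < c $ 1" "0 < c $ 2" "c $ 2 \<le> c $ 1"
  shows "R_sum p c \<le> ennreal (576 * C\<^sup>2 * (c $ 1) ^ 3) *
    (\<integral>\<^sup>+m. ennreal (1 / max_abs (vec_of_int m) ^ 3) \<partial>count_space (UNIV - {0 :: int^2}))"
proof -
  have det: "det (samp_mat c) \<noteq> 0" using c by (simp add: det_samp_mat)
  have "ennreal_sqrt (Gamma_sup p (matrix_inv (samp_mat c) *v vec_of_int m) * Gamma_sup p (- (matrix_inv (samp_mat c) *v vec_of_int m)))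
    \<le> ennreal (576 * C\<^sup>2 * (c $ 1) ^ 3) * ennreal (1 / max_abs (vec_of_int m) ^ 3)" if "m \<noteq> 0" for m :: "int^2"
  proof -
    define \<omega> where "\<omega> = matrix_inv (samp_mat c) *v vec_of_int m"
    have "samp_mat c *v \<omega> = vec_of_int m" unfolding \<omega>_def by (rule matrix_inv_mult[OF det])
    then have nth: "c $ 1 * \<omega> $ 1 = of_int (m $ 1)" "c $ 2 * \<omega> $ 2 = of_int (m $ 2)"
      using samp_mat_nth[of c \<omega>] by auto
    define s where "s = max_abs \<omega>"
    define M where "M = max_abs (vec_of_int m)"
    have "m $ 1 \<noteq> 0 \<or> m $ 2 \<noteq> 0" using that by (auto simp: vec_eq_iff forall_2)
    then have M: "M \<ge> 1" unfolding M_def max_abs_def by (auto simp: le_max_iff_disj)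
    have "M \<le> c $ 1 * s"
    proof -
      have "\<bar>of_int (m $ 1)\<bar> \<le> c $ 1 * s"
        unfolding nth[symmetric] abs_mult using c by (auto simp: s_def max_abs_def intro: mult_mono)
      moreover have "\<bar>of_int (m $ 2)\<bar> \<le> c $ 1 * s"
        unfolding nth[symmetric] abs_mult using c by (auto simp: s_def max_abs_def intro!: mult_mono)
      ultimately show ?thesis by (simp add: M_def max_abs_def)
    qed
    then have "M ^ 3 \<le> (c $ 1 * s) ^ 3" using M by (intro power_mono) auto
    then have M3: "M ^ 3 \<le> (c $ 1) ^ 3 * (1 + s ^ 3)"
      using c by (simp add: power_mult_distrib distrib_left add_increasing)
    have s: "0 \<le> s" by (simp add: s_def max_abs_def)
    define B where "B = 576 * C\<^sup>2 / (1 + s ^ 3)"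
    have B: "B \<ge> 0" using s by (simp add: B_def)
    \<comment> \<open>The bound depends on \<open>\<omega>\<close> only through
      \<open>max_abs\<close>, an even function, so one \<open>B\<close> serves both factors and also
      their geometric mean.\<close>
    have "Gamma_sup p \<omega> \<le> ennreal B" "Gamma_sup p (- \<omega>) \<le> ennreal B"
      using Gamma_sup_le[OF assms(1) C, of \<omega>] Gamma_sup_le[OF assms(1) C, of "- \<omega>"]
      by (simp_all add: B_def s_def max_abs_def)
    then have "Gamma_sup p \<omega> * Gamma_sup p (- \<omega>) \<le> ennreal B * ennreal B" by (intro mult_mono) auto
    also have "\<dots> = ennreal (B * B)" using B by (simp add: ennreal_mult)
    finally have le: "Gamma_sup p \<omega> * Gamma_sup p (- \<omega>) \<le> ennreal (B * B)" .
    then obtain r where r: "Gamma_sup p \<omega> * Gamma_sup p (- \<omega>) = ennreal r" "r \<ge> 0"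
      by (cases "Gamma_sup p \<omega> * Gamma_sup p (- \<omega>)") (auto simp: top_unique)
    have "r \<le> B * B" using le r B by (simp add: ennreal_le_iff)
    then have "sqrt r \<le> B" using B r by (intro real_le_lsqrt) (auto simp: power2_eq_square)
    then have "ennreal_sqrt (Gamma_sup p \<omega> * Gamma_sup p (- \<omega>)) \<le> ennreal B"
      unfolding r ennreal_sqrt_def using r by (auto intro: ennreal_leI)
    also have "B \<le> 576 * C\<^sup>2 * (c $ 1) ^ 3 * (1 / M ^ 3)"
    proof -
      have "1 / (1 + s ^ 3) \<le> (c $ 1) ^ 3 / M ^ 3"
        using M3 M s by (simp add: field_simps add_pos_nonneg)
      then have "576 * C\<^sup>2 * (1 / (1 + s ^ 3)) \<le> 576 * C\<^sup>2 * ((c $ 1) ^ 3 / M ^ 3)"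
        by (intro mult_left_mono) auto
      then show ?thesis by (simp add: B_def)
    qed
    then have "ennreal B \<le> ennreal (576 * C\<^sup>2 * (c $ 1) ^ 3) * ennreal (1 / M ^ 3)"
      using c M by (subst ennreal_mult[symmetric]) (auto intro: ennreal_leI)
    finally show ?thesis unfolding \<omega>_def M_def .
  qed
  then have "R_sum p c \<le> (\<integral>\<^sup>+m. ennreal (576 * C\<^sup>2 * (c $ 1) ^ 3) * ennreal (1 / max_abs (vec_of_int m) ^ 3) \<partial>count_space (UNIV - {0 :: int^2}))"
    unfolding R_sum_eq_nn_integral by (intro nn_integral_mono) auto
  then show ?thesis by (simp add: nn_integral_cmult)
qed

text \<open>Halve until the bound is met. At the first such \<open>n\<close> the previous value
  still exceeded \<open>b\<close>, unless no halving took place.\<close>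

lemma ex_dyadic:
  fixes y b :: real
  assumes "b > 0"
  shows "\<exists>n::nat. y / 2 ^ n \<le> b \<and> (n = 0 \<or> b / 2 < y / 2 ^ n)"
proof -
  have "\<exists>n. y / b < 2 ^ n" by (rule real_arch_pow) simp
  then obtain n0 :: nat where "y / b < 2 ^ n0" ..
  then have "y < 2 ^ n0 * b" using assms by (simp only: pos_divide_less_eq)
  then have ex: "y / 2 ^ n0 \<le> b" by (simp add: pos_divide_le_eq mult.commute)
  define n where "n = (LEAST n. y / 2 ^ n \<le> b)"
  have n: "y / 2 ^ n \<le> b" unfolding n_def by (rule LeastI[of "\<lambda>n. y / 2 ^ n \<le> b", OF ex])
  have "b / 2 < y / 2 ^ n" if "n \<noteq> 0"
  proof -
    from not0_implies_Suc[OF that] obtain k where k: "n = Suc k" ..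
    have "\<not> y / 2 ^ k \<le> b" by (rule not_less_Least[of k "\<lambda>n. y / 2 ^ n \<le> b"]) (unfold n_def[symmetric] k, rule lessI)
    then have "b / 2 < y / 2 ^ k / 2" by (intro divide_strict_right_mono) auto
    moreover have "y / 2 ^ n = y / 2 ^ k / 2" by (simp add: k)
    ultimately show ?thesis by (simp only:)
  qed
  with n show ?thesis by (intro exI[of _ n]) auto
qed

text \<open>Dyadic scaling reaches any interval whose endpoints have ratio 2; the interval from 1/12
  to 1/6 is the one on which \<open>psi_hat_lower\<close> controls the filters.\<close>

lemma L_inf_ge:
  assumes e: "e \<ge> 0" and lower: "\<And>\<eta>. 1 / 12 \<le> \<bar>\<eta> $ 1\<bar> \<Longrightarrow> \<bar>\<eta> $ 1\<bar> \<le> 1 / 6 \<Longrightarrow> 2 * \<bar>\<eta> $ 2\<bar> \<le> 1 / 6 \<Longrightarrow> e \<le> cmod (p \<eta>)"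
  shows "ennreal (e\<^sup>2) \<le> L_inf p"
proof -
  have "ennreal (e\<^sup>2) \<le> Phi p \<xi> 0" if \<xi>: "\<xi> \<in> shear_cone" for \<xi>
  proof -
    have \<xi>1: "\<bar>\<xi> $ 1\<bar> \<ge> 1" "\<bar>\<xi> $ 2 / \<xi> $ 1\<bar> \<le> 1" using \<xi> by (auto simp: shear_cone_def)
    obtain j :: nat where j: "\<bar>\<xi> $ 1\<bar> / 2 ^ j \<le> 1 / 6" "j = 0 \<or> (1 / 6) / 2 < \<bar>\<xi> $ 1\<bar> / 2 ^ j"
      using ex_dyadic[of "1 / 6" "\<bar>\<xi> $ 1\<bar>"] by auto
    \<comment> \<open>On the cone |\<xi>_1| >= 1, so at least one halving takes place and the lower
      estimate of \<open>ex_dyadic\<close> is available.\<close>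
    have "j \<noteq> 0"
    proof
      assume "j = 0"
      then show False using j(1) \<xi>1(1) by simp
    qed
    then have j': "1 / 12 \<le> \<bar>\<xi> $ 1\<bar> / 2 ^ j" using j by auto
    define v where "v = sqrt (2 ^ j) * (\<xi> $ 2 / \<xi> $ 1)"
    \<comment> \<open>The real shear \<open>- v\<close> would annihilate the second coordinate;
      rounding leaves at most half of the first one. On the cone |v| <= 2^(j/2), so that the rounded
      value belongs to \<open>shears j\<close>.\<close>
    define k where "k = - round v"
    have sq: "2 powr (real j / 2) = sqrt (2 ^ j)"
      by (simp add: powr_half_sqrt[symmetric] powr_realpow[symmetric] powr_powr)
    have "\<bar>v\<bar> = sqrt (2 ^ j) * \<bar>\<xi> $ 2 / \<xi> $ 1\<bar>" unfolding v_def abs_mult by simp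
    also have "\<dots> \<le> sqrt (2 ^ j)" using \<xi>1(2) by (intro mult_left_le) auto
    finally have "\<bar>v\<bar> \<le> sqrt (2 ^ j)" .
    then have "- of_int \<lceil>2 powr (real j / 2)\<rceil> \<le> v" "v \<le> of_int \<lceil>2 powr (real j / 2)\<rceil>"
      unfolding sq using le_of_int_ceiling[of "sqrt (2 ^ j) :: real"] by linarith+
    then have "of_int (- \<lceil>2 powr (real j / 2)\<rceil>) \<le> v" "v \<le> of_int \<lceil>2 powr (real j / 2)\<rceil>"
      by (simp_all only: of_int_minus)
    from this[THEN round_mono] have "- \<lceil>2 powr (real j / 2)\<rceil> \<le> round v" "round v \<le> \<lceil>2 powr (real j / 2)\<rceil>"
      by (simp_all only: round_of_int)
    then have k: "(j, k) \<in> cone_index"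
      by (simp add: cone_index_def shears_def k_def abs_le_iff)
    define \<eta> where "\<eta> = cone_mat (j, k) *v \<xi>"
    have \<eta>1: "\<bar>\<eta> $ 1\<bar> = \<bar>\<xi> $ 1\<bar> / 2 ^ j" by (simp add: \<eta>_def cone_mat_nth abs_divide)
    have "\<eta> $ 2 = \<eta> $ 1 * (v - of_int (round v))"
    proof -
      have "\<xi> $ 1 \<noteq> 0" using \<xi>1 by auto
      then have "\<xi> $ 1 / 2 ^ j * v = sqrt (2 ^ j) / 2 ^ j * \<xi> $ 2" by (simp add: v_def)
      also have "sqrt (2 ^ j) / 2 ^ j = inverse (sqrt (2 ^ j :: real))"
        by (rule sqrt_divide_self_eq) simp
      finally have "\<xi> $ 1 / 2 ^ j * v = \<xi> $ 2 / sqrt (2 ^ j)" by (simp add: divide_inverse mult.commute)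
      then have "\<eta> $ 2 = of_int k * \<eta> $ 1 + \<eta> $ 1 * v"
        unfolding \<eta>_def cone_mat_nth by simp
      then show ?thesis by (simp add: k_def right_diff_distrib mult.commute)
    qed
    moreover have "\<bar>v - of_int (round v)\<bar> \<le> 1 / 2"
      using of_int_round_abs_le[of v] by (simp only: abs_minus_commute)
    ultimately have "\<bar>\<eta> $ 2\<bar> \<le> \<bar>\<eta> $ 1\<bar> * (1 / 2)"
      by (simp only: abs_mult) (rule mult_left_mono, simp_all)
    then have "e \<le> cmod (p \<eta>)" using j(1) j' unfolding \<eta>1[symmetric] by (intro lower) linarith+
    then have "e * e \<le> cmod (p \<eta>) * cmod (p \<eta>)" using e by (intro mult_mono) auto
    then have "ennreal (e\<^sup>2) \<le> ennreal (cmod (p \<eta>) * cmod (p (\<eta> + 0)))"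
      unfolding power2_eq_square add_0_right by (rule ennreal_leI)
    also have "\<dots> \<le> Phi p \<xi> 0"
      unfolding Phi_eq_nn_integral \<eta>_def
      by (rule nn_integral_ge_point[OF k, of "\<lambda>a. ennreal (cmod (p (cone_mat a *v \<xi>)) * cmod (p (cone_mat a *v \<xi> + 0)))"])
    finally show ?thesis .
  qed
  then show ?thesis
    unfolding L_inf_def essinf_def by (intro Sup_upper) (simp add: AE_restrict_shear_cone)
qed

section \<open>The low-pass filter and the scaling function\<close>

text \<open>The sum is a partial sum of the power series of (1 - y)^(-K-1), all of whose terms are
  nonnegative. In the induction, multiplication by 1 - y lowers K by one up to a nonpositive
  remainder, by Pascal's rule.\<close>

lemma binomial_partial_sum_le:
  fixes y :: real
  assumes "0 \<le> y" "y \<le> 1"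
  shows "(1 - y) ^ Suc K * (\<Sum>n\<le>N. real ((K + n) choose n) * y ^ n) \<le> 1"
proof (induction K)
  case 0
  have "(1 - y) * (\<Sum>n\<le>N. y ^ n) = 1 - y ^ Suc N" by (rule sum_gp_basic)
  then show ?case using assms by simp
next
  case (Suc K)
  let ?S = "\<lambda>K N. \<Sum>n\<le>N. real ((K + n) choose n) * y ^ n"
  have "(1 - y) * ?S (Suc K) N = ?S K N - real ((Suc K + N) choose N) * y ^ Suc N"
  proof (induction N)
    case (Suc N)
    have pascal: "real ((Suc K + Suc N) choose Suc N) = real ((Suc K + N) choose N) + real ((K + Suc N) choose Suc N)"
      using binomial_Suc_Suc[of "Suc K + N" N] by (simp del: binomial_Suc_Suc)
    have "(1 - y) * ?S (Suc K) (Suc N) = (1 - y) * ?S (Suc K) N + (1 - y) * (real ((Suc K + Suc N) choose Suc N) * y ^ Suc N)"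
      by (simp only: sum.atMost_Suc distrib_left)
    also have "\<dots> = ?S K N - real ((Suc K + N) choose N) * y ^ Suc N + (1 - y) * (real ((Suc K + Suc N) choose Suc N) * y ^ Suc N)"
      by (simp only: Suc.IH)
    also have "\<dots> = ?S K (Suc N) - real ((Suc K + Suc N) choose Suc N) * y ^ Suc (Suc N)"
      unfolding pascal sum.atMost_Suc by (simp only: power_Suc) algebra
    finally show ?case .
  qed simp
  also have "\<dots> \<le> ?S K N" using assms by simp
  finally have "(1 - y) ^ Suc K * ((1 - y) * ?S (Suc K) N) \<le> (1 - y) ^ Suc K * ?S K N"
    using assms by (intro mult_left_mono) auto
  then have "(1 - y) ^ Suc (Suc K) * ?S (Suc K) N \<le> (1 - y) ^ Suc K * ?S K N"
    by (simp add: mult_ac)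
  with Suc show ?case by linarith
qed

text \<open>The entries at \<open>l\<close>, \<open>Suc l\<close> and their mirror images are all at
  least the one at \<open>l\<close>. The hypothesis keeps these four positions distinct, and the
  whole row sums to 2^N.\<close>

lemma four_mult_binomial_le:
  assumes "2 * l + 2 < N"
  shows "4 * (N choose l) \<le> 2 ^ N"
proof -
  have sym: "N choose (N - l) = N choose l" "N choose (N - Suc l) = N choose Suc l"
    using assms binomial_symmetric[of l N] binomial_symmetric[of "Suc l" N] by auto
  have mono: "N choose l \<le> N choose Suc l" using assms by (intro binomial_mono) auto
  have "l \<noteq> N - Suc l" "Suc l \<noteq> N - Suc l" "Suc l \<noteq> N - l" "l \<noteq> N - l" "N - Suc l \<noteq> N - l"
    using assms by auto
  then have "4 * (N choose l) \<le> (\<Sum>k\<in>{l, Suc l, N - Suc l, N - l}. N choose k)"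
    using sym mono by simp
  also have "\<dots> \<le> (\<Sum>k\<le>N. N choose k)" using assms by (intro sum_mono2) auto
  also have "\<dots> = 2 ^ N" by (rule choose_row_sum)
  finally show ?thesis .
qed

text \<open>Viete's product, by iterating the double-angle formula.\<close>

lemma prod_cos_dyadic:
  "2 ^ n * sin (2 * pi * x / 2 ^ n) * (\<Prod>i<n. cos (pi * x / 2 ^ i)) = sin (2 * pi * x)"
proof (induction n)
  case (Suc n)
  have "sin (2 * pi * x / 2 ^ n) = 2 * sin (pi * x / 2 ^ n) * cos (pi * x / 2 ^ n)"
    using sin_double[of "pi * x / 2 ^ n"] by (simp add: mult.assoc)
  then show ?case using Suc by (simp add: mult_ac)
qed simp

lemma half_le_sin:
  assumes "pi / 6 \<le> t" "t \<le> 5 * pi / 6"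
  shows "1 / 2 \<le> sin t"
proof -
  have "\<bar>t - pi / 2\<bar> \<le> pi / 3" using assms by linarith
  then have "cos (pi / 3) \<le> cos \<bar>t - pi / 2\<bar>"
    by (intro cos_monotone_0_pi_le) auto
  then show ?thesis by (simp add: cos_60 cos_diff)
qed

lemma half_mult_le_sin:
  assumes "0 \<le> t" "t \<le> pi / 3"
  shows "t / 2 \<le> sin t"
proof -
  have "sin 0 - 0 / 2 \<le> sin t - t / 2"
  proof (rule DERIV_nonneg_imp_nondecreasing[OF assms(1)])
    fix x assume x: "0 \<le> x" "x \<le> t"
    have "((\<lambda>x. sin x - x / 2) has_real_derivative cos x - 1 / 2) (at x)"
      by (auto intro!: derivative_eq_intros)
    moreover have "cos (pi / 3) \<le> cos x"
      using x assms by (intro cos_monotone_0_pi_le) auto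
    then have "0 \<le> cos x - 1 / 2" by (simp add: cos_60)
    ultimately show "\<exists>y. ((\<lambda>x. sin x - x / 2) has_real_derivative y) (at x) \<and> 0 \<le> y" by blast
  qed
  then show ?thesis by simp
qed

text \<open>The range of |x| / 2^n puts the angle of the sine in \<open>prod_cos_dyadic\<close>
  between \<pi>/4 and \<pi>/2, where the sine is at least 1/2.\<close>

lemma abs_prod_cos_upper:
  assumes "1 / 8 \<le> \<bar>x\<bar> / 2 ^ n" "\<bar>x\<bar> / 2 ^ n \<le> 1 / 4"
  shows "(\<Prod>i<n. \<bar>cos (pi * x / 2 ^ i)\<bar>) \<le> 2 / 2 ^ n"
proof -
  define r where "r = pi * (\<bar>x\<bar> / 2 ^ n)"
  let ?P = "\<Prod>i<n. \<bar>cos (pi * x / 2 ^ i)\<bar>"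
  have "pi * (1 / 8) \<le> r" "r \<le> pi * (1 / 4)"
    unfolding r_def using assms by (auto intro!: mult_left_mono simp del: times_divide_eq_right)
  then have "1 / 2 \<le> sin (2 * r)" using pi_gt_zero by (intro half_le_sin) linarith+
  moreover have "\<bar>sin (2 * pi * x / 2 ^ n)\<bar> = \<bar>sin (2 * r)\<bar>"
    unfolding r_def by (cases "x \<ge> 0") (auto simp: mult.assoc)
  ultimately have s: "1 / 2 \<le> \<bar>sin (2 * pi * x / 2 ^ n)\<bar>" by linarith
  have P: "?P \<ge> 0" by (intro prod_nonneg) auto
  have "2 ^ n * (1 / 2) * ?P \<le> 2 ^ n * \<bar>sin (2 * pi * x / 2 ^ n)\<bar> * ?P"
    using s P by (intro mult_right_mono mult_left_mono) auto
  also have "\<dots> = \<bar>sin (2 * pi * x)\<bar>"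
    using arg_cong[OF prod_cos_dyadic[of n x], of abs] by (simp add: abs_mult abs_prod)
  also have "\<dots> \<le> 1" by simp
  finally show ?thesis by (simp add: field_simps)
qed

text \<open>In \<open>prod_cos_dyadic\<close> the right-hand sine is at least half its angle and the
  left-hand sine at most its angle; the angle cancels, which leaves a bound independent of
  \<open>n\<close>.\<close>

lemma abs_prod_cos_lower:
  assumes "\<bar>x\<bar> \<le> 1 / 6"
  shows "1 / 2 \<le> (\<Prod>i<n. \<bar>cos (pi * x / 2 ^ i)\<bar>)"
proof (cases "x = 0")
  case False
  let ?t = "2 * pi * \<bar>x\<bar>" and ?P = "\<Prod>i<n. \<bar>cos (pi * x / 2 ^ i)\<bar>"
  have t: "0 < ?t" using False by simp
  have "pi * \<bar>x\<bar> \<le> pi * (1 / 6)" using assms by (intro mult_left_mono) auto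
  then have t3: "?t \<le> pi / 3" by simp
  have P: "?P \<ge> 0" by (intro prod_nonneg) auto
  have "?t / 2 \<le> sin ?t" using t t3 by (intro half_mult_le_sin) auto
  also have "\<dots> \<le> \<bar>sin (2 * pi * x)\<bar>" by (cases "x \<ge> 0") auto
  also have "\<dots> = 2 ^ n * \<bar>sin (2 * pi * x / 2 ^ n)\<bar> * ?P"
    using arg_cong[OF prod_cos_dyadic[of n x], of abs] by (simp add: abs_mult abs_prod)
  also have "\<dots> \<le> 2 ^ n * \<bar>2 * pi * x / 2 ^ n\<bar> * ?P"
    by (intro mult_right_mono mult_left_mono abs_sin_x_le_abs_x P) auto
  also have "\<dots> = ?t * ?P" by (simp add: abs_mult)
  finally have "?t * (1 / 2) \<le> ?t * ?P" by simp
  then show ?thesis using t by (simp only: mult_le_cancel_left_pos)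
qed simp

section \<open>Convergence of the infinite product\<close>

lemma trig_poly_lipschitz_at_0:
  assumes "trig_poly R p"
  shows "\<exists>C\<ge>0. \<forall>x. cmod (p x - p 0) \<le> C * \<bar>x\<bar>"
proof -
  have "trig_poly UNIV p" using assms unfolding trig_poly_def by blast
  then obtain N a where N: "finite N" "p = (\<lambda>x. \<Sum>n\<in>N. a n * chr (of_int n * x))"
    by (auto simp: trig_poly_iff_chr)
  have chr_le: "cmod (chr t - 1) \<le> 2 * pi * \<bar>t\<bar>" for t
    unfolding chr_def cis_conv_exp
    using iexp_approx1[of "2 * pi * t" 0] by (simp add: abs_mult)
  let ?C = "\<Sum>n\<in>N. cmod (a n) * (2 * pi * \<bar>of_int n\<bar>)"
  have "cmod (p x - p 0) \<le> ?C * \<bar>x\<bar>" for x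
  proof -
    have "p x - p 0 = (\<Sum>n\<in>N. a n * (chr (of_int n * x) - 1))"
      by (simp add: N right_diff_distrib sum_subtractf)
    then have "cmod (p x - p 0) \<le> (\<Sum>n\<in>N. cmod (a n * (chr (of_int n * x) - 1)))"
      by (simp add: norm_sum)
    also have "\<dots> \<le> (\<Sum>n\<in>N. cmod (a n) * (2 * pi * \<bar>of_int n * x\<bar>))"
      unfolding norm_mult by (intro sum_mono mult_left_mono chr_le) auto
    also have "\<dots> = ?C * \<bar>x\<bar>"
      unfolding sum_distrib_right by (intro sum.cong refl) (simp add: abs_mult)
    finally show ?thesis .
  qed
  moreover have "?C \<ge> 0" by (intro sum_nonneg) auto
  ultimately show ?thesis by blast
qed

text \<open>The factors differ from 1 by at most C |x| / 2^i, which is summable. Hence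
  \<open>phi_hat\<close> is the limit of the partial products, also when some factors
  vanish.\<close>

lemma phi_hat_LIMSEQ:
  assumes "trig_poly R m0" "m0 0 = 1"
  shows "(\<lambda>n. \<Prod>i\<le>n. m0 (x / 2 ^ i)) \<longlonglongrightarrow> phi_hat m0 x"
proof -
  obtain C where C: "\<And>x. cmod (m0 x - 1) \<le> C * \<bar>x\<bar>"
    using trig_poly_lipschitz_at_0[OF assms(1)] assms(2) by auto
  have "summable (\<lambda>i. C * \<bar>x\<bar> * (1 / 2) ^ i)"
    by (intro summable_mult summable_geometric) simp
  then have "summable (\<lambda>i. cmod (m0 (x / 2 ^ i) - 1))"
  proof (rule summable_comparison_test'[of _ 0])
    show "norm (cmod (m0 (x / 2 ^ i) - 1)) \<le> C * \<bar>x\<bar> * (1 / 2) ^ i" for i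
      using C[of "x / 2 ^ i"] by (simp add: abs_divide power_divide)
  qed
  then have "abs_convergent_prod (\<lambda>i. m0 (x / 2 ^ i))"
    by (rule summable_imp_abs_convergent_prod)
  then show ?thesis
    unfolding phi_hat_def by (intro convergent_prod_LIMSEQ abs_convergent_prod_imp_convergent_prod)
qed

text \<open>All that is used of the relation between \<open>K\<close> and \<open>L\<close> is \<open>L + 5 \<le> K\<close>. It makes the binomial
  coefficient \<open>P 1 = (K + L - 1) choose (L - 1)\<close> at most \<open>2 ^ (K + L - 3) \<le> 4 ^ (K - 4)\<close>, so of the decay
  of order \<open>K\<close> coming from the cosines an order of \<open>4\<close> survives.\<close>

locale daubechies_filter =
  fixes K L :: nat and m0 m1 :: "real \<Rightarrow> complex" and R :: "complex set"
  assumes K_pos: "K > 0" and L_pos: "L > 0" and L_K: "L + 5 \<le> K"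
    and m0_trig: "trig_poly R m0" and m0_0: "m0 0 = 1"
    and m0_square: "\<And>x. (cmod (m0 x))\<^sup>2 =
          cos (pi * x) ^ (2 * K) *
          (\<Sum>n = 0..L - 1. real ((K - 1 + n) choose n) * sin (pi * x) ^ (2 * n))"
    and m1_square: "\<And>x. (cmod (m1 x))\<^sup>2 = (cmod (m0 (x + 1 / 2)))\<^sup>2"
begin

text \<open>With \<open>y\<close> the square of the sine, the power series of (1 - y)^(-K) truncated
  after degree L - 1.\<close>

definition P :: "real \<Rightarrow> real" where
  "P y = (\<Sum>n\<le>L - 1. real ((K - 1 + n) choose n) * y ^ n)"

lemma m0_square_P: "(cmod (m0 x))\<^sup>2 = (\<bar>cos (pi * x)\<bar> ^ K)\<^sup>2 * P ((sin (pi * x))\<^sup>2)"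
  unfolding m0_square P_def atLeast0AtMost
  by (simp add: power_mult[symmetric] mult.commute[of K] power_even_abs)

lemma P_ge_1: "y \<ge> 0 \<Longrightarrow> 1 \<le> P y"
  unfolding P_def by (subst sum.atMost_shift) (auto intro!: sum_nonneg)

lemma P_le: "0 \<le> y \<Longrightarrow> y \<le> 1 \<Longrightarrow> P y \<le> (2 ^ (K - 4))\<^sup>2"
proof -
  assume y: "0 \<le> y" "y \<le> 1"
  have "P y \<le> (\<Sum>n\<le>L - 1. real ((K - 1 + n) choose n))"
    unfolding P_def using y by (intro sum_mono mult_left_le) (auto intro: power_le_one)
  also have "\<dots> = real (Suc (K - 1 + (L - 1)) choose (L - 1))"
    by (subst sum_choose_lower[symmetric]) simp
  also have "\<dots> \<le> (2 ^ (K - 4))\<^sup>2"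
  proof -
    let ?N = "Suc (K - 1 + (L - 1))"
    have "4 * (?N choose (L - 1)) \<le> 2 ^ ?N" using L_K L_pos by (intro four_mult_binomial_le) auto
    also have "(2::nat) ^ ?N \<le> 2 ^ ((K - 4) * 2 + 2)" using L_K L_pos by (intro power_increasing) auto
    also have "\<dots> = 4 * (2 ^ (K - 4))\<^sup>2" by (simp only: power_add power_mult) simp
    finally have "?N choose (L - 1) \<le> (2 ^ (K - 4))\<^sup>2" by simp
    then have "real (?N choose (L - 1)) \<le> real ((2 ^ (K - 4))\<^sup>2)" by (rule of_nat_mono)
    then show ?thesis by simp
  qed
  finally show ?thesis .
qed

lemma m0_le: "cmod (m0 x) \<le> \<bar>cos (pi * x)\<bar> ^ K * 2 ^ (K - 4)"
proof (rule power2_le_imp_le)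
  have "(sin (pi * x))\<^sup>2 \<le> 1" by (simp add: abs_square_le_1)
  then show "(cmod (m0 x))\<^sup>2 \<le> (\<bar>cos (pi * x)\<bar> ^ K * 2 ^ (K - 4))\<^sup>2"
    unfolding m0_square_P power_mult_distrib by (intro mult_left_mono P_le) auto
qed simp

lemma m0_ge: "\<bar>cos (pi * x)\<bar> ^ K \<le> cmod (m0 x)"
proof (rule power2_le_imp_le)
  have "(\<bar>cos (pi * x)\<bar> ^ K)\<^sup>2 * 1 \<le> (cmod (m0 x))\<^sup>2"
    unfolding m0_square_P by (intro mult_left_mono P_ge_1) auto
  then show "(\<bar>cos (pi * x)\<bar> ^ K)\<^sup>2 \<le> (cmod (m0 x))\<^sup>2" by simp
qed simp

lemma m0_le_1: "cmod (m0 x) \<le> 1"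
proof -
  let ?y = "(sin (pi * x))\<^sup>2"
  have y: "0 \<le> ?y" "?y \<le> 1" by (auto simp: abs_square_le_1)
  have "(\<bar>cos (pi * x)\<bar> ^ K)\<^sup>2 = (1 - ?y) ^ Suc (K - 1)"
    using K_pos by (simp add: power_mult[symmetric] mult.commute[of K] power_mult cos_squared_eq)
  then have "(cmod (m0 x))\<^sup>2 = (1 - ?y) ^ Suc (K - 1) * (\<Sum>n\<le>L - 1. real ((K - 1 + n) choose n) * ?y ^ n)"
    unfolding m0_square_P P_def by (simp only:)
  also have "\<dots> \<le> 1" by (rule binomial_partial_sum_le[OF y])
  finally show ?thesis by (simp add: abs_square_le_1)
qed

lemma phi_hat_limit: "(\<lambda>n. \<Prod>i\<le>n. cmod (m0 (x / 2 ^ i))) \<longlonglongrightarrow> cmod (phi_hat m0 x)"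
  using tendsto_norm[OF phi_hat_LIMSEQ[OF m0_trig m0_0, of x]] by (simp add: prod_norm)

text \<open>The factors left out have modulus at most 1.\<close>

lemma phi_hat_le_partial: "cmod (phi_hat m0 x) \<le> (\<Prod>i<n. cmod (m0 (x / 2 ^ i)))"
proof (rule LIMSEQ_le_const2[OF phi_hat_limit], intro exI allI impI)
  fix k assume "n \<le> k"
  then have "(\<Prod>i\<le>k. cmod (m0 (x / 2 ^ i))) = (\<Prod>i\<in>{..k} - {..<n}. cmod (m0 (x / 2 ^ i))) * (\<Prod>i<n. cmod (m0 (x / 2 ^ i)))"
    by (intro prod.subset_diff) auto
  also have "\<dots> \<le> 1 * (\<Prod>i<n. cmod (m0 (x / 2 ^ i)))"
    by (intro mult_right_mono prod_le_1 prod_nonneg) (auto simp: m0_le_1)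
  finally show "(\<Prod>i\<le>k. cmod (m0 (x / 2 ^ i))) \<le> (\<Prod>i<n. cmod (m0 (x / 2 ^ i)))" by simp
qed

lemma phi_hat_le_1: "cmod (phi_hat m0 x) \<le> 1"
  using phi_hat_le_partial[of x 0] by simp

text \<open>Take \<open>n\<close> with 2^n of the order of |x|. The first \<open>n\<close> factors
  contribute (2 / 2^n)^K from the cosines and (2^(K-4))^n from the binomial sums; what remains is
  2^K 2^(-4n), of order |x|^(-4).\<close>

lemma phi_hat_decay: "cmod (phi_hat m0 x) \<le> 2 ^ (K + 1) * decay_weight x"
proof -
  obtain n :: nat where n: "\<bar>x\<bar> / 2 ^ n \<le> 1 / 4" "n = 0 \<or> (1 / 4) / 2 < \<bar>x\<bar> / 2 ^ n"
    using ex_dyadic[of "1 / 4" "\<bar>x\<bar>"] by auto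
  have "(1 + x\<^sup>2)\<^sup>2 * cmod (phi_hat m0 x) \<le> 2 ^ (K + 1)"
  proof (cases "n = 0")
    case True
    then have "\<bar>x\<bar> \<le> 1 / 4" using n by simp
    then have "x\<^sup>2 \<le> (1 / 4)\<^sup>2" by (metis abs_ge_zero power2_abs power_mono)
    then have "(1 + x\<^sup>2)\<^sup>2 \<le> (1 + (1 / 4)\<^sup>2)\<^sup>2" by (intro power_mono) auto
    also have "\<dots> \<le> (2::real) ^ 1" by (simp add: power2_eq_square)
    finally have "(1 + x\<^sup>2)\<^sup>2 * cmod (phi_hat m0 x) \<le> 2 ^ 1 * 1"
      by (intro mult_mono phi_hat_le_1) auto
    also have "\<dots> \<le> 2 ^ (K + 1)" by (simp add: self_le_power)
    finally show ?thesis .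
  next
    case False
    have low: "1 / 8 \<le> \<bar>x\<bar> / 2 ^ n" using n(2) False by auto
    have K4: "K = 4 + (K - 4)" using L_K by simp
    let ?c = "\<Prod>i<n. \<bar>cos (pi * x / 2 ^ i)\<bar>"
    have c: "0 \<le> ?c" "?c \<le> 2 / 2 ^ n" using abs_prod_cos_upper[OF low n(1)] by (auto intro: prod_nonneg)
    have "cmod (phi_hat m0 x) \<le> (\<Prod>i<n. cmod (m0 (x / 2 ^ i)))" by (rule phi_hat_le_partial)
    also have "\<dots> \<le> (\<Prod>i<n. \<bar>cos (pi * (x / 2 ^ i))\<bar> ^ K * 2 ^ (K - 4))"
      by (intro prod_mono conjI m0_le) auto
    also have "\<dots> = ?c ^ K * (2 ^ (K - 4)) ^ n"
      by (simp add: prod.distrib prod_power_distrib)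
    also have "\<dots> \<le> (2 / 2 ^ n) ^ K * (2 ^ (K - 4)) ^ n"
      using c by (intro mult_right_mono power_mono) auto
    also have "\<dots> = 2 ^ K * (1 / 2 ^ n) ^ 4"
    proof -
      have "(2 / 2 ^ n) ^ K * (2 ^ (K - 4)) ^ n = 2 ^ K * ((1 / 2 ^ n) ^ K * (2 ^ n) ^ (K - 4) :: real)"
        by (simp add: power_divide power_mult[symmetric] mult.commute)
      also have "(1 / 2 ^ n) ^ K * (2 ^ n) ^ (K - 4) = (1 / 2 ^ n) ^ 4 * ((1 / 2 ^ n) ^ (K - 4) * (2 ^ n :: real) ^ (K - 4))"
        by (subst K4, subst power_add) (simp only: mult.assoc)
      also have "(1 / 2 ^ n) ^ (K - 4) * (2 ^ n :: real) ^ (K - 4) = 1"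
        by (simp add: power_mult_distrib[symmetric])
      finally show ?thesis by simp
    qed
    finally have phi: "cmod (phi_hat m0 x) \<le> 2 ^ K * (1 / 2 ^ n) ^ 4" .
    \<comment> \<open>In terms of q = 2^(-n), the bounds q <= 1/2 and |x| q <= 1/4 give (1 + x^2)
      q^2 <= 1/4 + 1/16, and squaring handles the fourth power.\<close>
    define q :: real where "q = 1 / 2 ^ n"
    have q: "0 \<le> q" "q \<le> 1" "\<bar>x\<bar> * q \<le> 1 / 4" using n(1) by (simp_all add: q_def)
    have "(x * q)\<^sup>2 \<le> (1 / 4)\<^sup>2"
      using q by (metis abs_ge_zero abs_mult abs_of_nonneg power2_abs power_mono)
    moreover have "q \<le> 1 / 2" unfolding q_def using False by (cases n) (auto simp: field_simps)
    then have "q\<^sup>2 \<le> (1 / 2)\<^sup>2" using q by (intro power_mono) auto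
    moreover have "(1 + x\<^sup>2) * q\<^sup>2 = q\<^sup>2 + (x * q)\<^sup>2" by (simp add: distrib_right power_mult_distrib)
    moreover have "(1 / 4)\<^sup>2 + (1 / 2)\<^sup>2 \<le> (1 :: real)" by (simp add: power2_eq_square)
    ultimately have "(1 + x\<^sup>2) * q\<^sup>2 \<le> 1" by linarith
    then have "((1 + x\<^sup>2) * q\<^sup>2)\<^sup>2 \<le> 1" by (intro power_le_one) (auto intro!: mult_nonneg_nonneg add_nonneg_nonneg)
    moreover have "(1 + x\<^sup>2)\<^sup>2 * (2 ^ K * q ^ 4) = 2 ^ K * ((1 + x\<^sup>2) * q\<^sup>2)\<^sup>2"
      by (simp add: power_mult_distrib mult_ac flip: power_mult)
    ultimately have "(1 + x\<^sup>2)\<^sup>2 * (2 ^ K * q ^ 4) \<le> 2 ^ K * 1" by (simp only: mult_left_mono zero_le_power zero_le_numeral)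
    moreover have "(1 + x\<^sup>2)\<^sup>2 * cmod (phi_hat m0 x) \<le> (1 + x\<^sup>2)\<^sup>2 * (2 ^ K * q ^ 4)"
      using phi unfolding q_def by (intro mult_left_mono) auto
    moreover have "(2::real) ^ K * 1 \<le> 2 ^ (K + 1)" by simp
    ultimately show ?thesis by linarith
  qed
  moreover have "0 < (1 + x\<^sup>2)\<^sup>2" by (intro zero_less_power) (simp add: add_pos_nonneg)
  ultimately show ?thesis
    unfolding decay_weight_def by (simp add: pos_le_divide_eq mult.commute)
qed

lemma phi_hat_lower:
  assumes "\<bar>x\<bar> \<le> 1 / 6"
  shows "(1 / 2) ^ K \<le> cmod (phi_hat m0 x)"
proof (rule LIMSEQ_le_const[OF phi_hat_limit], intro exI allI impI)
  fix n :: nat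
  have "(1 / 2) ^ K \<le> (\<Prod>i<Suc n. \<bar>cos (pi * x / 2 ^ i)\<bar>) ^ K"
    by (intro power_mono abs_prod_cos_lower assms) auto
  also have "\<dots> = (\<Prod>i<Suc n. \<bar>cos (pi * (x / 2 ^ i))\<bar> ^ K)"
    by (simp only: prod_power_distrib times_divide_eq_right)
  also have "\<dots> \<le> (\<Prod>i<Suc n. cmod (m0 (x / 2 ^ i)))"
    by (intro prod_mono conjI m0_ge) auto
  finally show "(1 / 2) ^ K \<le> (\<Prod>i\<le>n. cmod (m0 (x / 2 ^ i)))"
    by (simp only: lessThan_Suc_atMost)
qed

lemma m1_norm: "cmod (m1 (4 * x)) = cmod (m0 (4 * x + 1 / 2))"
  using m1_square[of "4 * x"] by (simp add: power2_eq_iff_nonneg)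

lemma cos_shift: "\<bar>cos (pi * (4 * x + 1 / 2))\<bar> = \<bar>sin (4 * pi * x)\<bar>"
  by (simp add: distrib_left cos_add mult_ac)

text \<open>The half-period shift turns the cosine into a sine, so \<open>m1\<close> vanishes at the
  origin. This is used for |x| <= 1; beyond that the quotient x^2 / (1 + x^2) is at least 1/2 and
  the trivial bound 1 does.\<close>

lemma m1_decay: "cmod (m1 (4 * x)) \<le> 2 ^ (K + 5) * (x\<^sup>2 / (1 + x\<^sup>2))"
proof -
  have "cmod (m1 (4 * x)) * (1 + x\<^sup>2) \<le> 2 ^ (K + 5) * x\<^sup>2"
  proof (cases "\<bar>x\<bar> \<le> 1")
    case True
    have "cmod (m1 (4 * x)) \<le> \<bar>sin (4 * pi * x)\<bar> ^ K * 2 ^ (K - 4)"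
      using m0_le[of "4 * x + 1 / 2"] unfolding m1_norm cos_shift .
    \<comment> \<open>Two orders of the zero at the origin are kept.\<close>
    also have "\<dots> \<le> \<bar>sin (4 * pi * x)\<bar> ^ 2 * 2 ^ (K - 4)"
      using L_K by (intro mult_right_mono power_decreasing) auto
    also have "\<dots> \<le> (16 * \<bar>x\<bar>) ^ 2 * 2 ^ (K - 4)"
    proof (intro mult_right_mono power_mono)
      have "\<bar>sin (4 * pi * x)\<bar> \<le> \<bar>4 * pi * x\<bar>" by (rule abs_sin_x_le_abs_x)
      also have "\<dots> = 4 * pi * \<bar>x\<bar>" by (simp add: abs_mult)
      \<comment> \<open>Replacing \<pi> by 4 makes the constant a power of two: 16^2 * 2^(K-4) =
        2^(K+4).\<close>
      also have "\<dots> \<le> 4 * 4 * \<bar>x\<bar>" using pi_less_4 by (intro mult_right_mono mult_left_mono) auto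
      finally show "\<bar>sin (4 * pi * x)\<bar> \<le> 16 * \<bar>x\<bar>" by simp
    qed auto
    also have "\<dots> = x\<^sup>2 * 2 ^ (8 + (K - 4))" by (simp add: power_mult_distrib power_add)
    also have "8 + (K - 4) = K + 4" using L_K by simp
    finally have le: "cmod (m1 (4 * x)) \<le> x\<^sup>2 * 2 ^ (K + 4)" .
    have "x\<^sup>2 \<le> 1" using True by (simp add: abs_square_le_1)
    then have "cmod (m1 (4 * x)) * (1 + x\<^sup>2) \<le> (x\<^sup>2 * 2 ^ (K + 4)) * 2"
      by (intro mult_mono le) auto
    then show ?thesis by (simp add: mult_ac power_add)
  next
    case False
    then have "1 \<le> x\<^sup>2" by (metis abs_square_le_1 linear)
    then have "1 + x\<^sup>2 \<le> 2 * x\<^sup>2" by simp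
    moreover have "cmod (m1 (4 * x)) \<le> 1" unfolding m1_norm by (rule m0_le_1)
    ultimately have "cmod (m1 (4 * x)) * (1 + x\<^sup>2) \<le> 1 * (2 * x\<^sup>2)" by (intro mult_mono) auto
    also have "\<dots> \<le> 2 ^ (K + 5) * x\<^sup>2"
      using self_le_power[of "2::real" "K + 5"] by (simp add: mult_right_mono)
    finally show ?thesis .
  qed
  then show ?thesis by (simp add: pos_le_divide_eq add_pos_nonneg)
qed

lemma psi_hat_decay:
  "cmod (psi_hat m0 m1 \<xi>) \<le> 2 ^ (3 * K + 7) * (freq_weight (\<xi> $ 1) * decay_weight (\<xi> $ 2))"
proof -
  have "decay_weight (2 * y) \<le> decay_weight y" for y
  proof -
    have "y\<^sup>2 \<le> (2 * y)\<^sup>2" by (simp add: power_mult_distrib)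
    then have "(1 + y\<^sup>2)\<^sup>2 \<le> (1 + (2 * y)\<^sup>2)\<^sup>2" by (intro power_mono) auto
    then show ?thesis unfolding decay_weight_def
      by (intro divide_left_mono mult_pos_pos zero_less_power) (auto simp: add_pos_nonneg)
  qed
  then have phi2: "cmod (phi_hat m0 (2 * \<xi> $ 2)) \<le> 2 ^ (K + 1) * decay_weight (\<xi> $ 2)"
    using phi_hat_decay[of "2 * \<xi> $ 2"] by (meson mult_left_mono order_trans zero_le_numeral zero_le_power)
  have "cmod (psi_hat m0 m1 \<xi>) = cmod (m1 (4 * \<xi> $ 1)) * cmod (phi_hat m0 (\<xi> $ 1)) * cmod (phi_hat m0 (2 * \<xi> $ 2))"
    by (simp add: psi_hat_def norm_mult)
  also have "\<dots> \<le> (2 ^ (K + 5) * ((\<xi> $ 1)\<^sup>2 / (1 + (\<xi> $ 1)\<^sup>2))) * (2 ^ (K + 1) * decay_weight (\<xi> $ 1)) * (2 ^ (K + 1) * decay_weight (\<xi> $ 2))"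
    by (intro mult_mono m1_decay phi_hat_decay phi2)
       (auto intro!: mult_nonneg_nonneg divide_nonneg_nonneg decay_weight_nonneg)
  also have "\<dots> = (2 ^ (K + 5) * 2 ^ (K + 1) * 2 ^ (K + 1)) * (((\<xi> $ 1)\<^sup>2 / (1 + (\<xi> $ 1)\<^sup>2) * decay_weight (\<xi> $ 1)) * decay_weight (\<xi> $ 2))"
    by (simp only: mult_ac)
  also have "2 ^ (K + 5) * 2 ^ (K + 1) * 2 ^ (K + 1) = (2::real) ^ (3 * K + 7)"
    unfolding power_add[symmetric] by (rule arg_cong[of _ _ "power 2"]) simp
  also have "(\<xi> $ 1)\<^sup>2 / (1 + (\<xi> $ 1)\<^sup>2) * decay_weight (\<xi> $ 1) = freq_weight (\<xi> $ 1)"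
    by (simp add: freq_weight_def decay_weight_def power3_eq_cube power2_eq_square)
  finally show ?thesis .
qed

lemma psi_hat_lower:
  assumes "1 / 12 \<le> \<bar>\<xi> $ 1\<bar>" "\<bar>\<xi> $ 1\<bar> \<le> 1 / 6" "2 * \<bar>\<xi> $ 2\<bar> \<le> 1 / 6"
  shows "(1 / 2) ^ (3 * K) \<le> cmod (psi_hat m0 m1 \<xi>)"
proof -
  \<comment> \<open>The angle 4\<pi>|\<xi>_1| lies between \<pi>/3 and 2\<pi>/3, so the sine that
    bounds \<open>m1\<close> from below is at least 1/2.\<close>
  have "pi * (1 / 12) \<le> pi * \<bar>\<xi> $ 1\<bar>" "pi * \<bar>\<xi> $ 1\<bar> \<le> pi * (1 / 6)"
    using assms by (auto intro!: mult_left_mono)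
  then have "1 / 2 \<le> sin (4 * (pi * \<bar>\<xi> $ 1\<bar>))" using pi_gt_zero by (intro half_le_sin) linarith+
  also have "\<dots> \<le> \<bar>sin (4 * pi * \<xi> $ 1)\<bar>" by (cases "\<xi> $ 1 \<ge> 0") (auto simp: mult_ac)
  finally have "(1 / 2) ^ K \<le> \<bar>sin (4 * pi * \<xi> $ 1)\<bar> ^ K" by (intro power_mono) auto
  also have "\<dots> \<le> cmod (m1 (4 * \<xi> $ 1))"
    using m0_ge[of "4 * \<xi> $ 1 + 1 / 2"] unfolding m1_norm cos_shift .
  finally have m1: "(1 / 2) ^ K \<le> cmod (m1 (4 * \<xi> $ 1))" .
  have "(1 / 2) ^ K * (1 / 2) ^ K * (1 / 2) ^ K \<le>
     cmod (m1 (4 * \<xi> $ 1)) * cmod (phi_hat m0 (\<xi> $ 1)) * cmod (phi_hat m0 (2 * \<xi> $ 2))"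
    using assms by (intro mult_mono m1 phi_hat_lower) (auto simp: abs_mult)
  moreover have "(1 / 2) ^ K * (1 / 2) ^ K * (1 / 2) ^ K = (1 / 2 :: real) ^ (3 * K)"
    unfolding power_add[symmetric] by (rule arg_cong[of _ _ "power (1 / 2)"]) simp
  ultimately show ?thesis by (simp only: psi_hat_def norm_mult)
qed

end

section \<open>The frame bounds\<close>

text \<open>A non-null function in \<open>H\<close> forces every lower bound below every upper
  bound, so \<open>Sup\<close> and \<open>Inf\<close> are taken over nonempty bounded sets.\<close>

lemma frame_bounds_from_inequalities:
  fixes H :: "('a::euclidean_space \<Rightarrow> complex) set"
  assumes nontrivial: "\<exists>f\<in>H. L2_norm f > 0" and sq: "\<And>i. i \<in> I \<Longrightarrow> square_integrable (g i)" and A: "0 < A"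
    and lower: "\<And>f. f \<in> H \<Longrightarrow> ennreal (A * (L2_norm f)\<^sup>2) \<le> frame_sum I g f"
    and upper: "\<And>f. f \<in> H \<Longrightarrow> frame_sum I g f \<le> ennreal (B * (L2_norm f)\<^sup>2)"
  shows "is_frame_for H I g" "A \<le> lower_frame_bound H I g"
    "lower_frame_bound H I g \<le> upper_frame_bound H I g" "upper_frame_bound H I g \<le> B"
proof -
  obtain f where f: "f \<in> H" "L2_norm f > 0" using nontrivial by blast
  \<comment> \<open>Here \<open>b\<close> is not assumed positive: positivity of \<open>B\<close>,
    required for membership in \<open>upper_frame_bounds\<close>, is deduced from A <= B.\<close>
  have le: "a \<le> b" if "a \<in> lower_frame_bounds H I g" "\<forall>f\<in>H. frame_sum I g f \<le> ennreal (b * (L2_norm f)\<^sup>2)" for a b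
  proof -
    have "ennreal (a * (L2_norm f)\<^sup>2) \<le> ennreal (b * (L2_norm f)\<^sup>2)"
      using that f by (auto simp: lower_frame_bounds_def intro: order_trans)
    moreover have "0 < a * (L2_norm f)\<^sup>2" using that f by (simp add: lower_frame_bounds_def)
    ultimately have "a * (L2_norm f)\<^sup>2 \<le> b * (L2_norm f)\<^sup>2" by (simp add: ennreal_le_iff2)
    then show ?thesis using f by simp
  qed
  have A_in: "A \<in> lower_frame_bounds H I g" using A lower by (simp add: lower_frame_bounds_def)
  have "A \<le> B" using le[OF A_in] upper by blast
  then have B_in: "B \<in> upper_frame_bounds H I g" using A upper by (simp add: upper_frame_bounds_def)
  have le': "a \<le> b" if "a \<in> lower_frame_bounds H I g" "b \<in> upper_frame_bounds H I g" for a b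
    using le that by (simp add: upper_frame_bounds_def)
  show "is_frame_for H I g"
    unfolding is_frame_for_def using sq A_in B_in \<open>A \<le> B\<close> by blast
  show "A \<le> lower_frame_bound H I g"
    unfolding lower_frame_bound_def
    by (rule cSup_upper[OF A_in]) (rule bdd_aboveI[of _ B], rule le'[OF _ B_in])
  show "upper_frame_bound H I g \<le> B"
    unfolding upper_frame_bound_def
    by (rule cInf_lower[OF B_in]) (rule bdd_belowI[of _ A], rule le'[OF A_in])
  show "lower_frame_bound H I g \<le> upper_frame_bound H I g"
    unfolding lower_frame_bound_def upper_frame_bound_def
    using A_in B_in by (intro cSup_least cInf_greatest le') auto
qed

lemma ennreal_mult_le_imp_le_divide:
  assumes "D > 0" "ennreal D * x \<le> ennreal a"
  shows "x \<le> ennreal (1 / D * a)"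
proof -
  have "ennreal (1 / D) * (ennreal D * x) \<le> ennreal (1 / D) * ennreal a"
    using assms by (intro mult_left_mono) auto
  moreover have "ennreal (1 / D) * ennreal D = 1" using assms by (simp add: ennreal_mult[symmetric])
  moreover have "ennreal (1 / D) * ennreal a = ennreal (1 / D * a)"
    using assms by (subst ennreal_mult'[symmetric]) auto
  ultimately show ?thesis by (simp add: mult.assoc[symmetric])
qed

lemma ennreal_le_mult_imp_divide_le:
  assumes "D > 0" "ennreal a \<le> ennreal D * x"
  shows "ennreal (1 / D * a) \<le> x"
proof -
  have "ennreal (1 / D) * ennreal a \<le> ennreal (1 / D) * (ennreal D * x)"
    using assms by (intro mult_left_mono) auto
  moreover have "ennreal (1 / D) * ennreal D = 1" using assms by (simp add: ennreal_mult[symmetric])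
  moreover have "ennreal (1 / D) * ennreal a = ennreal (1 / D * a)"
    using assms by (subst ennreal_mult'[symmetric]) auto
  ultimately show ?thesis by (simp add: mult.assoc[symmetric])
qed

text \<open>Since \<open>ennreal\<close> truncates at \<open>0\<close>, this is needed to exclude a negative \<open>Ls\<close> below.\<close>

lemma le_L_inf_imp_le_L_sup:
  assumes "z \<le> L_inf p" "z < \<infinity>"
  shows "z \<le> L_sup p"
proof (rule ccontr)
  assume z: "\<not> z \<le> L_sup p"
  have off_cone: "AE \<xi> in lborel. \<xi> \<notin> shear_cone"
    using AE_Phi_ge[OF assms] AE_Phi_le_L_sup[of p]
    by eventually_elim (use z in \<open>auto dest: order_trans\<close>)
  obtain f g where f: "L2_norm f > 0" and ft: "is_fourier_transform f g" and "ess_support g \<subseteq> shear_cone"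
    using L2_cone_nontrivial by (auto simp: L2_cone_def)
  from ess_support_AE_zero[OF this(3)] off_cone have "AE \<xi> in lborel. ennreal ((cmod (g \<xi>))\<^sup>2) = 0"
    by eventually_elim simp
  then have "sq_integral lborel g = (\<integral>\<^sup>+\<xi>. 0 \<partial>(lborel :: (real^2) measure))"
    by (rule nn_integral_cong_AE)
  then have "ennreal ((L2_norm f)\<^sup>2) = 0"
    using ft is_fourier_transform_norm[OF ft] L2_norm_square[of f] by (simp add: is_fourier_transform_def)
  then show False using f by simp
qed

text \<open>The hypothesis \<open>R_sum p c < ennreal Li\<close> acts twice: it makes R(c) finite,
  so that \<open>frame_sum_bounds\<close> applies, and it makes the lower frame bound
  positive.\<close>

lemma shearlet_frame_bounds:
  assumes p: "is_fourier_transform \<psi> p" and c: "0 < c $ 1" "0 < c $ 2"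
    and Gamma: "\<And>\<omega>. Gamma_sup p \<omega> < \<infinity>"
    and Li: "R_sum p c < ennreal Li" "ennreal Li \<le> L_inf p" and Ls: "L_sup p \<le> ennreal Ls"
  defines "S \<equiv> shearlet \<psi> c" and "D \<equiv> \<bar>det (samp_mat c)\<bar>"
  shows "is_frame_for L2_cone shearlet_index S"
    "1 / D * (Li - enn2real (R_sum p c)) \<le> lower_frame_bound L2_cone shearlet_index S"
    "lower_frame_bound L2_cone shearlet_index S \<le> upper_frame_bound L2_cone shearlet_index S"
    "upper_frame_bound L2_cone shearlet_index S \<le> 1 / D * (Ls + enn2real (R_sum p c))"
proof -
  have D: "D > 0" using c by (simp add: D_def det_samp_mat)
  have "R_sum p c < \<infinity>" using Li(1) by (auto intro: less_trans)
  then obtain R where R: "R_sum p c = ennreal R" "R \<ge> 0" by (cases "R_sum p c") auto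
  have RLi: "R < Li" using Li(1) R by (simp add: ennreal_less_iff)
  have L: "L_sup p < \<infinity>" using Ls by (auto intro: le_less_trans)
  have R_fin: "R_sum p c < \<infinity>" using R by simp
  have enn: "enn2real (R_sum p c) = R" using R by simp
  let ?n = "\<lambda>f. (L2_norm f)\<^sup>2"
  have low: "ennreal (1 / D * (Li - R) * ?n f) \<le> frame_sum shearlet_index S f" if f: "f \<in> L2_cone" for f
  proof -
    have "ennreal Li * ennreal (?n f) \<le> ennreal D * frame_sum shearlet_index S f + R_sum p c * ennreal (?n f)"
      unfolding D_def S_def by (rule frame_sum_bounds(2)[OF p f c Gamma R_fin L Li(2)]) simp
    then have *: "ennreal (Li * ?n f) \<le> ennreal (R * ?n f) + ennreal D * frame_sum shearlet_index S f"
      using R RLi by (simp add: ennreal_mult'' add.commute)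
    \<comment> \<open>Since \<open>R\<close> is finite, its term may be moved across the inequality
      by truncated subtraction.\<close>
    have "ennreal ((Li - R) * ?n f) = ennreal (Li * ?n f) - ennreal (R * ?n f)"
      using R by (subst ennreal_minus) (auto simp: left_diff_distrib)
    also have "\<dots> \<le> ennreal D * frame_sum shearlet_index S f"
      using * by (subst ennreal_minus_le_iff) auto
    finally show ?thesis
      using ennreal_le_mult_imp_divide_le[OF D, of "(Li - R) * ?n f"] by (simp add: mult.assoc)
  qed
  have up: "frame_sum shearlet_index S f \<le> ennreal (1 / D * (Ls + R) * ?n f)" if f: "f \<in> L2_cone" for f
  proof -
    have "ennreal D * frame_sum shearlet_index S f \<le> (L_sup p + R_sum p c) * ennreal (?n f)"
      unfolding D_def S_def by (rule frame_sum_bounds(1)[OF p f c Gamma R_fin L])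
    also have "\<dots> \<le> (ennreal (max 0 Ls) + ennreal R) * ennreal (?n f)"
      unfolding R using Ls by (intro mult_right_mono add_right_mono) (auto simp: max_def ennreal_neg)
    also have "\<dots> = ennreal ((max 0 Ls + R) * ?n f)" using R by (simp add: ennreal_mult)
    finally have 1: "ennreal D * frame_sum shearlet_index S f \<le> ennreal ((max 0 Ls + R) * ?n f)" .
    have "0 < ennreal Li" by (rule le_less_trans[OF _ Li(1)]) simp
    also have "\<dots> \<le> ennreal Ls" using le_L_inf_imp_le_L_sup[OF Li(2)] Ls by simp
    finally have "max 0 Ls = Ls" by simp
    with 1 show ?thesis
      using ennreal_mult_le_imp_le_divide[OF D, of "frame_sum shearlet_index S f" "(Ls + R) * ?n f"] by (simp add: mult.assoc)
  qed
  have sq: "square_integrable (S i)" for i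
    unfolding S_def using shearlet_transform[OF p] by (cases i) (auto simp: is_fourier_transform_def)
  note bounds = frame_bounds_from_inequalities[OF L2_cone_nontrivial sq _ low up]
  have pos: "0 < 1 / D * (Li - R)" using D RLi by simp
  show "is_frame_for L2_cone shearlet_index S" by (rule bounds(1)[OF pos])
  show "1 / D * (Li - enn2real (R_sum p c)) \<le> lower_frame_bound L2_cone shearlet_index S"
    unfolding enn by (rule bounds(2)[OF pos])
  show "lower_frame_bound L2_cone shearlet_index S \<le> upper_frame_bound L2_cone shearlet_index S"
    by (rule bounds(3)[OF pos])
  show "upper_frame_bound L2_cone shearlet_index S \<le> 1 / D * (Ls + enn2real (R_sum p c))"
    unfolding enn by (rule bounds(4)[OF pos])
qed

theorem theorem4p7:
  fixes K L :: nat
    and m0 m1 :: "real \<Rightarrow> complex"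
    and \<psi> :: "real^2 \<Rightarrow> complex"
  assumes "K > 0" and "L \<ge> 10"
    and "3 * real L / 2 \<le> real K" and "real K \<le> 3 * real L - 2"
    and "trig_poly \<real> m0" and "m0 0 = 1"
    and "\<And>x. (cmod (m0 x))\<^sup>2 =
          cos (pi * x) ^ (2 * K) *
          (\<Sum>n = 0..L - 1. real ((K - 1 + n) choose n) * sin (pi * x) ^ (2 * n))"
    and "trig_poly UNIV m1"
    and "\<And>x. (cmod (m1 x))\<^sup>2 = (cmod (m0 (x + 1 / 2)))\<^sup>2"
    and "is_fourier_transform \<psi> (psi_hat m0 m1)"
  shows "\<exists>chat1 > 0. \<forall>c :: real^2. 0 < c$1 \<and> 0 < c$2 \<and> c$2 \<le> c$1 \<and> c$1 \<le> chat1 \<longrightarrow>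
    (let p = psi_hat m0 m1;
         R = R_sum p c;
         A = lower_frame_bound L2_cone shearlet_index (shearlet \<psi> c);
         B = upper_frame_bound L2_cone shearlet_index (shearlet \<psi> c);
         D = \<bar>det (samp_mat c)\<bar>
     in is_frame_for L2_cone shearlet_index (shearlet \<psi> c) \<and>
        (\<exists>Li Ls :: real. R < ennreal Li \<and> ennreal Li \<le> L_inf p \<and> L_sup p \<le> ennreal Ls) \<and>
        (\<forall>Li Ls :: real. R < ennreal Li \<and> ennreal Li \<le> L_inf p \<and> L_sup p \<le> ennreal Ls \<longrightarrow>
           1 / D * (Li - enn2real R) \<le> A \<and> A \<le> B \<and> B \<le> 1 / D * (Ls + enn2real R)))"
proof -
  \<comment> \<open>From L >= 10 one gets 3L/2 >= L + 5, hence \<open>L + 5 \<le> K\<close>.\<close>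
  interpret daubechies_filter K L m0 m1 \<real>
    by unfold_locales (use assms in \<open>simp_all, linarith?\<close>)
  define p where "p = psi_hat m0 m1"
  have p: "is_fourier_transform \<psi> p" using assms(10) by (simp add: p_def)
  have pm: "p \<in> borel_measurable borel" by (rule is_fourier_transform_measurable(2)[OF p])
  define C :: real where "C = 2 ^ (3 * K + 7)"
  have C: "C \<ge> 0" "\<And>\<eta>. cmod (p \<eta>) \<le> C * (freq_weight (\<eta> $ 1) * decay_weight (\<eta> $ 2))"
    unfolding C_def p_def by (auto intro: psi_hat_decay)
  \<comment> \<open>The bound of \<open>psi_hat_lower\<close>, squared because \<open>Phi\<close> at
    shift 0 contains the square of the modulus. It does not depend on \<open>c\<close>.\<close>
  define Li where "Li = ((1 / 2 :: real) ^ (3 * K))\<^sup>2"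
  have Li: "Li > 0" "ennreal Li \<le> L_inf p"
    unfolding Li_def p_def by (auto intro!: L_inf_ge psi_hat_lower)
  have Gamma: "Gamma_sup p \<omega> < \<infinity>" for \<omega>
    using Gamma_sup_le[OF pm C, of \<omega>] by (rule le_less_trans) simp
  have Ls: "L_sup p \<le> ennreal (576 * C\<^sup>2)" by (rule L_sup_le[OF pm C])
  obtain Z where Z: "(\<integral>\<^sup>+m. ennreal (1 / max_abs (vec_of_int m) ^ 3) \<partial>count_space (UNIV - {0 :: int^2})) = ennreal Z" "Z \<ge> 0"
    using nn_integral_lattice_cube_finite by (cases "\<integral>\<^sup>+m. ennreal (1 / max_abs (vec_of_int m) ^ 3) \<partial>count_space (UNIV - {0 :: int^2})") auto
  \<comment> \<open>The minimum with 1 gives c_1^3 <= c_1, after which the linear bound (576 C^2 Z +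
    1) c_1 <= Li suffices. The added 1 keeps the denominator positive and makes the inequality
    strict.\<close>
  define chat where "chat = min 1 (Li / (576 * C\<^sup>2 * Z + 1))"
  have den: "0 < 576 * C\<^sup>2 * Z + 1" using Z by (simp add: add_nonneg_pos)
  have chat: "chat > 0" using Li den by (simp add: chat_def)
  have R_less: "R_sum p c < ennreal Li" if c: "0 < c $ 1" "0 < c $ 2" "c $ 2 \<le> c $ 1" "c $ 1 \<le> chat" for c
  proof -
    have "R_sum p c \<le> ennreal (576 * C\<^sup>2 * (c $ 1) ^ 3) * ennreal Z"
      using R_sum_le[OF pm C c(1-3)] unfolding Z .
    also have "\<dots> = ennreal (576 * C\<^sup>2 * Z * (c $ 1) ^ 3)"
      using Z c by (simp add: ennreal_mult[symmetric] mult_ac)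
    also have "\<dots> < ennreal Li"
    proof (rule ennreal_lessI[OF Li(1)])
      have "c $ 1 \<le> 1" using c by (simp add: chat_def)
      then have "(c $ 1) ^ 3 \<le> (c $ 1) ^ 1" using c by (intro power_decreasing) auto
      then have "576 * C\<^sup>2 * Z * (c $ 1) ^ 3 \<le> 576 * C\<^sup>2 * Z * c $ 1"
        using Z by (intro mult_left_mono) auto
      also have "\<dots> < (576 * C\<^sup>2 * Z + 1) * c $ 1" using c by (simp add: distrib_right)
      also have "\<dots> \<le> (576 * C\<^sup>2 * Z + 1) * (Li / (576 * C\<^sup>2 * Z + 1))"
        using c den by (intro mult_left_mono) (auto simp: chat_def)
      also have "\<dots> = Li" using den by simp
      finally show "576 * C\<^sup>2 * Z * (c $ 1) ^ 3 < Li" .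
    qed
    finally show ?thesis .
  qed
  show ?thesis
    unfolding Let_def p_def[symmetric]
  proof (rule exI[of _ chat], intro conjI allI impI chat)
    fix c :: "real^2" assume "0 < c $ 1 \<and> 0 < c $ 2 \<and> c $ 2 \<le> c $ 1 \<and> c $ 1 \<le> chat"
    then have c: "0 < c $ 1" "0 < c $ 2" "c $ 2 \<le> c $ 1" "c $ 1 \<le> chat" by auto
    show "is_frame_for L2_cone shearlet_index (shearlet \<psi> c)"
      by (rule shearlet_frame_bounds(1)[OF p c(1,2) Gamma R_less[OF c] Li(2) Ls])
    show "\<exists>Li Ls :: real. R_sum p c < ennreal Li \<and> ennreal Li \<le> L_inf p \<and> L_sup p \<le> ennreal Ls"
      using R_less[OF c] Li(2) Ls by blast
  next
    fix c :: "real^2" and Li Ls :: real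
    assume c: "0 < c $ 1 \<and> 0 < c $ 2 \<and> c $ 2 \<le> c $ 1 \<and> c $ 1 \<le> chat"
      and L: "R_sum p c < ennreal Li \<and> ennreal Li \<le> L_inf p \<and> L_sup p \<le> ennreal Ls"
    from c have c': "0 < c $ 1" "0 < c $ 2" by auto
    from L have L': "R_sum p c < ennreal Li" "ennreal Li \<le> L_inf p" "L_sup p \<le> ennreal Ls" by auto
    note frame = shearlet_frame_bounds[OF p c' Gamma L']
    show "1 / \<bar>det (samp_mat c)\<bar> * (Li - enn2real (R_sum p c)) \<le> lower_frame_bound L2_cone shearlet_index (shearlet \<psi> c)"
      by (rule frame(2))
    show "lower_frame_bound L2_cone shearlet_index (shearlet \<psi> c) \<le> upper_frame_bound L2_cone shearlet_index (shearlet \<psi> c)"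
      by (rule frame(3))
    show "upper_frame_bound L2_cone shearlet_index (shearlet \<psi> c) \<le> 1 / \<bar>det (samp_mat c)\<bar> * (Ls + enn2real (R_sum p c))"
      by (rule frame(4))
  qed
qed

end
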